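(* Let $k\in\mathbb N$ with $k>1$ and $\mathfrak z_1,\mathfrak z_2\in\mathbb H$. For all $m,n\in\mathbb N_0$, \[c^{\mathfrak z_2,+}_{2-2k,\mathfrak z_1}(-m-1,n)=-c^{\mathfrak z_1}_{2k,\mathfrak z_2}(-n-1,m).\]
   Context: $\mathbb H$ is the upper half-plane, $z=x+iy$. For $M=\begin{psmallmatrix}a&b\\c&d\end{psmallmatrix}\in\mathrm{SL}_2(\mathbb Z)$, $(f|_{\kappa}M)(z):=(cz+d)^{-\kappa}f(Mz)$. For $\varrho\in\mathbb H$ let $X_\varrho(z):=\frac{z-\varrho}{z-\overline\varrho}$ and $r_\varrho(z):=|X_\varrho(z)|$. For $0\le Z<1$, $a\in\mathbb N$, $b\in\mathbb Z$: $\beta(Z;a,b):=\int_0^Zt^{a-1}(1-t)^{b-1}dt$, $\mathcal C_{a,b}:=\sum_{0\le j\le a-1,\ j\ne-b}\binom{a-1}{j}\frac{(-1)^j}{j+b}$, and $\beta_0(Z;a,b):=\beta(Z;a,b)-\mathcal C_{a,b}$. Poincaré series: $\Psi^{\mathfrak z}_{2k,m}(z):=\sum_{M\in\mathrm{SL}_2(\mathbb Z)}\big((z-\overline{\mathfrak z})^{-2k}X_{\mathfrak z}^m(z)\big)\big|_{2k}M$ and $\mathbb P^{\mathfrak z}_{2-2k,m}(z):=\sum_{M\in\mathrm{SL}_2(\mathbb Z)}\big((z-\overline{\mathfrak z})^{2k-2}\beta(1-r_{\mathfrak z}^2(z);2k-1,-m)X_{\mathfrak z}^m(z)\big)\big|_{2-2k}M$.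 Elliptic expansions: a meromorphic function $f$ of weight $2k$ has near $\varrho$ an expansion $f(z)=(z-\overline\varrho)^{-2k}\sum_{n\gg-\infty}c_{f,\varrho}(n)X_\varrho^n(z)$. A function $F$ annihilated by $\Delta_{2-2k}:=-y^2(\partial_x^2+\partial_y^2)+2i(1-k)y(\partial_x+i\partial_y)$ in a punctured neighbourhood of $\varrho$ with $r_\varrho^{n_0}F$ bounded there ($n_0\in\mathbb N$) has a unique expansion, with $n_k:=\min(2k-2,n_0)$, \[F(z)=(z-\overline\varrho)^{2k-2}\Big(\sum_{n\ge-n_0}c^+_{F,\varrho}(n)X_\varrho^n+\sum_{n=0}^{n_k}c^-_{F,\varrho}(n)\beta(1-r_\varrho^2;2k-1,-n)X_\varrho^n+\sum_{n\le n_0,\ n\notin[0,n_k]}c^-_{F,\varrho}(n)\beta_0(1-r_\varrho^2;2k-1,-n)X_\varrho^n\Big);\] the coefficients $c^+_{F,\varrho}(n)$ are those of its meromorphic part. Notation: for $m\in-\mathbb N$, $c^{\mathfrak z_1}_{2k,\mathfrak z_2}(m,n)$ is the $n$th coefficient $c_{f,\mathfrak z_2}(n)$ of the elliptic expansion around $\varrho=\mathfrak z_2$ of $f=\Psi^{\mathfrak z_1}_{2k,m}$; and $c^{\mathfrak z_2,+}_{2-2k,\mathfrak z_1}(m,n)$ is the $n$th coefficient $c^+_{F,\mathfrak z_1}(n)$ of the meromorphic part of the elliptic expansion around $\varrho=\mathfrak z_1$ of $F=\mathcal C_{2k-1,-m}^{-1}\mathbb P^{\mathfrak z_2}_{2-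2k,m}$.
   Formalization: With the stated normalizations the identity fails when Im z1 ≠ Im z2 and the coefficients are nonzero; the right-hand side is corrected to −(Im z1/Im z2)·c^{z1}_{2k,z2}(−n−1,m), which agrees with the printed formula when Im z1 = Im z2. *)

theory Defs
  imports "HOL-Analysis.Analysis"
begin

definition SL2Z :: "(int^2^2) set" where
  "SL2Z = {M. det M = 1}"

definition moebius :: "int^2^2 \<Rightarrow> complex \<Rightarrow> complex" where
  "moebius M z = (of_int (M $ 1 $ 1) * z + of_int (M $ 1 $ 2)) /
                 (of_int (M $ 2 $ 1) * z + of_int (M $ 2 $ 2))"

definition slash :: "int \<Rightarrow> (complex \<Rightarrow> complex) \<Rightarrow> int^2^2 \<Rightarrow> complex \<Rightarrow> complex" where
  "slash \<kappa> f M z = (of_int (M $ 2 $ 1) * z + of_int (M $ 2 $ 2)) powi (-\<kappa>) * f (moebius M z)"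

definition ell_X :: "complex \<Rightarrow> complex \<Rightarrow> complex" where
  "ell_X \<rho> z = (z - \<rho>) / (z - cnj \<rho>)"

definition ell_r :: "complex \<Rightarrow> complex \<Rightarrow> real" where
  "ell_r \<rho> z = cmod (ell_X \<rho> z)"

definition inc_beta :: "real \<Rightarrow> nat \<Rightarrow> int \<Rightarrow> real" where
  "inc_beta Z a b = integral {0..Z} (\<lambda>t. t ^ (a - 1) * (1 - t) powi (b - 1))"

definition beta_const :: "nat \<Rightarrow> int \<Rightarrow> real" where
  "beta_const a b =
     (\<Sum>j\<in>{j\<in>{0..a - 1}. int j \<noteq> -b}. real ((a - 1) choose j) * (-1) ^ j / of_int (int j + b))"

definition inc_beta0 :: "real \<Rightarrow> nat \<Rightarrow> int \<Rightarrow> real" where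
  "inc_beta0 Z a b = inc_beta Z a b - beta_const a b"

text \<open>The sums over the modular group are unordered (hence absolutely convergent) sums; both
  matrices \<open>M\<close> and \<open>-M\<close> contribute. At a point where a summand has a pole, that summand takes the
  value 0 because of \<open>0 powi m = 0\<close> for negative \<open>m\<close>; the elliptic expansions below only look at
  punctured neighbourhoods.\<close>

definition Psi :: "nat \<Rightarrow> complex \<Rightarrow> int \<Rightarrow> complex \<Rightarrow> complex" where
  "Psi k \<zeta> m z =
     (\<Sum>\<^sub>\<infinity>M\<in>SL2Z. slash (2 * int k)
        (\<lambda>w. (w - cnj \<zeta>) powi (- 2 * int k) * ell_X \<zeta> w powi m) M z)"

definition PP :: "nat \<Rightarrow> complex \<Rightarrow> int \<Rightarrow> complex \<Rightarrow> complex" where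
  "PP k \<zeta> m z =
     (\<Sum>\<^sub>\<infinity>M\<in>SL2Z. slash (2 - 2 * int k)
        (\<lambda>w. (w - cnj \<zeta>) powi (2 * int k - 2)
              * of_real (inc_beta (1 - (ell_r \<zeta> w)\<^sup>2) (2 * k - 1) (-m))
              * ell_X \<zeta> w powi m) M z)"

definition has_elliptic_expansion ::
    "nat \<Rightarrow> (complex \<Rightarrow> complex) \<Rightarrow> complex \<Rightarrow> (int \<Rightarrow> complex) \<Rightarrow> bool" where
  "has_elliptic_expansion k f \<rho> c \<longleftrightarrow>
     (\<exists>N. \<forall>n<N. c n = 0) \<and>
     (\<forall>\<^sub>F z in at \<rho>. \<exists>S. ((\<lambda>n. c n * ell_X \<rho> z powi n) has_sum S) UNIV \<and>
        f z = (z - cnj \<rho>) powi (- 2 * int k) * S)"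

definition elliptic_coeff :: "nat \<Rightarrow> (complex \<Rightarrow> complex) \<Rightarrow> complex \<Rightarrow> int \<Rightarrow> complex" where
  "elliptic_coeff k f \<rho> = (THE c. has_elliptic_expansion k f \<rho> c)"

text \<open>Expansion in weight \<open>2 - 2k\<close> of a function \<open>F\<close> of growth order at most \<open>n0\<close> at \<open>\<rho>\<close>; \<open>cp\<close> and
  \<open>cm\<close> are the coefficients of the meromorphic and the non-meromorphic part. The coefficients \<open>cp n\<close>
  with \<open>n < - n0\<close> do not occur in the expansion and are set to 0.\<close>

definition has_harmonic_elliptic_expansion ::
    "nat \<Rightarrow> (complex \<Rightarrow> complex) \<Rightarrow> complex \<Rightarrow> nat \<Rightarrow> (int \<Rightarrow> complex) \<Rightarrow> (int \<Rightarrow> complex) \<Rightarrow> bool" where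
  "has_harmonic_elliptic_expansion k F \<rho> n0 cp cm \<longleftrightarrow>
     (let nk = int (min (2 * k - 2) n0) in
       Bfun (\<lambda>z. of_real (ell_r \<rho> z ^ n0) * F z) (at \<rho>) \<and>
       (\<forall>n < - int n0. cp n = 0) \<and>
       (\<forall>\<^sub>F z in at \<rho>. \<exists>S T.
          ((\<lambda>n. cp n * ell_X \<rho> z powi n) has_sum S) {- int n0..} \<and>
          ((\<lambda>n. cm n * of_real (inc_beta0 (1 - (ell_r \<rho> z)\<^sup>2) (2 * k - 1) (-n)) * ell_X \<rho> z powi n)
             has_sum T) {n. n \<le> int n0 \<and> n \<notin> {0..nk}} \<and>
          F z = (z - cnj \<rho>) powi (2 * int k - 2) *
            (S
             + (\<Sum>n=0..nk. cm n * of_real (inc_beta (1 - (ell_r \<rho> z)\<^sup>2) (2 * k - 1) (-n))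
                           * ell_X \<rho> z powi n)
             + T)))"

text \<open>The meromorphic part does not depend on the admissible growth order \<open>n0\<close>.\<close>

definition elliptic_coeff_plus :: "nat \<Rightarrow> (complex \<Rightarrow> complex) \<Rightarrow> complex \<Rightarrow> int \<Rightarrow> complex" where
  "elliptic_coeff_plus k F \<rho> =
     (THE cp. \<exists>n0>0. \<exists>cm. has_harmonic_elliptic_expansion k F \<rho> n0 cp cm)"

definition Psi_coeff :: "nat \<Rightarrow> complex \<Rightarrow> complex \<Rightarrow> int \<Rightarrow> int \<Rightarrow> complex" where
  "Psi_coeff k z1 z2 m n = elliptic_coeff k (Psi k z1 m) z2 n"

text \<open>The expansions at \<open>\<rho>\<close> are not normalised by the height of \<open>\<rho>\<close>: since
  \<open>dX/dz = 2 i Im \<rho> / (z - cnj \<rho>)^2\<close> for \<open>X = ell_X \<rho>\<close>, the residue at \<open>\<rho>\<close> of a product of forms of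
  weights \<open>2k\<close> and \<open>2 - 2k\<close> is \<open>1 / (2 i Im \<rho>)\<close> times the coefficient of \<open>1/X\<close> in the product of
  their expansions. This is the source of the factor \<open>Im z1 / Im z2\<close> in the duality between
  \<open>Psi_coeff\<close> and \<open>PP_coeff\<close>.\<close>

definition PP_coeff :: "nat \<Rightarrow> complex \<Rightarrow> complex \<Rightarrow> int \<Rightarrow> int \<Rightarrow> complex" where
  "PP_coeff k z2 z1 m n =
     elliptic_coeff_plus k (\<lambda>z. inverse (of_real (beta_const (2 * k - 1) (-m))) * PP k z2 m z) z1 n"

end

theory Submission
  imports Defs "HOL-Complex_Analysis.Complex_Analysis"
begin

text \<open>The duality holds term by term, the matrix \<open>M\<close> on one side being paired with its inverse on
  the other. In the coordinate \<open>X\<close> around \<open>\<rho>\<close> the numerator and denominator of the Moebius image become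
  the linear forms \<open>p - cnj q * X\<close> and \<open>q - cnj p * X\<close>, where \<open>p\<close> and \<open>q\<close> depend on \<open>M\<close> and
  \<open>|q|^2 - |p|^2 = 4 Im \<zeta> Im \<rho>\<close>. A term of the weight \<open>2 - 2k\<close> series is a function of \<open>X\<close> and
  \<open>Y = cnj X\<close>, treated as independent variables: its value at \<open>Y = 0\<close> is the meromorphic part, and
  its \<open>Y\<close>-derivative is \<open>(1 - X Y)^(2k-2)\<close> times a holomorphic function of \<open>Y\<close>, whose
  Taylor series yields the incomplete beta functions. The normalised incomplete beta function is
  \<open>(1 - v)^(2k-1)\<close> times a truncated binomial series in \<open>v\<close>, so the meromorphic part becomes rational
  in \<open>X\<close>, and the coefficient identity reduces to a symmetry of the coefficients of quotients of
  linear forms. Sums over the modular group are exchanged with the expansions by Cauchy's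
  estimate and the convergence of the sum of \<open>|q|^(-2k)\<close>; the expansions are unique because
  Fourier coefficients on the circles \<open>|X| = r\<close> are.\<close>

section \<open>Families of power series\<close>

text \<open>A summand of weight \<open>2 - 2k\<close> carries a factor of size \<open>|q|^N\<close>,
  \<open>N = 2k - 2\<close>, so its convergence is not visible. The incomplete beta factor repairs
  this: it is of order \<open>N + 1\<close> in \<open>1 - r^2\<close>, and \<open>1 - r^2\<close> at
  the image point has size \<open>|q|^(-2)\<close>. Hence both series are dominated by the sum of
  \<open>|q|^(-N-2)\<close>. Expanding under the sum needs one radius for all matrices, although a
  summand has its pole at \<open>X = p / cnj q\<close>; this is why \<open>|p| / |q|\<close> is
  bounded below over the matrices with \<open>p \<noteq> 0\<close>. If \<open>p = 0\<close>, the
  pole sits at the centre, and the meromorphic part of the summand is a multiple of one negative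
  power of \<open>X\<close>. Such matrices leave the coefficients of nonnegative index alone. The
  symmetry of coefficients is that of a generating function:
  \<open>(a - b X)^j / (c - d X)^(j+1)\<close> is the coefficient of \<open>Y^j\<close> in
  \<open>1 / (c - d X - a Y + b X Y)\<close>, where swapping \<open>X\<close> with \<open>Y\<close>
  swaps \<open>a\<close> with \<open>d\<close>. The inverse matrix has \<open>- p\<close> and
  \<open>- cnj q\<close> in place of \<open>p\<close> and \<open>q\<close>, and so swaps
  \<open>q\<close> with \<open>cnj q\<close> in the quotients of linear forms.\<close>

definition taylor_coeff :: "(complex \<Rightarrow> complex) \<Rightarrow> nat \<Rightarrow> complex" where
  "taylor_coeff f n = (deriv ^^ n) f 0 / fact n"

lemma taylor_coeff_eq_fps_nth:
  "f has_fps_expansion F \<Longrightarrow> taylor_coeff f n = fps_nth F n"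
  by (simp add: taylor_coeff_def fps_nth_fps_expansion)

lemma taylor_coeff_sums:
  assumes "f holomorphic_on ball 0 R" "norm z < R"
  shows "(\<lambda>n. taylor_coeff f n * z ^ n) sums f z"
  using holomorphic_power_series[OF assms(1), of z] assms(2) by (simp add: taylor_coeff_def)

lemma norm_taylor_coeff_le:
  assumes hol: "f holomorphic_on ball 0 R" and bound: "\<And>z. z \<in> ball 0 R \<Longrightarrow> norm (f z) \<le> K"
    and r: "0 < r" "r < R"
  shows "norm (taylor_coeff f n) \<le> K / r ^ n"
proof -
  have sub: "ball 0 r \<subseteq> ball (0::complex) R" "cball 0 r \<subseteq> ball (0::complex) R" using r by auto
  have "norm ((deriv ^^ n) f 0) \<le> fact n * K / r ^ n"
  proof (rule Cauchy_inequality)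
    show "f holomorphic_on ball 0 r" using hol sub(1) by (rule holomorphic_on_subset)
    show "continuous_on (cball 0 r) f"
      using holomorphic_on_imp_continuous_on[OF hol] sub(2) by (rule continuous_on_subset)
  qed (use r in \<open>auto intro!: bound\<close>)
  then show ?thesis
    using r by (simp add: taylor_coeff_def norm_divide field_simps)
qed

text \<open>Cauchy's estimate on a radius \<open>r\<close> strictly between \<open>s\<close> and
  \<open>R\<close> dominates the double family by \<open>K i * C * (s / r) ^ n\<close>. The weights
  \<open>w\<close> are general because the antiholomorphic part is expanded in functions other than
  powers.\<close>

lemma family_power_series_summable:
  fixes h :: "'i \<Rightarrow> complex \<Rightarrow> complex" and w :: "nat \<Rightarrow> complex"
  assumes hol: "\<And>i. i \<in> A \<Longrightarrow> h i holomorphic_on ball 0 R"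
    and bound: "\<And>i z. i \<in> A \<Longrightarrow> z \<in> ball 0 R \<Longrightarrow> norm (h i z) \<le> K i"
    and K: "K summable_on A"
    and w: "\<And>n. norm (w n) \<le> C * s ^ n" and s: "0 \<le> s" "s < R"
  shows "(\<lambda>(i, n). taylor_coeff (h i) n * w n) summable_on (A \<times> UNIV)"
proof -
  obtain r where r: "s < r" "r < R" using s dense by blast
  have r0: "r > 0" using r s by simp
  have C0: "C \<ge> 0" using order_trans[OF norm_ge_zero w[of 0]] by simp
  have K0: "K i \<ge> 0" if "i \<in> A" for i
    using order_trans[OF norm_ge_zero bound[OF that, of 0]] s by simp
  have geo: "((\<lambda>n. (s / r) ^ n) has_sum (1 / (1 - s / r))) UNIV"
    by (rule sums_nonneg_imp_has_sum, rule geometric_sums) (use r r0 s in auto)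
  have "(\<lambda>(i, n). K i * C * (s / r) ^ n) summable_on (A \<times> UNIV)"
  proof (rule summable_on_SigmaI)
    show "((\<lambda>n. case (i, n) of (i, n) \<Rightarrow> K i * C * (s / r) ^ n) has_sum (K i * C * (1 / (1 - s / r)))) UNIV"
      for i using has_sum_cmult_right[OF geo, of "K i * C"] by simp
    show "(\<lambda>i. K i * C * (1 / (1 - s / r))) summable_on A"
      using K by (intro summable_on_cmult_left)
  qed (use K0 C0 s r0 in auto)
  then have "(\<lambda>p. norm ((\<lambda>(i, n). taylor_coeff (h i) n * w n) p)) summable_on (A \<times> UNIV)"
  proof (rule Infinite_Sum.abs_summable_on_comparison_test')
    fix p :: "'i \<times> nat" assume "p \<in> A \<times> UNIV"
    then obtain i n where p: "p = (i, n)" "i \<in> A" by auto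
    have "norm (taylor_coeff (h i) n) * norm (w n) \<le> (K i / r ^ n) * (C * s ^ n)"
      using norm_taylor_coeff_le[OF hol[OF p(2)] bound[OF p(2)] r0 r(2), of n] w[of n] K0[OF p(2)] r0
      by (intro mult_mono) auto
    then show "norm ((\<lambda>(i, n). taylor_coeff (h i) n * w n) p) \<le> (\<lambda>(i, n). K i * C * (s / r) ^ n) p"
      using p by (simp add: norm_mult power_divide mult_ac)
  qed
  then show ?thesis by (rule abs_summable_summable)
qed

text \<open>Fubini for the absolutely summable double family. The inner sums \<open>V i\<close> are
  prescribed by a hypothesis, since for general weights they are not values of
  \<open>h i\<close>.\<close>

lemma family_power_series:
  fixes h :: "'i \<Rightarrow> complex \<Rightarrow> complex" and w :: "nat \<Rightarrow> complex"
  assumes hol: "\<And>i. i \<in> A \<Longrightarrow> h i holomorphic_on ball 0 R"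
    and bound: "\<And>i z. i \<in> A \<Longrightarrow> z \<in> ball 0 R \<Longrightarrow> norm (h i z) \<le> K i"
    and K: "K summable_on A"
    and w: "\<And>n. norm (w n) \<le> C * s ^ n" and s: "0 \<le> s" "s < R"
    and V: "\<And>i. i \<in> A \<Longrightarrow> (\<lambda>n. taylor_coeff (h i) n * w n) sums V i"
  shows "V summable_on A"
    and "((\<lambda>n. (\<Sum>\<^sub>\<infinity>i\<in>A. taylor_coeff (h i) n) * w n) has_sum (\<Sum>\<^sub>\<infinity>i\<in>A. V i)) UNIV"
proof -
  let ?f = "\<lambda>i n. taylor_coeff (h i) n * w n"
  have sm: "(\<lambda>(i, n). ?f i n) summable_on (A \<times> UNIV)"
    by (rule family_power_series_summable[OF hol bound K w s])
  have inner: "(?f i has_sum V i) UNIV" if "i \<in> A" for i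
  proof -
    have "?f i summable_on UNIV" using summable_on_SigmaD1[OF sm that] .
    then obtain S where S: "(?f i has_sum S) UNIV" by (auto simp: summable_on_def)
    then show ?thesis using V[OF that] has_sum_imp_sums sums_unique2 by metis
  qed
  obtain T where T: "((\<lambda>(i, n). ?f i n) has_sum T) (A \<times> UNIV)"
    using sm by (auto simp: summable_on_def)
  have VT: "(V has_sum T) A"
    by (rule has_sum_SigmaD[OF T]) (use inner in auto)
  then show "V summable_on A" by (auto simp: summable_on_def)
  have sw: "((\<lambda>(n, i). ?f i n) has_sum T) (UNIV \<times> A)"
    using iffD1[OF has_sum_swap T] by simp
  have cs: "(\<lambda>i. taylor_coeff (h i) n) summable_on A" for n
  proof -
    have R0: "R > 0" using s by simp
    have "norm (taylor_coeff (h i) n) \<le> K i / (R / 2) ^ n" if "i \<in> A" for i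
      using norm_taylor_coeff_le[OF hol[OF that] bound[OF that], of "R / 2" n] R0 by simp
    moreover have "(\<lambda>i. K i / (R / 2) ^ n) summable_on A"
      using summable_on_cmult_left[OF K, of "inverse ((R / 2) ^ n)"] by (simp only: divide_inverse)
    ultimately have "(\<lambda>i. norm (taylor_coeff (h i) n)) summable_on A"
      using Infinite_Sum.abs_summable_on_comparison_test'[of "\<lambda>i. K i / (R / 2) ^ n" A "\<lambda>i. taylor_coeff (h i) n"]
      by blast
    then show ?thesis by (rule abs_summable_summable)
  qed
  have "((\<lambda>n. \<Sum>\<^sub>\<infinity>i\<in>A. ?f i n) has_sum T) UNIV"
  proof (rule has_sum_SigmaD[OF sw])
    show "((\<lambda>i. (\<lambda>(n, i). ?f i n) (n, i)) has_sum (\<Sum>\<^sub>\<infinity>i\<in>A. ?f i n)) A" for n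
      using summable_on_cmult_left[OF cs[of n], of "w n"] by (simp add: has_sum_infsum)
  qed
  moreover have "(\<Sum>\<^sub>\<infinity>i\<in>A. ?f i n) = (\<Sum>\<^sub>\<infinity>i\<in>A. taylor_coeff (h i) n) * w n" for n
    using infsum_cmult_left[OF cs] by blast
  moreover have "T = (\<Sum>\<^sub>\<infinity>i\<in>A. V i)" using VT by (simp add: infsumI)
  ultimately show "((\<lambda>n. (\<Sum>\<^sub>\<infinity>i\<in>A. taylor_coeff (h i) n) * w n) has_sum (\<Sum>\<^sub>\<infinity>i\<in>A. V i)) UNIV"
    by simp
qed

section \<open>Uniqueness of Fourier coefficients on a circle\<close>

lemma has_integral_cis_multiple:
  "((\<lambda>t. cis (real_of_int l * t)) has_integral (if l = 0 then of_real (2 * pi) else 0)) {0..2*pi}"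
proof (cases "l = 0")
  case True
  then show ?thesis using has_integral_const_real[of "1::complex" 0 "2*pi"] by (simp add: scaleR_conv_of_real)
next
  case False
  let ?F = "\<lambda>t. cis (real_of_int l * t) / (\<i> * of_int l)"
  have "((\<lambda>t. cis (real_of_int l * t)) has_integral ?F (2*pi) - ?F 0) {0..2*pi}"
  proof (rule fundamental_theorem_of_calculus)
    fix t :: real
    have "((\<lambda>z. exp (\<i> * of_int l * z) / (\<i> * of_int l)) has_field_derivative
             exp (\<i> * of_int l * of_real t)) (at (of_real t))"
      using False by (auto intro!: derivative_eq_intros)
    from has_vector_derivative_real_field[OF this]
    show "(?F has_vector_derivative cis (real_of_int l * t)) (at t within {0..2*pi})"
      by (simp add: cis_conv_exp mult_ac)
  qed simp
  moreover have "?F (2*pi) - ?F 0 = 0"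
    using cis_multiple_2pi[of "real_of_int l"] by (simp add: mult_ac)
  ultimately show ?thesis using False by simp
qed

text \<open>Only a finite partial sum is integrated. Outside a suitable finite \<open>F\<close>
  containing \<open>m\<close> the coefficients have total mass below \<open>|e m| / 2\<close>; as
  the full sum is 0, the partial sum over \<open>F\<close> is bounded by the same number, yet its
  \<open>m\<close>-th Fourier coefficient is \<open>e m\<close>.\<close>

lemma has_sum_circle_zero_imp_zero:
  fixes e :: "int \<Rightarrow> complex"
  assumes sum0: "\<And>t. ((\<lambda>n. e n * cis (real_of_int n * t)) has_sum 0) UNIV"
  shows "e m = 0"
proof (rule ccontr)
  assume "e m \<noteq> 0"
  define \<epsilon> where "\<epsilon> = norm (e m) / 2"
  have \<epsilon>: "\<epsilon> > 0" using \<open>e m \<noteq> 0\<close> by (simp add: \<epsilon>_def)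
  have "e summable_on UNIV" using sum0[of 0] by (auto simp: summable_on_def)
  then have abs: "(\<lambda>n. norm (e n)) summable_on UNIV"
    by (simp add: summable_on_iff_abs_summable_on_complex)
  obtain F where F: "finite F" "m \<in> F" "(\<Sum>\<^sub>\<infinity>n\<in>-F. norm (e n)) < \<epsilon>"
  proof -
    have "((\<lambda>n. norm (e n)) has_sum (\<Sum>\<^sub>\<infinity>n. norm (e n))) UNIV" using abs by (rule has_sum_infsum)
    then have "eventually (\<lambda>F. dist (\<Sum>n\<in>F. norm (e n)) (\<Sum>\<^sub>\<infinity>n. norm (e n)) < \<epsilon>) (finite_subsets_at_top UNIV)"
      unfolding has_sum_def using \<epsilon> by (auto simp: tendsto_iff)
    then obtain G where G: "finite G"
      "\<And>F. finite F \<Longrightarrow> G \<subseteq> F \<Longrightarrow> dist (\<Sum>n\<in>F. norm (e n)) (\<Sum>\<^sub>\<infinity>n. norm (e n)) < \<epsilon>"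
      unfolding eventually_finite_subsets_at_top by auto
    define F where "F = insert m G"
    have fin: "finite F" using G(1) by (simp add: F_def)
    have "(\<Sum>\<^sub>\<infinity>n. norm (e n)) = (\<Sum>n\<in>F. norm (e n)) + (\<Sum>\<^sub>\<infinity>n\<in>-F. norm (e n))"
      using infsum_Un_disjoint[of "\<lambda>n. norm (e n)" F "-F"] abs fin
      by (simp add: summable_on_subset_banach[OF abs])
    then have "(\<Sum>\<^sub>\<infinity>n\<in>-F. norm (e n)) < \<epsilon>"
      using G(2)[OF fin] by (auto simp: F_def dist_real_def abs_less_iff)
    then show ?thesis using that[OF fin] by (auto simp: F_def)
  qed
  have tail: "norm (\<Sum>n\<in>F. e n * cis (real_of_int n * t)) \<le> \<epsilon>" for t
  proof -
    let ?g = "\<lambda>n. e n * cis (real_of_int n * t)"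
    have sg: "?g summable_on B" for B
      using summable_on_subset_banach[of ?g UNIV B] sum0[of t] by (auto simp: summable_on_def)
    have "0 = infsum ?g F + infsum ?g (-F)"
      using infsum_Un_disjoint[of ?g F "-F"] sg infsumI[OF sum0[of t]] by simp
    then have "norm (sum ?g F) = norm (infsum ?g (-F))"
      using F(1) by (simp add: add_eq_0_iff)
    also have "\<dots> \<le> (\<Sum>\<^sub>\<infinity>n\<in>-F. norm (?g n))"
      by (rule norm_infsum_bound) (simp add: norm_mult summable_on_subset_banach[OF abs])
    also have "\<dots> = (\<Sum>\<^sub>\<infinity>n\<in>-F. norm (e n))" by (simp add: norm_mult)
    finally show ?thesis using F(3) by simp
  qed
  let ?s = "\<lambda>t. \<Sum>n\<in>F. e n * cis (real_of_int (n - m) * t)"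
  have int: "(?s has_integral (\<Sum>n\<in>F. e n * (if n - m = 0 then of_real (2 * pi) else 0))) {0..2*pi}"
    by (intro has_integral_sum F(1) has_integral_mult_right has_integral_cis_multiple)
  have "(\<Sum>n\<in>F. e n * (if n - m = 0 then complex_of_real (2 * pi) else 0)) = e m * of_real (2 * pi)"
    using F(1,2) by (simp add: if_distrib cong: if_cong)
  then have int: "(?s has_integral (e m * of_real (2 * pi))) (cbox 0 (2*pi))" using int by simp
  have "norm (e m * complex_of_real (2 * pi)) \<le> \<epsilon> * measure lborel (cbox (0::real) (2*pi))"
  proof (rule has_integral_bound[OF _ int])
    fix t :: real
    have "?s t = cis (- real_of_int m * t) * (\<Sum>n\<in>F. e n * cis (real_of_int n * t))"
    proof -
      have "e n * cis (real_of_int (n - m) * t) = cis (- real_of_int m * t) * (e n * cis (real_of_int n * t))" for n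
      proof -
        have "cis (- real_of_int m * t) * cis (real_of_int n * t) = cis (real_of_int (n - m) * t)"
          by (subst cis_mult) (simp add: algebra_simps)
        then show ?thesis by (metis mult.left_commute)
      qed
      then show ?thesis by (simp only: sum_distrib_left)
    qed
    then show "norm (?s t) \<le> \<epsilon>" using tail[of t] by (simp add: norm_mult)
  qed (use \<epsilon> in simp)
  then show False using \<open>e m \<noteq> 0\<close> by (simp add: \<epsilon>_def norm_mult)
qed

text \<open>A single circle is involved, so the coefficients may themselves depend on
  \<open>r\<close>. The harmonic expansion relies on this, its coefficients containing beta
  functions of \<open>1 - r^2\<close>.\<close>

lemma has_sum_circle_unique:
  fixes a b :: "int \<Rightarrow> complex"
  assumes r: "r > 0"
    and a: "\<And>X. norm X = r \<Longrightarrow> ((\<lambda>n. a n * X powi n) has_sum S X) UNIV"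
    and b: "\<And>X. norm X = r \<Longrightarrow> ((\<lambda>n. b n * X powi n) has_sum S X) UNIV"
  shows "a n = b n"
proof -
  define e where "e n = (a n - b n) * of_real (r powi n)" for n
  have "((\<lambda>n. e n * cis (real_of_int n * t)) has_sum 0) UNIV" for t
  proof -
    let ?X = "of_real r * cis t"
    have nX: "norm ?X = r" using r by (simp add: norm_mult)
    have "((\<lambda>n. a n * ?X powi n + - (b n * ?X powi n)) has_sum (S ?X + - S ?X)) UNIV"
      by (intro has_sum_add has_sum_uminusI) (use a[OF nX] b[OF nX] in auto)
    moreover have "?X powi n = of_real (r powi n) * cis (real_of_int n * t)" for n
      by (simp add: power_int_mult_distrib cis_power_int)
    ultimately show ?thesis by (simp add: e_def algebra_simps)
  qed
  from has_sum_circle_zero_imp_zero[OF this, of n] show ?thesis using r by (simp add: e_def)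
qed

section \<open>Primitives of a power series against a polynomial weight\<close>

lemma divide_le_self:
  fixes x y :: real
  assumes "0 \<le> x" "1 \<le> y"
  shows "x / y \<le> x"
  using divide_left_mono[of 1 y x] assms by simp

text \<open>\<open>W n\<close> is the primitive of \<open>Y ^ n * (1 - X * Y) ^ N\<close> vanishing
  at 0, so this is termwise integration of the Taylor series of \<open>g\<close> against the weight.
  At \<open>Y = cnj X\<close> these primitives become the incomplete beta functions.\<close>

lemma weighted_power_series_primitive:
  fixes \<Phi> g :: "complex \<Rightarrow> complex" and N :: nat and X :: complex
  assumes g: "g holomorphic_on ball 0 R" and gb: "\<And>z. z \<in> ball 0 R \<Longrightarrow> norm (g z) \<le> K"
    and s: "0 < s" "s < R" "s \<le> 1" and X: "norm X \<le> 1"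
    and \<Phi>: "\<And>Y. norm Y < s \<Longrightarrow> (\<Phi> has_field_derivative (1 - X * Y) ^ N * g Y) (at Y)"
    and Y: "norm Y < s"
  defines "W \<equiv> \<lambda>n Y. \<Sum>i\<le>N. of_nat (N choose i) * (-1) ^ i * X ^ i * Y ^ (n + i + 1) / of_nat (n + i + 1)"
  shows "\<And>n. norm (W n Y) \<le> 2 ^ N * s ^ n"
    and "(\<lambda>n. taylor_coeff g n * W n Y) sums (\<Phi> Y - \<Phi> 0)"
proof -
  have Wb: "norm (W n Y) \<le> 2 ^ N * s ^ n" if Y: "norm Y < s" for n Y
  proof -
    have "norm (W n Y) \<le> (\<Sum>i\<le>N. of_nat (N choose i) * s ^ n)"
      unfolding W_def
    proof (rule sum_norm_le)
      fix i assume "i \<in> {..N}"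
      have "norm (X ^ i * Y ^ (n + i + 1) / of_nat (n + i + 1)) \<le> s ^ n"
      proof -
        have "norm X ^ i \<le> 1" using X by (simp add: power_le_one)
        moreover have "norm Y ^ (n + i + 1) \<le> s ^ (n + i + 1)" using Y by (intro power_mono) auto
        moreover have "s ^ (n + i + 1) \<le> s ^ n" using s by (intro power_decreasing) auto
        ultimately have "norm X ^ i * norm Y ^ (n + i + 1) \<le> 1 * s ^ n"
          by (intro mult_mono) auto
        moreover have "norm X ^ i * norm Y ^ (n + i + 1) / real (n + i + 1) \<le> norm X ^ i * norm Y ^ (n + i + 1)"
          by (rule divide_le_self) auto
        moreover have "norm (complex_of_nat (n + i + 1)) = real (n + i + 1)" by (rule norm_of_nat)
        ultimately show ?thesis by (metis (no_types, lifting) mult_1 norm_divide norm_mult norm_power order_trans)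
      qed
      then have "real (N choose i) * norm (X ^ i * Y ^ (n + i + 1) / of_nat (n + i + 1)) \<le> real (N choose i) * s ^ n"
        by (intro mult_left_mono) auto
      then show "norm (of_nat (N choose i) * (-1) ^ i * X ^ i * Y ^ (n + i + 1) / of_nat (n + i + 1))
          \<le> real (N choose i) * s ^ n"
        by (simp add: norm_mult norm_power norm_divide mult.assoc del: of_nat_add of_nat_Suc)
    qed
    also have "\<dots> = 2 ^ N * s ^ n"
      by (simp add: sum_distrib_right[symmetric] of_nat_sum[symmetric] choose_row_sum del: of_nat_sum)
    finally show ?thesis .
  qed
  then show "norm (W n Y) \<le> 2 ^ N * s ^ n" for n using Y by blast
  obtain r where r: "s < r" "r < R" using s dense by blast
  have r0: "r > 0" using r s by simp
  have dW: "(W n has_field_derivative Y ^ n * (1 - X * Y) ^ N) (at Y)" for n Y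
  proof -
    have "((\<lambda>Y. of_nat (N choose i) * (-1) ^ i * X ^ i * Y ^ (n + i + 1) / of_nat (n + i + 1))
           has_field_derivative of_nat (N choose i) * (-1) ^ i * X ^ i * Y ^ (n + i)) (at Y)" for i
    proof -
      let ?d = "of_nat (Suc (n + i)) :: complex"
      have "((\<lambda>Y. Y ^ Suc (n + i)) has_field_derivative ?d * Y ^ (n + i)) (at Y)"
        using DERIV_power[OF DERIV_ident, where n = "Suc (n + i)" and x = Y and s = UNIV] by (simp del: of_nat_Suc power_Suc)
      from DERIV_cdivide[OF DERIV_cmult[OF this, of "of_nat (N choose i) * (-1) ^ i * X ^ i"], of ?d]
      have "((\<lambda>Y. of_nat (N choose i) * (-1) ^ i * X ^ i * Y ^ Suc (n + i) / ?d)
          has_field_derivative of_nat (N choose i) * (-1) ^ i * X ^ i * (?d * Y ^ (n + i)) / ?d) (at Y)" .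
      moreover have "of_nat (N choose i) * (-1) ^ i * X ^ i * (?d * Y ^ (n + i)) / ?d =
          of_nat (N choose i) * (-1) ^ i * X ^ i * Y ^ (n + i)"
        using of_nat_neq_0[of "n + i", where 'a = complex] by (simp del: of_nat_Suc)
      ultimately show ?thesis by (simp only: Suc_eq_plus1)
    qed
    then have "(W n has_field_derivative (\<Sum>i\<le>N. of_nat (N choose i) * (-1) ^ i * X ^ i * Y ^ (n + i))) (at Y)"
      unfolding W_def by (rule DERIV_sum)
    moreover have "(\<Sum>i\<le>N. of_nat (N choose i) * (-1) ^ i * X ^ i * Y ^ (n + i)) = Y ^ n * (1 - X * Y) ^ N"
    proof -
      have "(1 - X * Y) ^ N = (- (X * Y) + 1) ^ N" by simp
      also have "\<dots> = (\<Sum>i\<le>N. of_nat (N choose i) * (- (X * Y)) ^ i)"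
        using binomial_ring[where a = "- (X * Y)" and b = 1 and n = N] by simp
      finally have "Y ^ n * (1 - X * Y) ^ N = (\<Sum>i\<le>N. Y ^ n * (of_nat (N choose i) * (- (X * Y)) ^ i))"
        by (simp only: sum_distrib_left)
      also have "\<dots> = (\<Sum>i\<le>N. of_nat (N choose i) * (-1) ^ i * X ^ i * Y ^ (n + i))"
        by (intro sum.cong refl) (simp add: power_add power_mult_distrib power_minus[of "X * Y"])
      finally show ?thesis by (rule sym)
    qed
    ultimately show ?thesis by simp
  qed
  define h where "h n = K / r ^ n * (2 ^ N * s ^ n)" for n
  have "summable h"
  proof -
    have "summable (\<lambda>n. K * 2 ^ N * (s / r) ^ n)"
      using r r0 s by (intro summable_mult summable_geometric) auto
    then show ?thesis unfolding h_def by (simp add: power_divide mult_ac)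
  qed
  have hb: "norm (taylor_coeff g n * W n Y) \<le> h n" if "Y \<in> ball 0 s" for n Y
  proof -
    have K0: "K \<ge> 0" using order_trans[OF norm_ge_zero gb[of 0]] s by simp
    have "norm (taylor_coeff g n) * norm (W n Y) \<le> K / r ^ n * (2 ^ N * s ^ n)"
      using norm_taylor_coeff_le[OF g gb r0 r(2), of n] Wb[of Y n] K0 r0 that
      by (intro mult_mono) auto
    then show ?thesis by (simp add: h_def norm_mult)
  qed
  \<comment> \<open>The geometric majorant \<open>h\<close> allows termwise differentiation; the
    resulting sum \<open>G\<close> has the derivative of \<open>\<Phi>\<close>, so the two differ by
    a constant on the disc.\<close>
  obtain G G' where G: "\<forall>Y\<in>ball 0 s. (\<lambda>n. taylor_coeff g n * W n Y) sums G Y \<and>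
      (\<lambda>n. taylor_coeff g n * (Y ^ n * (1 - X * Y) ^ N)) sums G' Y \<and> (G has_field_derivative G' Y) (at Y)"
  proof (rule series_and_derivative_comparison[OF open_ball \<open>summable h\<close>])
    show "((\<lambda>Y. taylor_coeff g n * W n Y) has_field_derivative taylor_coeff g n * (Y ^ n * (1 - X * Y) ^ N)) (at Y)"
      for n Y by (rule DERIV_cmult[OF dW])
    show "\<forall>\<^sub>F n in sequentially. \<forall>Y\<in>ball 0 s. norm (taylor_coeff g n * W n Y) \<le> h n"
      using hb by (intro always_eventually) blast
  qed (rule that)
  have G': "G' Y = (1 - X * Y) ^ N * g Y" if "Y \<in> ball 0 s" for Y
  proof -
    have "(\<lambda>n. taylor_coeff g n * Y ^ n) sums g Y"
      using that s by (intro taylor_coeff_sums[OF g]) auto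
    from sums_mult[OF this, of "(1 - X * Y) ^ N"]
    have "(\<lambda>n. taylor_coeff g n * (Y ^ n * (1 - X * Y) ^ N)) sums ((1 - X * Y) ^ N * g Y)"
      by (simp add: mult_ac)
    then show ?thesis using G that sums_unique2 by blast
  qed
  have "\<exists>c. \<forall>Y\<in>ball 0 s. \<Phi> Y - G Y = c"
  proof (rule has_field_derivative_zero_constant)
    show "((\<lambda>Y. \<Phi> Y - G Y) has_field_derivative 0) (at Y within ball 0 s)" if "Y \<in> ball 0 s" for Y
    proof -
      have "((\<lambda>Y. \<Phi> Y - G Y) has_field_derivative ((1 - X * Y) ^ N * g Y - G' Y)) (at Y)"
        by (intro derivative_intros) (use \<Phi> G that in auto)
      then show ?thesis using G'[OF that] by (auto intro: has_field_derivative_at_within)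
    qed
  qed auto
  then have "\<Phi> Y - G Y = \<Phi> 0 - G 0" using Y s by auto
  moreover have "G 0 = 0"
  proof -
    have "(\<lambda>n. taylor_coeff g n * W n 0) sums G 0" using G s by auto
    moreover have "W n 0 = 0" for n by (simp add: W_def)
    ultimately show ?thesis using sums_unique2[of "\<lambda>_. 0" "G 0" 0] by simp
  qed
  ultimately have GY: "G Y = \<Phi> Y - \<Phi> 0" by (simp add: algebra_simps)
  have "Y \<in> ball 0 s" using Y by simp
  then have "(\<lambda>n. taylor_coeff g n * W n Y) sums G Y" using G by blast
  then show "(\<lambda>n. taylor_coeff g n * W n Y) sums (\<Phi> Y - \<Phi> 0)" by (simp only: GY)
qed

section \<open>Sums over the modular group\<close>

text \<open>This is \<open>(c z + d) * (M z - w)\<close>, the numerator left after clearing the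
  automorphy factor. It is affine in each of the two points.\<close>

definition lin :: "int^2^2 \<Rightarrow> complex \<Rightarrow> complex \<Rightarrow> complex" where
  "lin M w z = of_int (M $ 1 $ 1) * z + of_int (M $ 1 $ 2)
     - w * (of_int (M $ 2 $ 1) * z + of_int (M $ 2 $ 2))"

definition adj :: "int^2^2 \<Rightarrow> int^2^2" where
  "adj M = (\<chi> i j. if i = j then (if i = 1 then M $ 2 $ 2 else M $ 1 $ 1) else - (M $ i $ j))"

lemma adj_nth [simp]:
  fixes M :: "int^2^2"
  shows
  "adj M $ 1 $ 1 = M $ 2 $ 2" "adj M $ 1 $ 2 = - M $ 1 $ 2"
  "adj M $ 2 $ 1 = - M $ 2 $ 1" "adj M $ 2 $ 2 = M $ 1 $ 1"
  by (simp_all add: adj_def)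

lemma SL2Z_iff: "M \<in> SL2Z \<longleftrightarrow> M $ 1 $ 1 * M $ 2 $ 2 - M $ 1 $ 2 * M $ 2 $ 1 = 1"
  by (simp add: SL2Z_def det_2)

lemma bij_betw_adj_SL2Z: "bij_betw adj SL2Z SL2Z"
  by (rule bij_betwI[of _ _ _ adj]) (auto simp: SL2Z_iff vec_eq_iff forall_2 algebra_simps)

text \<open>A bilinear form in the vectors \<open>(w, 1)\<close> and \<open>(z, 1)\<close> is
  transposed here: inverting the matrix exchanges the two points up to sign. The pairing of the two
  series rests on it.\<close>

lemma lin_adj: "lin (adj M) w z = - lin M z w"
  by (simp add: lin_def algebra_simps)

lemma cnj_lin: "cnj (lin M w z) = lin M (cnj w) (cnj z)"
  by (simp add: lin_def)

text \<open>For \<open>z\<close> in the upper half-plane this is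
  \<open>Im (M z) = Im z / |c z + d|^2\<close> with denominators cleared, because
  \<open>|u - cnj w|^2 - |u - w|^2 = 4 Im u Im w\<close>.\<close>

lemma norm_lin_diff:
  assumes "M \<in> SL2Z"
  shows "norm (lin M (cnj w) z) ^ 2 - norm (lin M w z) ^ 2 = 4 * Im w * Im z"
proof -
  have det: "real_of_int (M $ 1 $ 1) * M $ 2 $ 2 = 1 + real_of_int (M $ 1 $ 2) * M $ 2 $ 1"
    using assms by (simp add: SL2Z_iff of_int_mult[symmetric] of_int_add[symmetric] del: of_int_mult of_int_add)
  define a b c d where "a = real_of_int (M $ 1 $ 1)" "b = real_of_int (M $ 1 $ 2)"
    "c = real_of_int (M $ 2 $ 1)" "d = real_of_int (M $ 2 $ 2)"
  have e: "a * d - b * c = 1" using det by (simp add: a_b_c_d_def)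
  have "norm (lin M (cnj w) z) ^ 2 - norm (lin M w z) ^ 2 = 4 * Im w * Im z * (a * d - b * c)"
    by (simp add: cmod_power2 lin_def a_b_c_d_def, simp add: algebra_simps power2_eq_square)
  then show ?thesis using e by simp
qed

section \<open>Convergence of sums over the modular group\<close>

lemma summable_on_int_inverse_powr:
  assumes "s > 1"
  shows "(\<lambda>n::int. (1 + \<bar>real_of_int n\<bar>) powr (- s)) summable_on UNIV"
proof -
  have "summable (\<lambda>n. real (Suc n) powr (- s))"
    using summable_Suc_iff[of "\<lambda>n. real n powr - s"] summable_real_powr_iff[of "-s"] assms by simp
  then have nat: "(\<lambda>n::nat. (1 + real n) powr (- s)) summable_on UNIV"
    by (intro summable_nonneg_imp_summable_on) (auto simp: add_ac)
  have "(\<lambda>n::int. (1 + \<bar>real_of_int n\<bar>) powr (- s)) summable_on range int"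
    by (subst summable_on_reindex) (use nat in \<open>auto simp: o_def\<close>)
  moreover have "(\<lambda>n::int. (1 + \<bar>real_of_int n\<bar>) powr (- s)) summable_on range (\<lambda>n. - int n)"
    by (subst summable_on_reindex) (use nat in \<open>auto simp: o_def inj_on_def\<close>)
  ultimately have "(\<lambda>n::int. (1 + \<bar>real_of_int n\<bar>) powr (- s)) summable_on (range int \<union> range (\<lambda>n. - int n))"
    by (rule summable_on_union)
  moreover have "range int \<union> range (\<lambda>n. - int n) = UNIV"
    using int_cases2 by (auto simp: image_iff) (metis int_cases2)
  ultimately show ?thesis by simp
qed

lemma summable_on_product_real:
  fixes f :: "'a \<Rightarrow> real" and g :: "'b \<Rightarrow> real"
  assumes "f summable_on UNIV" "g summable_on UNIV" "\<And>x. f x \<ge> 0" "\<And>x. g x \<ge> 0"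
  shows "(\<lambda>(x, y). f x * g y) summable_on UNIV"
proof -
  have "(\<lambda>(x, y). f x * g y) summable_on (UNIV \<times> UNIV)"
  proof (rule summable_on_SigmaI)
    show "((\<lambda>y. case (x, y) of (x, y) \<Rightarrow> f x * g y) has_sum (f x * infsum g UNIV)) UNIV" for x
      using has_sum_cmult_right[OF has_sum_infsum[OF assms(2)], of "f x"] by simp
    show "(\<lambda>x. f x * infsum g UNIV) summable_on UNIV" using assms(1) by (rule summable_on_cmult_left)
  qed (use assms in auto)
  then show ?thesis by simp
qed

text \<open>Matrices with lower left entry \<open>c \<noteq> 0\<close> are determined by three of their entries, those with
  \<open>c = 0\<close> by the others, so the sum is dominated by a convergent triple sum with exponent \<open>4/3\<close>.\<close>

lemma summable_on_SL2Z_entries: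
  fixes f :: "int^2^2 \<Rightarrow> real"
  assumes B: "\<And>M. M \<in> SL2Z \<Longrightarrow> f M \<ge> 1"
    and bound: "\<And>M i j. (M::int^2^2) \<in> SL2Z \<Longrightarrow> \<bar>real_of_int (M $ i $ j)\<bar> \<le> f M"
  shows "(\<lambda>M. f M powr - 4) summable_on SL2Z"
proof -
  let ?h = "\<lambda>n::int. (1 + \<bar>real_of_int n\<bar>) powr (- (4/3))"
  have h: "?h summable_on UNIV" by (rule summable_on_int_inverse_powr) simp
  have G: "(\<lambda>(x, y, z). ?h x * (?h y * ?h z)) summable_on UNIV"
    using summable_on_product_real[OF h summable_on_product_real[OF h h]]
    by (simp add: case_prod_unfold)
  have key: "f M powr - 4 \<le> 16 * (?h x * (?h y * ?h z))"
    if M: "M \<in> SL2Z" and x: "\<bar>real_of_int x\<bar> \<le> f M" "\<bar>real_of_int y\<bar> \<le> f M" "\<bar>real_of_int z\<bar> \<le> f M" for M x y z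
  proof -
    \<comment> \<open>Since \<open>f M \<ge> 1\<close> bounds each entry \<open>u\<close>, also
      \<open>1 + |u| \<le> 2 * f M\<close>. The exponent 4 is then split into three parts 4/3, each
      above 1, one for each free entry; the constant 16 is \<open>2^4\<close>.\<close>
    have le: "(2 * f M) powr (- (4/3)) \<le> ?h u" if "\<bar>real_of_int u\<bar> \<le> f M" for u
      using that B[OF M] by (intro powr_mono2') auto
    have "(2 * f M) powr - 4 = (2 * f M) powr (- (4/3)) * ((2 * f M) powr (- (4/3)) * (2 * f M) powr (- (4/3)))"
      using B[OF M] by (simp add: powr_add[symmetric])
    also have "\<dots> \<le> ?h x * (?h y * ?h z)" using x by (intro mult_mono le) auto
    finally have "2 powr - 4 * f M powr - 4 \<le> ?h x * (?h y * ?h z)" using B[OF M] by (simp add: powr_mult)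
    moreover have "(2::real) powr - 4 = 1 / 16" by (simp add: powr_minus powr_numeral divide_simps)
    ultimately show ?thesis by simp
  qed
  have red: "(\<lambda>M. f M powr - 4) summable_on S"
    if S: "S \<subseteq> SL2Z" and inj: "inj_on p S"
      and p: "\<And>M. M \<in> S \<Longrightarrow> (case p M of (x, y, z) \<Rightarrow>
            \<bar>real_of_int x\<bar> \<le> f M \<and> \<bar>real_of_int y\<bar> \<le> f M \<and> \<bar>real_of_int z\<bar> \<le> f M)"
    for S and p :: "int^2^2 \<Rightarrow> int \<times> int \<times> int"
  proof (rule summable_on_comparison_test)
    have "(\<lambda>(x, y, z). ?h x * (?h y * ?h z)) summable_on p ` S"
      using G by (rule summable_on_subset_banach) simp
    then show "(\<lambda>M. 16 * (case p M of (x, y, z) \<Rightarrow> ?h x * (?h y * ?h z))) summable_on S"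
      using inj by (intro summable_on_cmult_right) (simp add: summable_on_reindex o_def)
    show "f M powr - 4 \<le> 16 * (case p M of (x, y, z) \<Rightarrow> ?h x * (?h y * ?h z))" if "M \<in> S" for M
      using p[OF that] key[of M] S that by (auto split: prod.split)
  qed auto
  have "(\<lambda>M. f M powr - 4) summable_on {M::int^2^2. M \<in> SL2Z \<and> M $ 2 $ 1 \<noteq> 0}"
  proof (rule red[where p = "\<lambda>M::int^2^2. (M $ 1 $ 1, M $ 2 $ 1, M $ 2 $ 2)"])
    show "inj_on (\<lambda>M::int^2^2. (M $ 1 $ 1, M $ 2 $ 1, M $ 2 $ 2)) {M::int^2^2. M \<in> SL2Z \<and> M $ 2 $ 1 \<noteq> 0}"
    proof (rule inj_onI)
      fix M M' :: "int^2^2"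
      assume M: "M \<in> {M::int^2^2. M \<in> SL2Z \<and> M $ 2 $ 1 \<noteq> 0}" "M' \<in> {M::int^2^2. M \<in> SL2Z \<and> M $ 2 $ 1 \<noteq> 0}"
        and eq: "(M $ 1 $ 1, M $ 2 $ 1, M $ 2 $ 2) = (M' $ 1 $ 1, M' $ 2 $ 1, M' $ 2 $ 2)"
      have "M $ 1 $ 1 * M $ 2 $ 2 - M $ 1 $ 2 * M $ 2 $ 1 = 1"
        and "M $ 1 $ 1 * M $ 2 $ 2 - M' $ 1 $ 2 * M $ 2 $ 1 = 1"
        using M eq by (simp_all add: SL2Z_iff)
      then have "M $ 1 $ 2 * M $ 2 $ 1 = M' $ 1 $ 2 * M $ 2 $ 1" by linarith
      then have "M $ 1 $ 2 = M' $ 1 $ 2" using M by simp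
      then show "M = M'" using eq by (simp add: vec_eq_iff forall_2)
    qed
  qed (use bound in auto)
  moreover have "(\<lambda>M. f M powr - 4) summable_on {M::int^2^2. M \<in> SL2Z \<and> M $ 2 $ 1 = 0}"
  proof (rule red[where p = "\<lambda>M::int^2^2. (M $ 1 $ 1, M $ 1 $ 2, M $ 2 $ 2)"])
    show "inj_on (\<lambda>M::int^2^2. (M $ 1 $ 1, M $ 1 $ 2, M $ 2 $ 2)) {M::int^2^2. M \<in> SL2Z \<and> M $ 2 $ 1 = 0}"
      by (rule inj_onI) (auto simp: vec_eq_iff forall_2)
  qed (use bound in auto)
  ultimately have "(\<lambda>M. f M powr - 4) summable_on ({M::int^2^2. M \<in> SL2Z \<and> M $ 2 $ 1 \<noteq> 0} \<union> {M::int^2^2. M \<in> SL2Z \<and> M $ 2 $ 1 = 0})"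
    by (rule summable_on_union)
  moreover have "{M::int^2^2. M \<in> SL2Z \<and> M $ 2 $ 1 \<noteq> 0} \<union> {M::int^2^2. M \<in> SL2Z \<and> M $ 2 $ 1 = 0} = SL2Z" by auto
  ultimately show ?thesis by simp
qed

lemma norm_lin_lower:
  assumes "Im w > 0" "Im z > 0" "M \<in> SL2Z"
  shows "2 * sqrt (Im w * Im z) \<le> norm (lin M (cnj w) z)"
    and "norm (lin M w z) < norm (lin M (cnj w) z)"
proof -
  have "4 * Im w * Im z > 0" using assms by simp
  then have *: "norm (lin M (cnj w) z) ^ 2 \<ge> 4 * Im w * Im z"
    "norm (lin M w z) ^ 2 < norm (lin M (cnj w) z) ^ 2"
    using norm_lin_diff[OF assms(3), of w z] zero_le_power2[of "norm (lin M w z)"] by linarith+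
  show "2 * sqrt (Im w * Im z) \<le> norm (lin M (cnj w) z)"
  proof -
    have "sqrt (4 * (Im w * Im z)) \<le> sqrt (norm (lin M (cnj w) z) ^ 2)"
      using *(1) by (intro real_sqrt_le_mono) (simp add: mult_ac)
    then show ?thesis by (simp add: real_sqrt_mult)
  qed
  show "norm (lin M w z) < norm (lin M (cnj w) z)"
    using *(2) by (rule power2_less_imp_less) simp
qed

lemma norm_affine_real_lower:
  fixes a b :: real
  assumes "Im z > 0"
  shows "\<bar>a\<bar> \<le> norm (of_real a * z + of_real b) / Im z"
    and "\<bar>b\<bar> \<le> norm (of_real a * z + of_real b) * (1 + norm z / Im z)"
proof -
  let ?v = "complex_of_real a * z + of_real b"
  have "\<bar>a * Im z\<bar> \<le> norm ?v" using abs_Im_le_cmod[of ?v] by simp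
  then show a: "\<bar>a\<bar> \<le> norm ?v / Im z" using assms by (simp add: abs_mult field_simps)
  have "\<bar>b\<bar> = norm (?v - of_real a * z)" by simp
  also have "\<dots> \<le> norm ?v + \<bar>a\<bar> * norm z" by (metis norm_triangle_ineq4 norm_mult norm_of_real)
  also have "\<bar>a\<bar> * norm z \<le> norm ?v / Im z * norm z" using a by (intro mult_right_mono) auto
  finally show "\<bar>b\<bar> \<le> norm ?v * (1 + norm z / Im z)" by (simp add: algebra_simps)
qed

text \<open>\<open>q\<close> controls every entry of \<open>M\<close>: from \<open>|p| < |q|\<close>
  follow bounds for \<open>c z + d = (q - p) / (2 i Im w)\<close> and
  \<open>a z + b = p + w (c z + d)\<close>, and their real coefficients are recovered because
  \<open>z\<close> is not real. The positive lower bound of \<open>|q|\<close> reduces the exponent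
  \<open>k\<close> to 4.\<close>

lemma summable_on_norm_lin:
  assumes w: "Im w > 0" and z: "Im z > 0" and k: "k \<ge> 4"
  shows "(\<lambda>M. inverse (norm (lin M (cnj w) z) ^ k)) summable_on SL2Z"
proof -
  define q where "q M = norm (lin M (cnj w) z)" for M
  define c where "c = 2 * sqrt (Im w * Im z)"
  have c: "c > 0" using w z by (simp add: c_def)
  have qc: "q M \<ge> c" if "M \<in> SL2Z" for M using norm_lin_lower(1)[OF w z that] by (simp add: q_def c_def)
  have ex: "\<exists>K. \<forall>M\<in>(SL2Z :: (int^2^2) set). \<forall>i j. \<bar>real_of_int (M $ i $ j)\<bar> \<le> K * q M"
  proof -
    define L where "L = max (1 / Im z) (1 + norm z / Im z)"
    have L: "L \<ge> 0" using z by (simp add: L_def le_max_iff_disj)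
    have ent: "\<bar>real_of_int (M $ i $ j)\<bar> \<le> L * norm (of_int (M $ i $ 1) * z + of_int (M $ i $ 2))" for M :: "int^2^2" and i j
    proof -
      let ?v = "of_int (M $ i $ 1) * z + of_int (M $ i $ 2)"
      have *: "\<bar>real_of_int (M $ i $ 1)\<bar> \<le> norm ?v / Im z" "\<bar>real_of_int (M $ i $ 2)\<bar> \<le> norm ?v * (1 + norm z / Im z)"
        using norm_affine_real_lower(1)[OF z, of "of_int (M $ i $ 1)" "of_int (M $ i $ 2)"]
          norm_affine_real_lower(2)[OF z, where a = "of_int (M $ i $ 1)" and b = "of_int (M $ i $ 2)"] by simp_all
      have "norm ?v * (1 / Im z) \<le> norm ?v * L" "norm ?v * (1 + norm z / Im z) \<le> norm ?v * L"
        by (intro mult_left_mono; simp add: L_def)+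
      with * have "\<bar>real_of_int (M $ i $ 1)\<bar> \<le> norm ?v * L" "\<bar>real_of_int (M $ i $ 2)\<bar> \<le> norm ?v * L"
        by auto
      then show ?thesis using exhaust_2[of j] by (auto simp: mult.commute)
    qed
    have "\<bar>real_of_int (M $ i $ j)\<bar> \<le> L * (1 + norm w) * (1 / Im w + 1) * q M" if M: "M \<in> SL2Z" for M :: "int^2^2" and i j
    proof -
      let ?u = "of_int (M $ 1 $ 1) * z + of_int (M $ 1 $ 2)"
      let ?v = "of_int (M $ 2 $ 1) * z + of_int (M $ 2 $ 2)"
      have p: "norm (lin M w z) \<le> q M" using norm_lin_lower(2)[OF w z M] by (simp add: q_def)
      have "lin M (cnj w) z - lin M w z = 2 * \<i> * of_real (Im w) * ?v"
        by (simp add: lin_def complex_eq_iff algebra_simps)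
      then have "2 * Im w * norm ?v = norm (lin M (cnj w) z - lin M w z)"
        using w by (simp add: norm_mult)
      also have "\<dots> \<le> 2 * q M" using norm_triangle_ineq4[of "lin M (cnj w) z" "lin M w z"] p by (simp add: q_def)
      finally have v: "norm ?v \<le> q M / Im w" using w by (simp add: field_simps)
      have "?u = lin M w z + w * ?v" by (simp add: lin_def)
      then have "norm ?u \<le> norm (lin M w z) + norm w * norm ?v" by (metis norm_mult norm_triangle_ineq)
      also have "\<dots> \<le> q M + norm w * (q M / Im w)" using p v by (intro add_mono mult_left_mono) auto
      finally have u: "norm ?u \<le> q M + norm w * (q M / Im w)" .
      have q0: "q M \<ge> 0" by (simp add: q_def)
      have exp: "(1 + norm w) * (1 / Im w + 1) * q M = q M / Im w + q M + norm w * (q M / Im w) + norm w * q M"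
        by (simp add: algebra_simps add_divide_distrib)
      have nn: "q M / Im w \<ge> 0" "norm w * (q M / Im w) \<ge> 0" "norm w * q M \<ge> 0" using q0 w by auto
      have "norm ?u \<le> (1 + norm w) * (1 / Im w + 1) * q M" "norm ?v \<le> (1 + norm w) * (1 / Im w + 1) * q M"
        unfolding exp using u v nn q0 by linarith+
      then have "norm (of_int (M $ i $ 1) * z + of_int (M $ i $ 2)) \<le> (1 + norm w) * (1 / Im w + 1) * q M"
        using exhaust_2[of i] by auto
      from mult_left_mono[OF this L] ent[of M i j] show ?thesis by (simp add: mult.assoc)
    qed
    then show ?thesis by blast
  qed
  then obtain K where K: "\<And>M i j. (M::int^2^2) \<in> SL2Z \<Longrightarrow> \<bar>real_of_int (M $ i $ j)\<bar> \<le> K * q M" by blast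
  \<comment> \<open>The entry \<open>1 / c\<close> of the maximum secures
    \<open>K' * q M \<ge> 1\<close>, as the criterion on matrix entries demands.\<close>
  define K' where "K' = max K (1 / c)"
  have K'0: "K' > 0" using c by (simp add: K'_def less_max_iff_disj)
  have "(\<lambda>M. (K' * q M) powr - 4) summable_on SL2Z"
  proof (rule summable_on_SL2Z_entries)
    fix M :: "int^2^2" assume M: "M \<in> SL2Z"
    have "1 = 1 / c * c" using c by simp
    also have "\<dots> \<le> K' * q M" using qc[OF M] c K'0 by (intro mult_mono) (auto simp: K'_def)
    finally show "K' * q M \<ge> 1" .
    show "\<bar>real_of_int (M $ i $ j)\<bar> \<le> K' * q M" for i j
    proof -
      have "K * q M \<le> K' * q M" by (intro mult_right_mono) (auto simp: K'_def q_def)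
      then show ?thesis using K[OF M, of i j] by linarith
    qed
  qed
  then have "(\<lambda>M. K' ^ 4 / c ^ (k - 4) * (K' * q M) powr - 4) summable_on SL2Z"
    by (rule summable_on_cmult_right)
  then have "(\<lambda>M. inverse (q M ^ k)) summable_on SL2Z"
  proof (rule summable_on_comparison_test)
    fix M :: "int^2^2" assume M: "M \<in> SL2Z"
    have q: "q M > 0" using qc[OF M] c by simp
    have "c ^ (k - 4) \<le> q M ^ (k - 4)" using qc[OF M] c by (intro power_mono) auto
    then have "inverse (q M ^ (k - 4)) * inverse (q M ^ 4) \<le> inverse (c ^ (k - 4)) * inverse (q M ^ 4)"
      using c q by (intro mult_right_mono le_imp_inverse_le) auto
    also have "inverse (q M ^ (k - 4)) * inverse (q M ^ 4) = inverse (q M ^ k)"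
      using k by (simp add: inverse_mult_distrib[symmetric] power_add[symmetric] del: inverse_mult_distrib)
    also have "inverse (c ^ (k - 4)) * inverse (q M ^ 4) = K' ^ 4 / c ^ (k - 4) * (K' * q M) powr - 4"
      using q K'0 by (simp add: powr_minus powr_numeral power_mult_distrib divide_simps)
    finally show "inverse (q M ^ k) \<le> K' ^ 4 / c ^ (k - 4) * (K' * q M) powr - 4" .
  qed (use q_def in auto)
  then show ?thesis by (simp add: q_def)
qed

text \<open>If \<open>|p| < |q|/2\<close> then \<open>|q|\<close> is bounded, which by summability happens for finitely many matrices only.\<close>

lemma lin_ratio_bounded_below:
  assumes w: "Im w > 0" and z: "Im z > 0"
  obtains \<delta> where "0 < \<delta>" "\<delta> \<le> 1/2"
    "\<And>M. M \<in> SL2Z \<Longrightarrow> lin M w z \<noteq> 0 \<Longrightarrow> \<delta> * norm (lin M (cnj w) z) \<le> norm (lin M w z)"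
proof -
  let ?p = "\<lambda>M. norm (lin M w z)" and ?q = "\<lambda>M. norm (lin M (cnj w) z)"
  define S where "S = {M \<in> SL2Z. ?p M < 1/2 * ?q M}"
  have "finite S"
  proof -
    let ?f = "\<lambda>M. inverse (?q M ^ 4)"
    define D where "D = 4 * Im w * Im z"
    have D: "D > 0" using w z by (simp add: D_def)
    obtain T where T: "(?f has_sum T) SL2Z"
      using summable_on_norm_lin[OF w z, of 4] by (auto simp: summable_on_def)
    have low: "?f M \<ge> inverse (4 * D ^ 2)" if "M \<in> S" for M
    proof -
      have M: "M \<in> SL2Z" "?p M < 1/2 * ?q M" using that by (auto simp: S_def)
      have q0: "?q M > 0" using norm_lin_lower(2)[OF w z M(1)] norm_ge_zero[of "lin M w z"] by linarith
      have "?p M ^ 2 \<le> (1/2 * ?q M) ^ 2" using M(2) by (intro power_mono) auto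
      then have "?q M ^ 2 \<le> 4/3 * D"
        using norm_lin_diff[OF M(1), of w z] by (simp add: D_def power_mult_distrib power2_eq_square)
      also have "\<dots> \<le> 2 * D" using D by simp
      finally have "(?q M ^ 2) ^ 2 \<le> (2 * D) ^ 2" by (intro power_mono) auto
      then have "?q M ^ 4 \<le> 4 * D ^ 2" by (simp add: power_mult_distrib power_mult[symmetric])
      then show ?thesis using q0 by (intro le_imp_inverse_le) auto
    qed
    show ?thesis
    proof (rule ccontr)
      assume inf: "infinite S"
      define e where "e = inverse (4 * D ^ 2)"
      have e: "e > 0" using D by (simp add: e_def)
      obtain n :: nat where n: "real n * e > T" using reals_Archimedean3[OF e] by blast
      obtain F where F: "F \<subseteq> S" "finite F" "card F = n" using infinite_arbitrarily_large[OF inf] by blast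
      have "real n * e \<le> sum ?f F" using F low sum_bounded_below[of F e ?f] by (auto simp: e_def)
      also have "sum ?f F \<le> T"
        by (rule has_sum_mono_neutral[OF has_sum_finite[OF F(2)] T]) (use F in \<open>auto simp: S_def\<close>)
      finally show False using n by simp
    qed
  qed
  \<comment> \<open>The element 1/2 keeps the finite set nonempty and takes care of the matrices
    outside \<open>S\<close>.\<close>
  define R where "R = insert (1/2) ((\<lambda>M. ?p M / ?q M) ` {M \<in> S. lin M w z \<noteq> 0})"
  have q0: "?q M > 0" if "M \<in> SL2Z" for M
    using norm_lin_lower(2)[OF w z that] norm_ge_zero[of "lin M w z"] by linarith
  have fin: "finite R" using \<open>finite S\<close> by (simp add: R_def)
  have "Min R > 0" using fin q0 by (subst Min_gr_iff) (auto simp: R_def S_def)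
  moreover have "Min R \<le> 1/2" using fin by (intro Min_le) (auto simp: R_def)
  moreover have "Min R * ?q M \<le> ?p M" if M: "M \<in> SL2Z" "lin M w z \<noteq> 0" for M
  proof (cases "M \<in> S")
    case True
    then have "Min R \<le> ?p M / ?q M" using fin M by (intro Min_le) (auto simp: R_def)
    then show ?thesis using q0[OF M(1)] by (simp add: field_simps)
  next
    case False
    then have "?p M \<ge> 1/2 * ?q M" using M by (simp add: S_def)
    moreover have "Min R * ?q M \<le> 1/2 * ?q M" using \<open>Min R \<le> 1/2\<close> by (intro mult_right_mono) auto
    ultimately show ?thesis by linarith
  qed
  ultimately show ?thesis by (rule that)
qed

section \<open>Incomplete beta functions and quotients of linear forms\<close>

text \<open>For \<open>j \<ge> 1\<close> this is the incomplete beta function with parameters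
  \<open>j\<close> and \<open>N + 1\<close>, the primitive of
  \<open>x ^ (j - 1) * (1 - x) ^ N\<close> vanishing at 0. As a polynomial it makes sense over both
  fields, and complex arguments such as \<open>X * cnj X\<close> can be expanded.\<close>

definition beta_primitive :: "nat \<Rightarrow> nat \<Rightarrow> 'a::real_normed_field \<Rightarrow> 'a" where
  "beta_primitive N j x = (\<Sum>i\<le>N. of_nat (N choose i) * (-1) ^ i * x ^ (j + i) / of_nat (j + i))"

text \<open>The regularised incomplete beta function of \<open>1 - x\<close> with parameters
  \<open>N + 1\<close> and \<open>m + 1\<close>. The sum is the series of
  \<open>(1 - x)^(-N-1)\<close> cut off after degree \<open>m\<close>; the product falls from 1 at
  \<open>x = 0\<close> to 0 at \<open>x = 1\<close>.\<close>

definition cutoff :: "nat \<Rightarrow> nat \<Rightarrow> 'a::real_normed_field \<Rightarrow> 'a" where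
  "cutoff N m x = (1 - x) ^ (N + 1) * (\<Sum>l\<le>m. of_nat ((N + l) choose l) * x ^ l)"

text \<open>This is \<open>(N + m + 1)! / (N! m!)\<close>, the reciprocal of the Euler beta value at
  \<open>m + 1\<close> and \<open>N + 1\<close>.\<close>

definition cutoff_slope :: "nat \<Rightarrow> nat \<Rightarrow> 'a::real_normed_field" where
  "cutoff_slope N m = of_nat ((N + m + 1) * ((N + m) choose m))"

lemma of_real_beta_primitive: "of_real (beta_primitive N j x) = beta_primitive N j (of_real x)"
  by (simp add: beta_primitive_def)

lemma of_real_cutoff: "of_real (cutoff N m x) = cutoff N m (of_real x)"
  by (simp add: cutoff_def)

lemma cutoff_slope_nonzero: "cutoff_slope N m \<noteq> (0 :: 'a::real_normed_field)"
  unfolding cutoff_slope_def of_nat_eq_0_iff by simp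

lemma Suc_times_binomial_shift:
  "(m + 1) * ((N + (m + 1)) choose (m + 1)) = (N + m + 1) * ((N + m) choose m)"
  using Suc_times_binomial_eq[of "N + m" m] by (simp add: mult_ac)

lemma has_field_derivative_beta_primitive:
  assumes "j \<ge> 1"
  shows "(beta_primitive N j has_field_derivative x ^ (j - 1) * (1 - x) ^ N) (at (x :: 'a::real_normed_field))"
proof -
  have "((\<lambda>x::'a. of_nat (N choose i) * (-1) ^ i * x ^ (j + i) / of_nat (j + i)) has_field_derivative
      of_nat (N choose i) * (-1) ^ i * x ^ (j + i - 1)) (at x)" for i
  proof -
    let ?d = "of_nat (j + i) :: 'a"
    have d: "?d \<noteq> 0" using assms by (simp only: of_nat_eq_0_iff)
    have "((\<lambda>x::'a. x ^ (j + i)) has_field_derivative ?d * x ^ (j + i - 1)) (at x)"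
      using DERIV_power[OF DERIV_ident, where n = "j + i" and x = x and s = UNIV] by simp
    from DERIV_cdivide[OF DERIV_cmult[OF this, of "of_nat (N choose i) * (-1) ^ i"], of ?d]
    have "((\<lambda>x::'a. of_nat (N choose i) * (-1) ^ i * x ^ (j + i) / ?d) has_field_derivative
        of_nat (N choose i) * (-1) ^ i * (?d * x ^ (j + i - 1)) / ?d) (at x)" .
    moreover have "of_nat (N choose i) * (-1) ^ i * (?d * x ^ (j + i - 1)) / ?d =
        of_nat (N choose i) * (-1) ^ i * x ^ (j + i - 1)"
      using d by (simp del: of_nat_add)
    ultimately show ?thesis by simp
  qed
  then have "(beta_primitive N j has_field_derivative (\<Sum>i\<le>N. of_nat (N choose i) * (-1) ^ i * x ^ (j + i - 1))) (at x)"
    unfolding beta_primitive_def by (rule DERIV_sum)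
  moreover have "x ^ (j - 1) * (1 - x) ^ N = (\<Sum>i\<le>N. of_nat (N choose i) * (-1) ^ i * x ^ (j + i - 1))"
  proof -
    have "(1 - x) ^ N = (\<Sum>i\<le>N. of_nat (N choose i) * (- x) ^ i)"
      using binomial_ring[where a = "- x" and b = 1 and n = N] by simp
    then have "x ^ (j - 1) * (1 - x) ^ N = (\<Sum>i\<le>N. x ^ (j - 1) * (of_nat (N choose i) * (- x) ^ i))"
      by (simp only: sum_distrib_left)
    also have "\<dots> = (\<Sum>i\<le>N. of_nat (N choose i) * (-1) ^ i * x ^ (j + i - 1))"
      using assms by (intro sum.cong refl) (simp add: power_minus[of x] power_add[symmetric])
    finally show ?thesis .
  qed
  ultimately show ?thesis by simp
qed

lemma has_field_derivative_one_minus_power: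
  "((\<lambda>x. (1 - x) ^ (N + 1)) has_field_derivative - (of_nat (N + 1) * (1 - x) ^ N)) (at (x :: 'a::real_normed_field))"
proof -
  have "((\<lambda>x::'a. 1 - x) has_field_derivative - 1) (at x)"
    by (auto intro!: derivative_eq_intros)
  from DERIV_power[OF this, where n = "N + 1"] show ?thesis by simp
qed

text \<open>With the full binomial series the product would be constantly 1, so only the boundary
  term of degree \<open>m\<close> survives. The induction carries out this telescoping, its binomial
  input being \<open>Suc_times_binomial_shift\<close>.\<close>

lemma has_field_derivative_cutoff:
  "(cutoff N m has_field_derivative - (cutoff_slope N m * x ^ m * (1 - x) ^ N)) (at (x :: 'a::real_normed_field))"
proof (induction m)
  case 0
  show ?case using has_field_derivative_one_minus_power[of N x] unfolding cutoff_def cutoff_slope_def by simp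
next
  case (Suc m)
  let ?b = "of_nat ((N + Suc m) choose Suc m) :: 'a"
  have eq: "cutoff N (Suc m) = (\<lambda>x. cutoff N m x + ?b * ((1 - x) ^ (N + 1) * x ^ Suc m))"
    by (rule ext) (simp add: cutoff_def algebra_simps)
  note d1 = has_field_derivative_one_minus_power[of N x]
  have d2: "((\<lambda>x::'a. x ^ Suc m) has_field_derivative (of_nat (Suc m) * x ^ m)) (at x)"
    using DERIV_power[OF DERIV_ident, where n = "Suc m" and x = x and s = UNIV] by simp
  have rec: "of_nat (Suc m) * ?b = (cutoff_slope N m :: 'a)"
    unfolding cutoff_slope_def of_nat_mult[symmetric] Suc_eq_plus1 Suc_times_binomial_shift ..
  have slope: "cutoff_slope N (Suc m) = of_nat (N + m + 2) * ?b"
  proof -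
    have "N + Suc m + 1 = N + m + 2" by simp
    then show ?thesis by (simp only: cutoff_slope_def of_nat_mult)
  qed
  have "(cutoff N (Suc m) has_field_derivative
      - (cutoff_slope N m * x ^ m * (1 - x) ^ N) +
      ?b * (- (of_nat (N + 1) * (1 - x) ^ N) * x ^ Suc m + (of_nat (Suc m) * x ^ m) * (1 - x) ^ (N + 1))) (at x)"
  proof -
    have "((\<lambda>x::'a. (1 - x) ^ (N + 1) * x ^ Suc m) has_field_derivative
        - (of_nat (N + 1) * (1 - x) ^ N) * x ^ Suc m + (of_nat (Suc m) * x ^ m) * (1 - x) ^ (N + 1)) (at x)"
      using DERIV_mult[OF d1 d2] by simp
    from DERIV_add[OF Suc.IH DERIV_cmult[OF this]] show ?thesis unfolding eq .
  qed
  moreover have "- (cutoff_slope N m * x ^ m * (1 - x) ^ N) +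
      ?b * (- (of_nat (N + 1) * (1 - x) ^ N) * x ^ Suc m + (of_nat (Suc m) * x ^ m) * (1 - x) ^ (N + 1))
    = - (cutoff_slope N (Suc m) * x ^ Suc m * (1 - x) ^ N)"
    unfolding slope rec[symmetric] by (simp add: algebra_simps)
  ultimately show ?case by simp
qed

lemma cutoff_eq: "cutoff N m x = 1 - cutoff_slope N m * beta_primitive N (m + 1) (x :: real)"
proof -
  have "((\<lambda>x. cutoff N m x + cutoff_slope N m * beta_primitive N (m + 1) x) has_field_derivative 0) (at x)" for x :: real
    by (rule DERIV_cong[OF DERIV_add[OF has_field_derivative_cutoff
          DERIV_cmult[OF has_field_derivative_beta_primitive]]]) auto
  from DERIV_isconst_all[OF allI, OF this, of x 0]
  have "cutoff N m x + cutoff_slope N m * beta_primitive N (m + 1) x = cutoff N m 0 + cutoff_slope N m * beta_primitive N (m + 1) 0" .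
  moreover have "cutoff N m 0 = (1::real)"
    by (simp add: cutoff_def power_0_left if_distrib cong: if_cong)
  moreover have "beta_primitive N (m + 1) 0 = (0::real)" by (simp add: beta_primitive_def)
  ultimately show ?thesis by simp
qed

lemma beta_primitive_1: "beta_primitive N (Suc m) 1 = 1 / (cutoff_slope N m :: real)"
  using cutoff_eq[of N m 1] cutoff_slope_nonzero[of N m, where 'a = real]
  by (simp add: cutoff_def field_simps)

text \<open>For positive \<open>j\<close> no denominator vanishes, so no index is excluded and the
  constant is the complete beta value.\<close>

lemma beta_const_eq: "j \<ge> 1 \<Longrightarrow> beta_const (N + 1) (int j) = beta_primitive N j 1"
  unfolding beta_const_def beta_primitive_def
  by (intro sum.cong) (auto simp: of_nat_add[symmetric] add_ac simp del: of_nat_add)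

lemma inc_beta_eq:
  assumes "j \<ge> 1" "0 \<le> Z"
  shows "inc_beta Z (N + 1) (int j) = beta_primitive N j 1 - beta_primitive N j (1 - Z)"
proof -
  have "((\<lambda>t. t ^ N * (1 - t) ^ (j - 1)) has_integral (- beta_primitive N j (1 - Z)) - (- beta_primitive N j (1 - 0))) {0..Z}"
  proof (rule fundamental_theorem_of_calculus[OF assms(2)])
    fix t :: real
    have "((\<lambda>t. - beta_primitive N j (1 - t)) has_field_derivative - ((1 - t) ^ (j - 1) * (1 - (1 - t)) ^ N * (- 1))) (at t)"
      by (intro DERIV_minus DERIV_chain2[OF has_field_derivative_beta_primitive[OF assms(1)]]) (auto intro!: derivative_eq_intros)
    then show "((\<lambda>t. - beta_primitive N j (1 - t)) has_vector_derivative t ^ N * (1 - t) ^ (j - 1)) (at t within {0..Z})"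
      by (simp add: has_real_derivative_iff_has_vector_derivative[symmetric] mult.commute has_field_derivative_at_within)
  qed
  moreover have "(1 - t) powi (int j - 1) = (1 - t) ^ (j - 1)" for t :: real
    using assms(1) by (simp add: power_int_def nat_diff_distrib)
  ultimately show ?thesis unfolding inc_beta_def by (simp add: integral_unique)
qed

text \<open>Subtracting the constant leaves a function of order \<open>x ^ j\<close> at
  \<open>x = 0\<close>. With \<open>x = |X|^2\<close> this absorbs the pole of
  \<open>X^(-j)\<close>, so the nonmeromorphic terms of negative index are polynomials in
  \<open>X\<close> and \<open>cnj X\<close>.\<close>

lemma inc_beta0_eq:
  assumes "j \<ge> 1" "x \<le> 1"
  shows "inc_beta0 (1 - x) (N + 1) (int j) = - beta_primitive N j x"
  unfolding inc_beta0_def using inc_beta_eq[OF assms(1), of "1 - x" N] beta_const_eq[OF assms(1), of N] assms(2)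
  by simp

text \<open>This explains the normalisation of the weight \<open>2 - 2k\<close> series: division by
  the constant turns the beta factor into \<open>cutoff\<close>, which has the value 1 at the
  centre.\<close>

lemma inc_beta_normalised:
  assumes "x \<le> 1"
  shows "inc_beta (1 - x) (N + 1) (int (m + 1)) = beta_const (N + 1) (int (m + 1)) * cutoff N m x"
proof -
  have "inc_beta (1 - x) (N + 1) (int (m + 1)) = beta_primitive N (m + 1) 1 - beta_primitive N (m + 1) x"
    using inc_beta_eq[of "m + 1" "1 - x" N] assms by simp
  moreover have "beta_const (N + 1) (int (m + 1)) = beta_primitive N (m + 1) 1" by (rule beta_const_eq) simp
  moreover have "1 / c * (1 - c * w) = 1 / c - w" if "c \<noteq> 0" for c w :: real
    using that by (simp add: right_diff_distrib)
  ultimately show ?thesis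
    using cutoff_slope_nonzero[of N m, where 'a = real] by (simp add: cutoff_eq beta_primitive_1)
qed

lemma beta_const_nonzero: "beta_const (N + 1) (int (m + 1)) \<noteq> 0"
  using beta_const_eq[of "m + 1" N] cutoff_slope_nonzero[of N m, where 'a = real] by (simp add: beta_primitive_1)

section \<open>Power series of quotients of linear forms\<close>

abbreviation fps_lin :: "complex \<Rightarrow> complex \<Rightarrow> complex fps" where
  "fps_lin a b \<equiv> fps_const a - fps_const b * fps_X"

lemma fps_nth_lin_mult:
  "fps_nth (fps_lin a b * F) (Suc n) = a * fps_nth F (Suc n) - b * fps_nth F n"
  "fps_nth (fps_lin a b * F) 0 = a * fps_nth F 0"
  by (simp_all add: left_diff_distrib mult.assoc)

lemma fps_nth_inverse_lin_power:
  assumes "a \<noteq> 0"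
  shows "fps_nth (inverse (fps_lin a b) ^ (N + 1)) l = of_nat ((N + l) choose l) * (b / a) ^ l / a ^ (N + 1)"
proof -
  have "fps_lin a b = fps_const a * (1 - fps_const (b / a) * fps_X)"
    using assms by (simp add: right_diff_distrib mult.assoc[symmetric])
  then have "inverse (fps_lin a b) = fps_const (1 / a) * inverse (1 - fps_const (b / a) * fps_X)"
    by (simp only: fps_inverse_mult fps_const_inverse inverse_eq_divide)
  then have "inverse (fps_lin a b) ^ (N + 1) = fps_const (1 / a ^ (N + 1)) * inverse ((1 - fps_const (b / a) * fps_X) ^ (N + 1))"
    by (simp only: power_mult_distrib fps_const_power power_one_over fps_inverse_power)
  also have "inverse ((1 - fps_const (b / a) * fps_X) ^ (N + 1)) = Abs_fps (\<lambda>k. of_nat ((N + 1 + k - 1) choose k) * (b / a) ^ k)"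
    by (rule one_minus_const_fps_X_neg_power') simp
  finally show ?thesis by simp
qed

lemma mult_power_quotient_step:
  fixes A B I :: "'a::comm_monoid_mult"
  assumes "A * I = 1"
  shows "A * (B ^ Suc j * I ^ (Suc j + 1)) = B * (B ^ j * I ^ (j + 1))"
proof -
  have "A * (B ^ Suc j * I ^ (Suc j + 1)) = (A * I) * (B * (B ^ j * I ^ (j + 1)))"
    by (simp add: mult_ac)
  then show ?thesis by (simp add: assms)
qed

text \<open>Both sides satisfy the same recursion in \<open>j\<close> and \<open>n\<close>.\<close>

lemma fps_nth_lin_quotient_swap:
  assumes "c \<noteq> 0"
  shows "fps_nth (fps_lin a b ^ j * inverse (fps_lin c d) ^ (j + 1)) n =
         fps_nth (fps_lin d b ^ n * inverse (fps_lin c a) ^ (n + 1)) j"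
proof -
  define S where "S j n = fps_nth (fps_lin a b ^ j * inverse (fps_lin c d) ^ (j + 1)) n" for j n
  define T where "T j n = fps_nth (fps_lin d b ^ n * inverse (fps_lin c a) ^ (n + 1)) j" for j n
  have inv: "fps_lin c e * inverse (fps_lin c e) = 1" for e
    using assms by (intro inverse_mult_eq_1') simp
  have Srec: "c * S (Suc j) (Suc n) - d * S (Suc j) n = a * S j (Suc n) - b * S j n"
    and S0: "c * S (Suc j) 0 = a * S j 0" for j n
  proof -
    have e: "fps_lin c d * (fps_lin a b ^ Suc j * inverse (fps_lin c d) ^ (Suc j + 1)) =
        fps_lin a b * (fps_lin a b ^ j * inverse (fps_lin c d) ^ (j + 1))"
      by (rule mult_power_quotient_step[OF inv])
    show "c * S (Suc j) (Suc n) - d * S (Suc j) n = a * S j (Suc n) - b * S j n" "c * S (Suc j) 0 = a * S j 0"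
      unfolding S_def using arg_cong[OF e, of "\<lambda>F. fps_nth F (Suc n)"] arg_cong[OF e, of "\<lambda>F. fps_nth F 0"]
      by (simp_all only: fps_nth_lin_mult)
  qed
  have Trec: "c * T (Suc j) (Suc n) - a * T j (Suc n) = d * T (Suc j) n - b * T j n"
    and T0: "c * T 0 (Suc n) = d * T 0 n" for j n
  proof -
    have e: "fps_lin c a * (fps_lin d b ^ Suc n * inverse (fps_lin c a) ^ (Suc n + 1)) =
        fps_lin d b * (fps_lin d b ^ n * inverse (fps_lin c a) ^ (n + 1))"
      by (rule mult_power_quotient_step[OF inv])
    show "c * T (Suc j) (Suc n) - a * T j (Suc n) = d * T (Suc j) n - b * T j n" "c * T 0 (Suc n) = d * T 0 n"
      unfolding T_def using arg_cong[OF e, of "\<lambda>F. fps_nth F (Suc j)"] arg_cong[OF e, of "\<lambda>F. fps_nth F 0"]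
      by (simp_all only: fps_nth_lin_mult)
  qed
  have Sz: "S 0 n = (d / c) ^ n / c" for n
    using fps_nth_inverse_lin_power[OF assms, of d 0 n] by (simp add: S_def)
  have Tz: "T j 0 = (a / c) ^ j / c" for j
    using fps_nth_inverse_lin_power[OF assms, of a 0 j] by (simp add: T_def)
  have "S j n = T j n"
  proof (induction j arbitrary: n)
    case 0
    show ?case
    proof (induction n)
      case 0 show ?case by (simp add: Sz Tz)
    next
      case (Suc n)
      have "T 0 (Suc n) = d * T 0 n / c" using T0[of n] assms by (simp add: field_simps)
      moreover have "S 0 (Suc n) = d * S 0 n / c" by (simp add: Sz)
      ultimately show ?case using Suc by simp
    qed
  next
    case (Suc j)
    note SS = Suc.IH
    show ?case
    proof (induction n)
      case 0
      have "S (Suc j) 0 = a * S j 0 / c" using S0[of j] assms by (simp add: field_simps)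
      then show ?case using Suc.IH[of 0] by (simp add: Tz)
    next
      case (Suc n)
      have "c * S (Suc j) (Suc n) = c * T (Suc j) (Suc n)"
      proof -
        have "c * S (Suc j) (Suc n) = a * S j (Suc n) - b * S j n + d * S (Suc j) n"
          using Srec[of j n] by (simp add: diff_eq_eq)
        moreover have "c * T (Suc j) (Suc n) = a * T j (Suc n) - b * T j n + d * T (Suc j) n"
          using Trec[of j n] by (simp add: diff_eq_eq algebra_simps)
        ultimately show ?thesis using Suc SS by simp
      qed
      then show ?case using assms by simp
    qed
  qed
  then show ?thesis by (simp add: S_def T_def)
qed

section \<open>Local form of the summands\<close>

text \<open>Here \<open>N = 2k - 2\<close>, and \<open>p\<close>, \<open>q\<close> stand for
  \<open>lin M \<zeta> \<rho>\<close> and \<open>lin M (cnj \<zeta>) \<rho>\<close>. The power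
  \<open>n - N - 1\<close> of \<open>q - cnj p * X\<close> is kept as two factors: exponent
  \<open>n\<close> belongs to the quotient that obeys the coefficient symmetry, the negative power
  is a binomial series.\<close>

definition psi_loc :: "nat \<Rightarrow> nat \<Rightarrow> complex \<Rightarrow> complex \<Rightarrow> complex \<Rightarrow> complex" where
  "psi_loc N n p q X = (q - cnj p * X) ^ n * inverse (q - cnj p * X) ^ (N + 1) * inverse (p - cnj q * X) ^ (n + 1)"

text \<open>With \<open>A = p - cnj q * X\<close> and \<open>B = q - cnj p * X\<close>, the argument
  of \<open>cutoff\<close> is \<open>|A / B|^2\<close>, the squared radius at the image point, in
  which \<open>cnj X\<close> is replaced by the free variable \<open>Y\<close>.\<close>

definition phi_loc :: "nat \<Rightarrow> nat \<Rightarrow> complex \<Rightarrow> complex \<Rightarrow> complex \<Rightarrow> complex \<Rightarrow> complex" where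
  "phi_loc N m p q X Y = (q - cnj p * X) ^ (N + m + 1) * inverse (p - cnj q * X) ^ (m + 1) *
     cutoff N m (((p - cnj q * X) * (cnj p - q * Y)) / ((q - cnj p * X) * (cnj q - p * Y)))"

text \<open>The value at \<open>Y = 0\<close> after clearing all denominators in
  \<open>q - cnj p * X\<close>, so that the zero of \<open>p - cnj q * X\<close> is the only pole in
  \<open>X\<close>.\<close>

definition phi_hol :: "nat \<Rightarrow> nat \<Rightarrow> complex \<Rightarrow> complex \<Rightarrow> complex \<Rightarrow> complex" where
  "phi_hol N m p q X = ((q * cnj q - p * cnj p) / cnj q) ^ (N + 1) * inverse (p - cnj q * X) ^ (m + 1) *
     (\<Sum>l\<le>m. of_nat ((N + l) choose l) * (cnj p / cnj q) ^ l * (p - cnj q * X) ^ l * (q - cnj p * X) ^ (m - l))"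

text \<open>The \<open>Y\<close>-derivative of \<open>phi_loc\<close> without its factor
  \<open>(1 - X * Y) ^ N\<close>. Since \<open>X\<close> has dropped out, its Taylor coefficients in
  \<open>Y\<close> are constants and can serve as expansion coefficients.\<close>

definition phi_anti :: "nat \<Rightarrow> nat \<Rightarrow> complex \<Rightarrow> complex \<Rightarrow> complex \<Rightarrow> complex" where
  "phi_anti N m p q Y = (q * cnj q - p * cnj p) ^ (N + 1) * cutoff_slope N m *
     (cnj p - q * Y) ^ m * inverse (cnj q - p * Y) ^ (m + N + 2)"

lemma denominator_nonzero:
  fixes p q X :: complex
  assumes "norm p < norm q" "norm X \<le> 1"
  shows "q - cnj p * X \<noteq> 0"
proof
  assume "q - cnj p * X = 0"
  then have "norm q = norm p * norm X" by (metis complex_mod_cnj eq_iff_diff_eq_0 norm_mult)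
  also have "\<dots> \<le> norm p" using assms by (intro mult_left_le) auto
  finally show False using assms by simp
qed

lemma norm_denominator_ge:
  fixes p q X :: complex
  assumes "norm p \<le> norm q" "norm X \<le> 1/2"
  shows "norm q / 2 \<le> norm (q - cnj p * X)"
proof -
  have "norm (cnj p * X) \<le> norm q * (1/2)"
    unfolding norm_mult using assms by (intro mult_mono) auto
  then show ?thesis using norm_triangle_ineq2[of q "cnj p * X"] by simp
qed

lemma norm_affine_le:
  fixes a b X :: complex
  assumes "norm a \<le> K" "norm b \<le> K" "norm X \<le> 1"
  shows "norm (a - b * X) \<le> 2 * K"
proof -
  have "0 \<le> K" using assms(1) norm_ge_zero[of a] by linarith
  then have "norm (b * X) \<le> K * 1" unfolding norm_mult using assms by (intro mult_mono) auto
  then show ?thesis using norm_triangle_ineq4[of a "b * X"] assms by simp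
qed

lemma norm_numerator_ge:
  fixes p q X :: complex
  assumes "\<delta> * norm q \<le> norm p" "norm X \<le> \<delta> / 2"
  shows "\<delta> * norm q / 2 \<le> norm (p - cnj q * X)"
proof -
  have "norm (cnj q * X) \<le> norm q * (\<delta> / 2)"
    unfolding norm_mult using assms by (intro mult_mono) auto
  then show ?thesis using norm_triangle_ineq2[of p "cnj q * X"] assms by (simp add: algebra_simps)
qed

text \<open>At \<open>Y = 0\<close> the argument \<open>v\<close> of \<open>cutoff\<close> satisfies
  \<open>1 - v = D / (B * cnj q)\<close>. Its power \<open>N + 1\<close> cancels
  \<open>B ^ (N + 1)\<close>, and the remaining \<open>B ^ m\<close> clears the denominators of the
  series truncated at degree \<open>m\<close>.\<close>

lemma phi_loc_zero:
  assumes "norm p < norm q" "norm X \<le> 1" "p - cnj q * X \<noteq> 0"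
  shows "phi_loc N m p q X 0 = phi_hol N m p q X"
proof -
  define A where "A = p - cnj q * X"
  define B where "B = q - cnj p * X"
  define D where "D = q * cnj q - p * cnj p"
  have B: "B \<noteq> 0" unfolding B_def using assms(1,2) by (rule denominator_nonzero)
  have q: "cnj q \<noteq> 0" using assms(1) by auto
  have v: "1 - A * cnj p / (B * cnj q) = D / (B * cnj q)"
  proof -
    have "B * cnj q - A * cnj p = D" by (simp add: A_def B_def D_def algebra_simps)
    then show ?thesis using B q by (auto simp: diff_divide_distrib)
  qed
  have "phi_loc N m p q X 0 = B ^ (N + m + 1) * inverse A ^ (m + 1) *
      ((D / (B * cnj q)) ^ (N + 1) * (\<Sum>l\<le>m. of_nat ((N + l) choose l) * (A * cnj p / (B * cnj q)) ^ l))"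
    unfolding phi_loc_def cutoff_def A_def[symmetric] B_def[symmetric] by (simp add: v)
  also have "\<dots> = (D / cnj q) ^ (N + 1) * inverse A ^ (m + 1) *
      (\<Sum>l\<le>m. B ^ m * (of_nat ((N + l) choose l) * (A * cnj p / (B * cnj q)) ^ l))"
  proof -
    have *: "B ^ (N + m + 1) * (D / (B * cnj q)) ^ (N + 1) = (D / cnj q) ^ (N + 1) * B ^ m"
    proof -
      have "B ^ (N + m + 1) = B ^ m * B ^ (N + 1)" by (simp add: power_add)
      moreover have "(D / (B * cnj q)) ^ (N + 1) = (D / cnj q) ^ (N + 1) / B ^ (N + 1)"
        unfolding power_divide[symmetric] by (simp only: divide_divide_eq_left mult.commute)
      ultimately show ?thesis using B by simp
    qed
    have "B ^ (N + m + 1) * I * ((D / (B * cnj q)) ^ (N + 1) * S) = (D / cnj q) ^ (N + 1) * I * (B ^ m * S)" for I S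
    proof -
      have "B ^ (N + m + 1) * I * ((D / (B * cnj q)) ^ (N + 1) * S) =
          (B ^ (N + m + 1) * (D / (B * cnj q)) ^ (N + 1)) * (I * S)" by (simp only: mult_ac)
      then show ?thesis unfolding * by (simp only: mult_ac)
    qed
    then show ?thesis by (simp only: sum_distrib_left[symmetric])
  qed
  also have "(\<Sum>l\<le>m. B ^ m * (of_nat ((N + l) choose l) * (A * cnj p / (B * cnj q)) ^ l)) =
      (\<Sum>l\<le>m. of_nat ((N + l) choose l) * (cnj p / cnj q) ^ l * A ^ l * B ^ (m - l))"
  proof (intro sum.cong refl)
    fix l assume "l \<in> {..m}"
    then have "B ^ m = B ^ l * B ^ (m - l)" by (simp add: power_add[symmetric])
    then show "B ^ m * (of_nat ((N + l) choose l) * (A * cnj p / (B * cnj q)) ^ l) =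
        of_nat ((N + l) choose l) * (cnj p / cnj q) ^ l * A ^ l * B ^ (m - l)"
      using B q by (simp add: power_divide power_mult_distrib)
  qed
  finally show ?thesis unfolding phi_hol_def A_def B_def D_def .
qed

lemma phi_loc_zero_centre:
  assumes "q \<noteq> 0"
  shows "phi_loc N m 0 q X 0 = q ^ (N + m + 1) * inverse (- cnj q * X) ^ (m + 1)"
  by (simp add: phi_loc_def cutoff_def power_0_left if_distrib cong: if_cong)

lemma phi_derivative_simplify:
  fixes A B a b c D t :: complex
  assumes A: "A \<noteq> 0" and B: "B \<noteq> 0"
  shows "B ^ (N + m + 1) * inverse A ^ (m + 1) *
      (- (c * (A * a / (B * b)) ^ m * (D * t / (B * b)) ^ N) * (- (A * D) / (B * b ^ 2))) =
     t ^ N * (D ^ (N + 1) * c * a ^ m * inverse b ^ (m + N + 2))"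
proof -
  have one: "B ^ j * inverse B ^ j = 1" "A ^ j * inverse A ^ j = 1" for j
    unfolding power_mult_distrib[symmetric] using A B by simp_all
  have "B ^ (N + m + 1) * inverse A ^ (m + 1) *
      (- (c * (A * a / (B * b)) ^ m * (D * t / (B * b)) ^ N) * (- (A * D) / (B * b ^ 2))) =
      B ^ (N + m + 1) * inverse A ^ (m + 1) *
      ((c * (A * a / (B * b)) ^ m * (D * t / (B * b)) ^ N) * ((A * D) / (B * b ^ 2)))" by simp
  also have "\<dots> = (B ^ (N + m + 1) * inverse B ^ (N + m + 1)) * (A ^ (m + 1) * inverse A ^ (m + 1)) *
      (t ^ N * (D ^ (N + 1) * c * a ^ m * inverse b ^ (m + N + 2)))"
    by (simp only: divide_inverse inverse_mult_distrib power_mult_distrib power_add power_one_right power_inverse[symmetric] mult_ac)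
  finally show ?thesis unfolding one by simp
qed

text \<open>The identity \<open>B * b - A * a = D * (1 - X * Y)\<close> produces the weight. The
  derivative of the argument of \<open>cutoff\<close> supplies one factor \<open>A\<close>, which
  together with the power \<open>m\<close> coming from \<open>cutoff\<close> removes
  \<open>A ^ (m + 1)\<close> from the denominator; the powers of \<open>B\<close> cancel as
  well.\<close>

lemma has_field_derivative_phi_loc:
  assumes "norm p < norm q" "norm X \<le> 1" "norm Y \<le> 1" "p - cnj q * X \<noteq> 0"
  shows "(phi_loc N m p q X has_field_derivative (1 - X * Y) ^ N * phi_anti N m p q Y) (at Y)"
proof -
  define A where "A = p - cnj q * X"
  define B where "B = q - cnj p * X"
  define a where "a = cnj p - q * Y"
  define b where "b = cnj q - p * Y"
  define D where "D = q * cnj q - p * cnj p"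
  have A: "A \<noteq> 0" using assms by (simp add: A_def)
  have B: "B \<noteq> 0" unfolding B_def using assms(1,2) by (rule denominator_nonzero)
  have b: "b \<noteq> 0" unfolding b_def using denominator_nonzero[of "cnj p" "cnj q" Y] assms by simp
  have D: "B * b - A * a = D * (1 - X * Y)" by (simp add: A_def B_def a_def b_def D_def algebra_simps)
  let ?v = "\<lambda>Y. (A * (cnj p - q * Y)) / (B * (cnj q - p * Y))"
  have v1: "1 - A * a / (B * b) = D * (1 - X * Y) / (B * b)"
    using B b D by (simp add: field_simps)
  have dv: "(?v has_field_derivative - (A * D) / (B * b ^ 2)) (at Y)"
  proof -
    have "(?v has_field_derivative ((A * (- q)) * (B * b) - (A * a) * (B * (- p))) / ((B * b) * (B * b))) (at Y)"
      unfolding a_def b_def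
      by (rule DERIV_divide) (use B b in \<open>auto simp: b_def intro!: derivative_eq_intros\<close>)
    moreover have "((A * (- q)) * (B * b) - (A * a) * (B * (- p))) / ((B * b) * (B * b)) = - (A * D) / (B * b ^ 2)"
    proof -
      have "(A * (- q)) * (B * b) - (A * a) * (B * (- p)) = - (A * D) * B"
        by (simp add: a_def b_def D_def algebra_simps)
      then show ?thesis using B b by (simp add: power2_eq_square)
    qed
    ultimately show ?thesis by simp
  qed
  have "((\<lambda>Y. B ^ (N + m + 1) * inverse A ^ (m + 1) * cutoff N m (?v Y)) has_field_derivative
      B ^ (N + m + 1) * inverse A ^ (m + 1) *
       (- (cutoff_slope N m * (?v Y) ^ m * (1 - ?v Y) ^ N) * (- (A * D) / (B * b ^ 2)))) (at Y)"
    by (intro DERIV_cmult DERIV_chain2[OF has_field_derivative_cutoff dv])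
  moreover have "B ^ (N + m + 1) * inverse A ^ (m + 1) *
       (- (cutoff_slope N m * (?v Y) ^ m * (1 - ?v Y) ^ N) * (- (A * D) / (B * b ^ 2)))
     = (1 - X * Y) ^ N * phi_anti N m p q Y"
  proof -
    have "B ^ (N + m + 1) * inverse A ^ (m + 1) *
        (- (cutoff_slope N m * (A * a / (B * b)) ^ m * (D * (1 - X * Y) / (B * b)) ^ N) * (- (A * D) / (B * b ^ 2)))
      = (1 - X * Y) ^ N * (D ^ (N + 1) * cutoff_slope N m * a ^ m * inverse b ^ (m + N + 2))"
      by (rule phi_derivative_simplify[OF A B])
    then show ?thesis
      unfolding phi_anti_def a_def[symmetric] b_def[symmetric] D_def[symmetric] v1 .
  qed
  ultimately show ?thesis unfolding phi_loc_def A_def B_def by simp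
qed

section \<open>Uniform bounds and holomorphy of the local terms\<close>

lemma power_collect:
  fixes x :: real
  assumes "x \<noteq> 0"
  shows "(a * x) ^ n * (b / x) ^ (N + 1) * (c / x) ^ (n + 1) = a ^ n * b ^ (N + 1) * c ^ (n + 1) * inverse (x ^ (N + 2))"
    and "(d / x) ^ (N + 1) * (c / x) ^ (m + 1) * (s * x ^ m) = d ^ (N + 1) * c ^ (m + 1) * s * inverse (x ^ (N + 2))"
    and "e * f * (a * x) ^ m * (b / x) ^ (m + N + 2) = e * f * a ^ m * b ^ (m + N + 2) * inverse (x ^ (N + 2))"
  using assms by (simp_all add: power_divide power_mult_distrib power_add divide_simps power2_eq_square)

lemma norm_psi_loc_le:
  assumes pq: "norm p < norm q" and \<delta>: "0 < \<delta>" "\<delta> \<le> 1" "\<delta> * norm q \<le> norm p" and X: "norm X \<le> \<delta> / 2"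
  shows "norm (psi_loc N n p q X) \<le> 2 ^ n * 2 ^ (N + 1) * (2 / \<delta>) ^ (n + 1) * inverse (norm q ^ (N + 2))"
proof -
  have q: "norm q > 0" using pq norm_ge_zero[of p] by linarith
  have 1: "norm (q - cnj p * X) \<le> 2 * norm q" using pq X \<delta> by (intro norm_affine_le) auto
  have 2: "inverse (norm (q - cnj p * X)) \<le> 2 / norm q"
    using le_imp_inverse_le[OF norm_denominator_ge[of p q X]] pq X \<delta> q by simp
  have 3: "inverse (norm (p - cnj q * X)) \<le> (2 / \<delta>) / norm q"
    using le_imp_inverse_le[OF norm_numerator_ge[OF \<delta>(3) X]] \<delta> q by (simp add: field_simps)
  have "norm (psi_loc N n p q X) \<le> (2 * norm q) ^ n * (2 / norm q) ^ (N + 1) * ((2 / \<delta>) / norm q) ^ (n + 1)"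
    unfolding psi_loc_def norm_mult norm_power norm_inverse using 1 2 3 q \<delta>
    by (intro mult_mono power_mono) auto
  also have "\<dots> = 2 ^ n * 2 ^ (N + 1) * (2 / \<delta>) ^ (n + 1) * inverse (norm q ^ (N + 2))"
    by (rule power_collect(1)) (use q in simp)
  finally show ?thesis .
qed

text \<open>Every linear form is comparable to \<open>|q|\<close>, and counting degrees gives the
  exponent \<open>- N - 2\<close>. The first factor is harmless because
  \<open>q * cnj q - p * cnj p\<close> takes the same value for all matrices of the group.\<close>

lemma norm_phi_hol_le:
  assumes pq: "norm p < norm q" and \<delta>: "0 < \<delta>" "\<delta> \<le> 1" "\<delta> * norm q \<le> norm p" and X: "norm X \<le> \<delta> / 2"
  shows "norm (phi_hol N m p q X) \<le> norm (q * cnj q - p * cnj p) ^ (N + 1) * (2 / \<delta>) ^ (m + 1) *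
    (\<Sum>l\<le>m. of_nat ((N + l) choose l) * 2 ^ m) * inverse (norm q ^ (N + 2))"
proof -
  have q: "norm q > 0" using pq norm_ge_zero[of p] by linarith
  have 1: "norm (q - cnj p * X) \<le> 2 * norm q" using pq X \<delta> by (intro norm_affine_le) auto
  have 2: "norm (p - cnj q * X) \<le> 2 * norm q" using pq X \<delta> by (intro norm_affine_le) auto
  have 3: "inverse (norm (p - cnj q * X)) \<le> (2 / \<delta>) / norm q"
    using le_imp_inverse_le[OF norm_numerator_ge[OF \<delta>(3) X]] \<delta> q by (simp add: field_simps)
  have s: "norm (\<Sum>l\<le>m. of_nat ((N + l) choose l) * (cnj p / cnj q) ^ l * (p - cnj q * X) ^ l * (q - cnj p * X) ^ (m - l))
      \<le> (\<Sum>l\<le>m. of_nat ((N + l) choose l) * 2 ^ m * norm q ^ m)"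
  proof (rule sum_norm_le)
    fix l assume l: "l \<in> {..m}"
    have "norm (of_nat ((N + l) choose l) * (cnj p / cnj q) ^ l * (p - cnj q * X) ^ l * (q - cnj p * X) ^ (m - l))
        \<le> of_nat ((N + l) choose l) * 1 ^ l * (2 * norm q) ^ l * (2 * norm q) ^ (m - l)"
      unfolding norm_mult norm_power norm_divide norm_of_nat using 1 2 pq q
      by (intro mult_mono power_mono) auto
    also have "\<dots> = of_nat ((N + l) choose l) * 2 ^ m * norm q ^ m"
    proof -
      have "(2 * norm q) ^ l * (2 * norm q) ^ (m - l) = (2 * norm q) ^ m"
        using l power_add[of "2 * norm q" l "m - l"] by (simp del: power_mult_distrib)
      then show ?thesis by (simp add: mult.assoc power_mult_distrib)
    qed
    finally show "norm (of_nat ((N + l) choose l) * (cnj p / cnj q) ^ l * (p - cnj q * X) ^ l * (q - cnj p * X) ^ (m - l))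
        \<le> of_nat ((N + l) choose l) * 2 ^ m * norm q ^ m" .
  qed
  have "norm (phi_hol N m p q X) \<le> (norm (q * cnj q - p * cnj p) / norm q) ^ (N + 1) * ((2 / \<delta>) / norm q) ^ (m + 1) *
      (\<Sum>l\<le>m. of_nat ((N + l) choose l) * 2 ^ m * norm q ^ m)"
    unfolding phi_hol_def norm_mult[of "_ * _" "sum _ _"] norm_mult[of "_ ^ _" "inverse _ ^ _"] norm_power norm_inverse norm_divide complex_mod_cnj
    using s 3 q \<delta> by (intro mult_mono power_mono) auto
  also have "\<dots> = norm (q * cnj q - p * cnj p) ^ (N + 1) * (2 / \<delta>) ^ (m + 1) *
      (\<Sum>l\<le>m. of_nat ((N + l) choose l) * 2 ^ m) * inverse (norm q ^ (N + 2))"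
    unfolding sum_distrib_right[symmetric] by (rule power_collect(2)) (use q in simp)
  finally show ?thesis .
qed

lemma norm_phi_anti_le:
  assumes pq: "norm p < norm q" and Y: "norm Y \<le> 1/2"
  shows "norm (phi_anti N m p q Y) \<le> norm (q * cnj q - p * cnj p) ^ (N + 1) * cutoff_slope N m * 2 ^ m * 2 ^ (m + N + 2) *
     inverse (norm q ^ (N + 2))"
proof -
  have q: "norm q > 0" using pq norm_ge_zero[of p] by linarith
  have 1: "norm (cnj p - q * Y) \<le> 2 * norm q" using pq Y by (intro norm_affine_le) auto
  have 2: "inverse (norm (cnj q - p * Y)) \<le> 2 / norm q"
    using le_imp_inverse_le[OF norm_denominator_ge[of "cnj p" "cnj q" Y]] pq Y q by simp
  have c: "norm (cutoff_slope N m :: complex) = cutoff_slope N m"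
    by (simp add: cutoff_slope_def del: of_nat_mult of_nat_add of_nat_Suc)
  have c0: "cutoff_slope N m \<ge> (0::real)" by (simp add: cutoff_slope_def)
  have "norm (phi_anti N m p q Y) \<le> norm (q * cnj q - p * cnj p) ^ (N + 1) * cutoff_slope N m *
      (2 * norm q) ^ m * (2 / norm q) ^ (m + N + 2)"
    unfolding phi_anti_def norm_mult[of "_ * _" "_ ^ _"] norm_mult[of "_ ^ _" "cutoff_slope _ _"] c norm_power norm_inverse
    using 1 2 q c0 by (intro mult_mono power_mono) auto
  also have "\<dots> = norm (q * cnj q - p * cnj p) ^ (N + 1) * cutoff_slope N m * 2 ^ m * 2 ^ (m + N + 2) *
     inverse (norm q ^ (N + 2))"
    by (rule power_collect(3)) (use q in simp)
  finally show ?thesis .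
qed

lemma local_terms_holomorphic:
  assumes "norm p < norm q" "0 < \<delta>" "\<delta> \<le> 1" "\<delta> * norm q \<le> norm p"
  shows "psi_loc N n p q holomorphic_on ball 0 (\<delta> / 2)"
    and "phi_hol N n p q holomorphic_on ball 0 (\<delta> / 2)"
proof -
  have nz: "q - cnj p * X \<noteq> 0" "p - cnj q * X \<noteq> 0" if "X \<in> ball 0 (\<delta> / 2)" for X
  proof -
    show "q - cnj p * X \<noteq> 0" using assms that by (intro denominator_nonzero) auto
    have "norm q > 0" using assms(1) norm_ge_zero[of p] by linarith
    then have "0 < \<delta> * norm q / 2" using assms by simp
    also have "\<dots> \<le> norm (p - cnj q * X)" using assms that by (intro norm_numerator_ge) auto
    finally show "p - cnj q * X \<noteq> 0" by auto
  qed
  show "psi_loc N n p q holomorphic_on ball 0 (\<delta> / 2)"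
    unfolding psi_loc_def[abs_def] using nz by (auto intro!: holomorphic_intros)
  show "phi_hol N n p q holomorphic_on ball 0 (\<delta> / 2)"
    unfolding phi_hol_def[abs_def] using nz by (auto intro!: holomorphic_intros)
qed

lemma phi_anti_holomorphic:
  assumes "norm p < norm q"
  shows "phi_anti N m p q holomorphic_on ball 0 (1/2)"
  unfolding phi_anti_def[abs_def] using denominator_nonzero[of "cnj p" "cnj q"] assms
  by (auto intro!: holomorphic_intros)

section \<open>Duality of the Taylor coefficients\<close>

lemma has_fps_expansion_lin: "(\<lambda>X. a - b * X) has_fps_expansion fps_lin a b"
  by (intro fps_expansion_intros)

text \<open>The \<open>m\<close>-th coefficient of \<open>psi_loc\<close> is a convolution involving
  the binomial series of \<open>(q - cnj p * X)^(-N-1)\<close> up to degree \<open>m\<close>, and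
  these binomial terms are exactly the weights of the truncated sum in \<open>phi_hol\<close>. The
  cofactors agree by \<open>fps_nth_lin_quotient_swap\<close> with exponent \<open>m - l\<close>.
  The arguments \<open>- p\<close> and \<open>- cnj q\<close> are those of the inverse matrix; since
  \<open>N\<close> is even, all signs cancel.\<close>

lemma taylor_coeff_duality:
  assumes pq: "norm p < norm q" and p: "p \<noteq> 0" and N: "even N"
  shows "taylor_coeff (phi_hol N m (- p) (- cnj q)) n =
    (q * cnj q - p * cnj p) ^ (N + 1) * taylor_coeff (psi_loc N n p q) m"
proof -
  have q: "q \<noteq> 0" using pq by auto
  define D where "D = q * cnj q - p * cnj p"
  define A where "A = fps_lin p q"
  define B where "B = fps_lin (cnj q) (cnj p)"
  have A0: "fps_nth A 0 \<noteq> 0" using p by (simp add: A_def)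
  have psi: "psi_loc N n p q has_fps_expansion
      (fps_lin q (cnj p) ^ n * inverse (fps_lin q (cnj p)) ^ (N + 1) * inverse (fps_lin p (cnj q)) ^ (n + 1))"
    unfolding psi_loc_def[abs_def] using p q
    by (intro has_fps_expansion_mult has_fps_expansion_power has_fps_expansion_inverse has_fps_expansion_lin) auto
  have hA: "(\<lambda>X. p - q * X) has_fps_expansion A" and hB: "(\<lambda>X. cnj q - cnj p * X) has_fps_expansion B"
    unfolding A_def B_def by (rule has_fps_expansion_lin)+
  let ?b = "\<lambda>l. of_nat ((N + l) choose l) * (cnj p / q) ^ l / q ^ (N + 1) :: complex"
  have phi_eq: "phi_hol N m (- p) (- cnj q) =
      (\<lambda>X. D ^ (N + 1) * (\<Sum>l\<le>m. ?b l * (inverse (p - q * X) ^ (m + 1) * (p - q * X) ^ l * (cnj q - cnj p * X) ^ (m - l))))"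
  proof
    fix X
    have sg: "(- 1 :: complex) ^ (N + 1) = - 1" using N by simp
    have "- p - cnj (- cnj q) * X = - (p - q * X)" "- cnj q - cnj (- p) * X = - (cnj q - cnj p * X)"
      by (simp_all add: algebra_simps)
    then have "phi_hol N m (- p) (- cnj q) X = (- (D / q)) ^ (N + 1) * inverse (- (p - q * X)) ^ (m + 1) *
       (\<Sum>l\<le>m. of_nat ((N + l) choose l) * (cnj p / q) ^ l * (- (p - q * X)) ^ l * (- (cnj q - cnj p * X)) ^ (m - l))"
      by (simp add: phi_hol_def D_def mult_ac)
    also have "(\<Sum>l\<le>m. of_nat ((N + l) choose l) * (cnj p / q) ^ l * (- (p - q * X)) ^ l * (- (cnj q - cnj p * X)) ^ (m - l)) =
        (- 1) ^ m * (\<Sum>l\<le>m. of_nat ((N + l) choose l) * (cnj p / q) ^ l * (p - q * X) ^ l * (cnj q - cnj p * X) ^ (m - l))"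
      unfolding sum_distrib_left
    proof (intro sum.cong refl)
      fix l assume "l \<in> {..m}"
      then have "(- 1 :: complex) ^ m = (- 1) ^ l * (- 1) ^ (m - l)" by (simp add: power_add[symmetric])
      then show "of_nat ((N + l) choose l) * (cnj p / q) ^ l * (- (p - q * X)) ^ l * (- (cnj q - cnj p * X)) ^ (m - l) =
        (- 1) ^ m * (of_nat ((N + l) choose l) * (cnj p / q) ^ l * (p - q * X) ^ l * (cnj q - cnj p * X) ^ (m - l))"
        unfolding power_minus[of "p - q * X"] power_minus[of "cnj q - cnj p * X"] by simp
    qed
    also have "(- (D / q)) ^ (N + 1) * inverse (- (p - q * X)) ^ (m + 1) * ((- 1) ^ m * S) =
        (D / q) ^ (N + 1) * inverse (p - q * X) ^ (m + 1) * S" for S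
    proof -
      have "(- (D / q)) ^ (N + 1) = - ((D / q) ^ (N + 1))"
        unfolding power_minus[of "D / q"] sg by simp
      moreover have "inverse (- (p - q * X)) ^ (m + 1) * (- 1) ^ m = - (inverse (p - q * X) ^ (m + 1))"
        unfolding inverse_minus_eq power_minus[of "inverse (p - q * X)"]
        by (simp add: mult_ac power_mult_distrib[symmetric])
      ultimately show ?thesis by (metis (no_types, lifting) minus_mult_minus mult.assoc mult_minus_left)
    qed
    finally show "phi_hol N m (- p) (- cnj q) X =
      D ^ (N + 1) * (\<Sum>l\<le>m. ?b l * (inverse (p - q * X) ^ (m + 1) * (p - q * X) ^ l * (cnj q - cnj p * X) ^ (m - l)))"
      by (simp add: sum_distrib_left power_divide mult_ac)
  qed
  have phi: "phi_hol N m (- p) (- cnj q) has_fps_expansion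
      (fps_const (D ^ (N + 1)) * (\<Sum>l\<le>m. fps_const (?b l) * (inverse A ^ (m + 1) * A ^ l * B ^ (m - l))))"
    unfolding phi_eq using A0
    by (intro has_fps_expansion_cmult_left has_fps_expansion_sum has_fps_expansion_mult has_fps_expansion_power
        has_fps_expansion_inverse hA hB)
  have "fps_nth (inverse A ^ (m + 1) * A ^ l * B ^ (m - l)) n =
      fps_nth (fps_lin q (cnj p) ^ n * inverse (fps_lin p (cnj q)) ^ (n + 1)) (m - l)" if l: "l \<le> m" for l
  proof -
    have "inverse A ^ (m + 1) * A ^ l = inverse A ^ (m - l + 1)"
    proof -
      have "inverse A ^ l * A ^ l = 1"
        unfolding power_mult_distrib[symmetric] using inverse_mult_eq_1[OF A0] by simp
      moreover have "inverse A ^ (m + 1) = inverse A ^ (m - l + 1) * inverse A ^ l"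
        using l unfolding power_add[symmetric] by simp
      ultimately show ?thesis by (simp only: mult.assoc mult_1_right)
    qed
    then have "inverse A ^ (m + 1) * A ^ l * B ^ (m - l) = B ^ (m - l) * inverse A ^ (m - l + 1)"
      by (simp only: mult.commute)
    then show ?thesis
      unfolding A_def B_def by (simp only: fps_nth_lin_quotient_swap[OF p])
  qed
  then have "taylor_coeff (phi_hol N m (- p) (- cnj q)) n = D ^ (N + 1) *
      (\<Sum>l\<le>m. ?b l * fps_nth (fps_lin q (cnj p) ^ n * inverse (fps_lin p (cnj q)) ^ (n + 1)) (m - l))"
    unfolding taylor_coeff_eq_fps_nth[OF phi] by (simp add: fps_sum_nth mult.assoc)
  moreover have "taylor_coeff (psi_loc N n p q) m =
      (\<Sum>l\<le>m. ?b l * fps_nth (fps_lin q (cnj p) ^ n * inverse (fps_lin p (cnj q)) ^ (n + 1)) (m - l))"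
  proof -
    have "taylor_coeff (psi_loc N n p q) m = fps_nth (inverse (fps_lin q (cnj p)) ^ (N + 1) *
        (fps_lin q (cnj p) ^ n * inverse (fps_lin p (cnj q)) ^ (n + 1))) m"
      unfolding taylor_coeff_eq_fps_nth[OF psi] by (simp only: mult_ac)
    then show ?thesis
      unfolding fps_mult_nth[of "inverse _ ^ _"] fps_nth_inverse_lin_power[OF q] by (simp add: atMost_atLeast0)
  qed
  ultimately show ?thesis unfolding D_def by simp
qed

section \<open>Uniqueness of elliptic expansions\<close>

definition ell_inv :: "complex \<Rightarrow> complex \<Rightarrow> complex" where
  "ell_inv \<rho> X = (\<rho> - cnj \<rho> * X) / (1 - X)"

lemma diff_cnj_nonzero: "Im \<rho> \<noteq> 0 \<Longrightarrow> \<rho> - cnj \<rho> \<noteq> 0"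
  by (simp add: complex_eq_iff)

lemma ell_inv_diff:
  assumes "X \<noteq> 1"
  shows "ell_inv \<rho> X - \<rho> = (\<rho> - cnj \<rho>) * X / (1 - X)" "ell_inv \<rho> X - cnj \<rho> = (\<rho> - cnj \<rho>) / (1 - X)"
  using assms by (auto simp: ell_inv_def divide_simps) (auto simp: algebra_simps)

lemma ell_X_ell_inv:
  assumes "Im \<rho> \<noteq> 0" "X \<noteq> 1"
  shows "ell_X \<rho> (ell_inv \<rho> X) = X"
  unfolding ell_X_def ell_inv_diff[OF assms(2)] using diff_cnj_nonzero[OF assms(1)] assms(2) by simp

lemma eventually_at_imp_ell_inv:
  assumes \<rho>: "Im \<rho> \<noteq> 0" and P: "eventually P (at \<rho>)"
  obtains \<epsilon> where "0 < \<epsilon>" "\<epsilon> < 1" "\<And>X. 0 < norm X \<Longrightarrow> norm X < \<epsilon> \<Longrightarrow> P (ell_inv \<rho> X)"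
proof -
  have "filterlim (ell_inv \<rho>) (at \<rho>) (at 0)"
    unfolding filterlim_at
  proof
    have "ell_inv \<rho> \<midarrow>0\<rightarrow> (\<rho> - cnj \<rho> * 0) / (1 - 0)"
      unfolding ell_inv_def[abs_def] by (intro tendsto_intros) auto
    then show "(ell_inv \<rho> \<longlongrightarrow> \<rho>) (at 0)" by simp
    have "\<forall>\<^sub>F X in at 0. X \<noteq> (1::complex)"
      using eventually_at[of "\<lambda>X. X \<noteq> (1::complex)" 0 UNIV] by (auto simp: dist_norm intro!: exI[of _ 1])
    moreover have "\<forall>\<^sub>F X in at 0. X \<noteq> (0::complex)" by (simp add: eventually_at_filter)
    ultimately show "\<forall>\<^sub>F X in at 0. ell_inv \<rho> X \<in> UNIV \<and> ell_inv \<rho> X \<noteq> \<rho>"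
    proof eventually_elim
      case (elim X)
      then show ?case using ell_inv_diff(1)[of X \<rho>] diff_cnj_nonzero[OF \<rho>] by auto
    qed
  qed
  from eventually_compose_filterlim[OF P this]
  obtain d where d: "d > 0" "\<And>X. X \<noteq> 0 \<Longrightarrow> dist X 0 < d \<Longrightarrow> P (ell_inv \<rho> X)"
    unfolding eventually_at by auto
  show ?thesis by (rule that[of "min d (1/2)"]) (use d in auto)
qed

lemma eventually_at_ell_X:
  assumes \<rho>: "Im \<rho> > 0" and \<epsilon>: "\<epsilon> > 0"
  shows "\<forall>\<^sub>F z in at \<rho>. Im z > 0 \<and> ell_X \<rho> z \<noteq> 0 \<and> norm (ell_X \<rho> z) < \<epsilon>"
proof -
  have ne: "\<rho> - cnj \<rho> \<noteq> 0" using \<rho> by (intro diff_cnj_nonzero) simp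
  have "(ell_X \<rho> \<longlongrightarrow> (\<rho> - \<rho>) / (\<rho> - cnj \<rho>)) (at \<rho>)"
    unfolding ell_X_def[abs_def] using ne by (intro tendsto_intros) auto
  then have "(ell_X \<rho> \<longlongrightarrow> 0) (at \<rho>)" by simp
  then have 1: "\<forall>\<^sub>F z in at \<rho>. norm (ell_X \<rho> z) < \<epsilon>"
    using \<epsilon> by (auto simp: tendsto_iff)
  have "(Im \<longlongrightarrow> Im \<rho>) (at \<rho>)" by (intro tendsto_intros)
  then have 2: "\<forall>\<^sub>F z in at \<rho>. Im z > 0" using \<rho> by (rule order_tendstoD)
  have 3: "\<forall>\<^sub>F z in at \<rho>. z \<noteq> \<rho>" by (simp add: eventually_at_filter)
  from 1 2 3 show ?thesis
  proof eventually_elim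
    case (elim z)
    have "z - cnj \<rho> \<noteq> 0" using elim \<rho> by (auto simp: complex_eq_iff)
    then show ?case using elim by (simp add: ell_X_def)
  qed
qed

lemma elliptic_expansion_circle:
  assumes \<rho>: "Im \<rho> > 0" and c: "has_elliptic_expansion k f \<rho> c"
  obtains \<epsilon> where "0 < \<epsilon>" "\<epsilon> < 1"
    "\<And>X. 0 < norm X \<Longrightarrow> norm X < \<epsilon> \<Longrightarrow> ((\<lambda>n. c n * X powi n) has_sum
       (f (ell_inv \<rho> X) / (ell_inv \<rho> X - cnj \<rho>) powi (- 2 * int k))) UNIV"
proof -
  have "Im \<rho> \<noteq> 0" using \<rho> by simp
  have ev: "\<forall>\<^sub>F z in at \<rho>. \<exists>S. ((\<lambda>n. c n * ell_X \<rho> z powi n) has_sum S) UNIV \<and>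
        f z = (z - cnj \<rho>) powi (- 2 * int k) * S" (is "eventually ?P _")
    using c unfolding has_elliptic_expansion_def by (elim conjE)
  obtain \<epsilon> where \<epsilon>: "0 < \<epsilon>" "\<epsilon> < 1" and S: "\<And>X. 0 < norm X \<Longrightarrow> norm X < \<epsilon> \<Longrightarrow> ?P (ell_inv \<rho> X)"
    using eventually_at_imp_ell_inv[OF \<open>Im \<rho> \<noteq> 0\<close> ev] by blast
  show ?thesis
  proof (rule that[OF \<epsilon>])
    fix X :: complex assume X: "0 < norm X" "norm X < \<epsilon>"
    then have X1: "X \<noteq> 1" using \<epsilon> by auto
    have "ell_inv \<rho> X - cnj \<rho> \<noteq> 0"
      using ell_inv_diff(2)[OF X1, of \<rho>] diff_cnj_nonzero[of \<rho>] \<rho> X1 by auto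
    then show "((\<lambda>n. c n * X powi n) has_sum
       (f (ell_inv \<rho> X) / (ell_inv \<rho> X - cnj \<rho>) powi (- 2 * int k))) UNIV"
      using S[OF X] ell_X_ell_inv[OF \<open>Im \<rho> \<noteq> 0\<close> X1] by (auto simp: power_int_eq_0_iff)
  qed
qed

lemma elliptic_coeff_eq:
  assumes \<rho>: "Im \<rho> > 0" and c: "has_elliptic_expansion k f \<rho> c"
  shows "elliptic_coeff k f \<rho> = c"
  unfolding elliptic_coeff_def
proof (rule the_equality[where P = "has_elliptic_expansion k f \<rho>", OF c])
  fix d assume d: "has_elliptic_expansion k f \<rho> d"
  obtain \<epsilon>1 where \<epsilon>1: "0 < \<epsilon>1" "\<epsilon>1 < 1" "\<And>X. 0 < norm X \<Longrightarrow> norm X < \<epsilon>1 \<Longrightarrow> ((\<lambda>n. c n * X powi n) has_sum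
       (f (ell_inv \<rho> X) / (ell_inv \<rho> X - cnj \<rho>) powi (- 2 * int k))) UNIV"
    by (rule elliptic_expansion_circle[OF \<rho> c]) blast
  obtain \<epsilon>2 where \<epsilon>2: "0 < \<epsilon>2" "\<epsilon>2 < 1" "\<And>X. 0 < norm X \<Longrightarrow> norm X < \<epsilon>2 \<Longrightarrow> ((\<lambda>n. d n * X powi n) has_sum
       (f (ell_inv \<rho> X) / (ell_inv \<rho> X - cnj \<rho>) powi (- 2 * int k))) UNIV"
    by (rule elliptic_expansion_circle[OF \<rho> d]) blast
  obtain r where r: "0 < r" "r < \<epsilon>1" "r < \<epsilon>2" using dense[of 0 "min \<epsilon>1 \<epsilon>2"] \<epsilon>1(1) \<epsilon>2(1) by auto
  show "d = c"
    by (rule ext, rule has_sum_circle_unique[OF r(1)]) (use r \<epsilon>1(3) \<epsilon>2(3) in auto)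
qed

text \<open>For \<open>n \<le> n0\<close> the conditions \<open>n \<le> 2k - 2\<close> and
  \<open>n \<le> min (2k - 2) n0\<close> agree, so the kernel at index \<open>n\<close> can be
  chosen independently of the growth order. Expansions with different \<open>n0\<close> thereby
  become comparable.\<close>

definition beta_star :: "nat \<Rightarrow> int \<Rightarrow> real \<Rightarrow> real" where
  "beta_star k n Z = (if n \<in> {0..int (2 * k - 2)} then inc_beta Z (2 * k - 1) (- n) else inc_beta0 Z (2 * k - 1) (- n))"

text \<open>The derivative at an interior point of the unit interval is the integrand, which is
  nonzero there. This is what separates the meromorphic from the nonmeromorphic contribution at the
  same index.\<close>

lemma inc_beta_not_constant:
  assumes \<epsilon>: "0 < \<epsilon>" "\<epsilon> < 1" and const: "\<And>r. 0 < r \<Longrightarrow> r < \<epsilon> \<Longrightarrow> inc_beta (1 - r\<^sup>2) a b = K"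
  shows False
proof -
  let ?g = "\<lambda>t::real. t ^ (a - 1) * (1 - t) powi (b - 1)"
  \<comment> \<open>The point \<open>t\<close> lies strictly between \<open>u\<close> and
    \<open>v\<close>, where the function would be constant, and \<open>v < 1\<close> keeps away from
    the possible singularity of the integrand at 1.\<close>
  define u v where "u = 1 - \<epsilon>\<^sup>2" "v = 1 - (\<epsilon> / 3)\<^sup>2"
  define t where "t = 1 - (\<epsilon> / 2)\<^sup>2"
  have sq: "(\<epsilon> / 3)\<^sup>2 < (\<epsilon> / 2)\<^sup>2" "(\<epsilon> / 2)\<^sup>2 < \<epsilon>\<^sup>2" "0 < (\<epsilon> / 3)\<^sup>2" "\<epsilon>\<^sup>2 < 1"
    using \<epsilon> by (auto simp: power_divide power_less_one_iff divide_simps)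
  have ut: "0 < u" "u < t" "t < v" "v < 1" using sq by (auto simp: u_v_def t_def)
  have "continuous_on {0..v} ?g" using ut by (intro continuous_intros) auto
  from integral_has_real_derivative[OF this, of t]
  have "((\<lambda>Z. inc_beta Z a b) has_real_derivative ?g t) (at t within {0..v})"
    using ut unfolding inc_beta_def by auto
  moreover have "at t within {0..v} = at t" by (rule at_within_interior) (use ut in auto)
  ultimately have d1: "((\<lambda>Z. inc_beta Z a b) has_real_derivative ?g t) (at t)" by simp
  have "((\<lambda>Z. inc_beta Z a b) has_real_derivative 0) (at t)"
  proof (rule has_field_derivative_transform_within_open[of "\<lambda>_. K" 0 t "{u<..<v}"])
    fix Z assume Z: "Z \<in> {u<..<v}"
    then have "0 < 1 - Z" using ut by simp
    moreover have "1 - Z < \<epsilon>\<^sup>2" using Z by (simp add: u_v_def)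
    ultimately have Z': "0 < 1 - Z" "1 - Z < \<epsilon>\<^sup>2" by auto
    then have "0 < sqrt (1 - Z)" "sqrt (1 - Z) < \<epsilon>" using \<epsilon> by (auto intro: real_less_lsqrt)
    from const[OF this] show "K = inc_beta Z a b" using Z' by simp
  qed (use ut in auto)
  from DERIV_unique[OF d1 this] show False using ut by (auto simp: power_int_eq_0_iff)
qed

lemma beta_star_not_constant:
  assumes \<epsilon>: "0 < \<epsilon>" "\<epsilon> < 1" and const: "\<And>r. 0 < r \<Longrightarrow> r < \<epsilon> \<Longrightarrow> beta_star k n (1 - r\<^sup>2) = K"
  shows False
proof (cases "n \<in> {0..int (2 * k - 2)}")
  case True
  then show False using inc_beta_not_constant[OF \<epsilon>, of "2 * k - 1" "- n" K] const by (auto simp: beta_star_def)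
next
  case False
  have "inc_beta (1 - r\<^sup>2) (2 * k - 1) (- n) = K + beta_const (2 * k - 1) (- n)" if "0 < r" "r < \<epsilon>" for r
    using const[OF that] False unfolding beta_star_def inc_beta0_def by (auto split: if_splits)
  then show False by (rule inc_beta_not_constant[OF \<epsilon>])
qed

text \<open>For fixed \<open>|X|\<close> the three sums merge into one Laurent series whose
  coefficients depend on \<open>|X|\<close> alone, the form to which uniqueness on circles
  applies.\<close>

lemma harmonic_expansion_circle:
  assumes \<rho>: "Im \<rho> > 0" and h: "has_harmonic_elliptic_expansion k F \<rho> n0 cp cm"
  obtains \<epsilon> c where "0 < \<epsilon>" "\<epsilon> < 1"
    "\<And>X. 0 < norm X \<Longrightarrow> norm X < \<epsilon> \<Longrightarrow> ((\<lambda>n. (cp n + c n * of_real (beta_star k n (1 - (norm X)\<^sup>2))) * X powi n) has_sum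
       (F (ell_inv \<rho> X) / (ell_inv \<rho> X - cnj \<rho>) powi (2 * int k - 2))) UNIV"
proof -
  define nk where "nk = int (min (2 * k - 2) n0)"
  have "Im \<rho> \<noteq> 0" using \<rho> by simp
  have cp0: "cp n = 0" if "n < - int n0" for n
    using h that by (simp add: has_harmonic_elliptic_expansion_def Let_def)
  have ev: "\<forall>\<^sub>F z in at \<rho>. \<exists>S T.
          ((\<lambda>n. cp n * ell_X \<rho> z powi n) has_sum S) {- int n0..} \<and>
          ((\<lambda>n. cm n * of_real (inc_beta0 (1 - (ell_r \<rho> z)\<^sup>2) (2 * k - 1) (-n)) * ell_X \<rho> z powi n)
             has_sum T) {n. n \<le> int n0 \<and> n \<notin> {0..nk}} \<and>
          F z = (z - cnj \<rho>) powi (2 * int k - 2) *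
            (S
             + (\<Sum>n=0..nk. cm n * of_real (inc_beta (1 - (ell_r \<rho> z)\<^sup>2) (2 * k - 1) (-n))
                           * ell_X \<rho> z powi n)
             + T)" (is "eventually ?P (at \<rho>)")
    using h unfolding has_harmonic_elliptic_expansion_def Let_def nk_def by (elim conjE)
  obtain \<epsilon> where \<epsilon>: "0 < \<epsilon>" "\<epsilon> < 1" and P: "\<And>X. 0 < norm X \<Longrightarrow> norm X < \<epsilon> \<Longrightarrow> ?P (ell_inv \<rho> X)"
    using eventually_at_imp_ell_inv[OF \<open>Im \<rho> \<noteq> 0\<close> ev] by blast
  \<comment> \<open>The expansion says nothing about \<open>cm\<close> above \<open>n0\<close>, so
    those values are replaced by 0.\<close>
  define c where "c n = (if n \<le> int n0 then cm n else 0)" for n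
  show ?thesis
  proof (rule that[OF \<epsilon>])
    fix X :: complex assume X: "0 < norm X" "norm X < \<epsilon>"
    then have X1: "X \<noteq> 1" using \<epsilon> by auto
    have ne: "ell_inv \<rho> X - cnj \<rho> \<noteq> 0"
      using ell_inv_diff(2)[OF X1, of \<rho>] diff_cnj_nonzero[of \<rho>] \<rho> X1 by auto
    define b where "b n = of_real (inc_beta (1 - (norm X)\<^sup>2) (2 * k - 1) (-n)) * X powi n" for n
    define b0 where "b0 n = of_real (inc_beta0 (1 - (norm X)\<^sup>2) (2 * k - 1) (-n)) * X powi n" for n
    obtain S T where S: "((\<lambda>n. cp n * X powi n) has_sum S) {- int n0..}"
      and T: "((\<lambda>n. cm n * b0 n) has_sum T) {n. n \<le> int n0 \<and> n \<notin> {0..nk}}"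
      and F: "F (ell_inv \<rho> X) = (ell_inv \<rho> X - cnj \<rho>) powi (2 * int k - 2) *
         (S + (\<Sum>n=0..nk. cm n * b n) + T)"
      using P[OF X] ell_X_ell_inv[OF \<open>Im \<rho> \<noteq> 0\<close> X1] by (auto simp: ell_r_def b_def b0_def mult.assoc)
    have S': "((\<lambda>n. cp n * X powi n) has_sum S) UNIV"
      using S by (rule has_sum_cong_neutral[THEN iffD1, rotated -1]) (auto simp: cp0)
    have T': "((\<lambda>n. if n \<le> int n0 \<and> n \<notin> {0..nk} then cm n * b0 n else 0) has_sum T) UNIV"
      using T by (rule has_sum_cong_neutral[THEN iffD1, rotated -1]) auto
    have "((\<lambda>n. cm n * b n) has_sum (\<Sum>n=0..nk. cm n * b n)) {0..nk}" by (rule has_sum_finite) simp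
    then have M': "((\<lambda>n. if n \<in> {0..nk} then cm n * b n else 0) has_sum (\<Sum>n=0..nk. cm n * b n)) UNIV"
      by (rule has_sum_cong_neutral[THEN iffD1, rotated -1]) auto
    have "((\<lambda>n. cp n * X powi n + (if n \<in> {0..nk} then cm n * b n else 0) +
        (if n \<le> int n0 \<and> n \<notin> {0..nk} then cm n * b0 n else 0)) has_sum (S + (\<Sum>n=0..nk. cm n * b n) + T)) UNIV"
      by (intro has_sum_add S' M' T')
    moreover have "cp n * X powi n + (if n \<in> {0..nk} then cm n * b n else 0) +
        (if n \<le> int n0 \<and> n \<notin> {0..nk} then cm n * b0 n else 0) =
        (cp n + c n * of_real (beta_star k n (1 - (norm X)\<^sup>2))) * X powi n" for n
      by (auto simp: c_def beta_star_def b_def b0_def nk_def algebra_simps)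
    ultimately show "((\<lambda>n. (cp n + c n * of_real (beta_star k n (1 - (norm X)\<^sup>2))) * X powi n) has_sum
       (F (ell_inv \<rho> X) / (ell_inv \<rho> X - cnj \<rho>) powi (2 * int k - 2))) UNIV"
      using F ne by (simp add: power_int_eq_0_iff)
  qed
qed

text \<open>On each small circle \<open>cp n - dp n\<close> equals \<open>c2 n - c1 n\<close> times
  the kernel at that radius. The left side does not depend on the radius but the kernel does, so
  both differences vanish.\<close>

lemma elliptic_coeff_plus_eq:
  assumes \<rho>: "Im \<rho> > 0" and n0: "n0 > 0" and h: "has_harmonic_elliptic_expansion k F \<rho> n0 cp cm"
  shows "elliptic_coeff_plus k F \<rho> = cp"
  unfolding elliptic_coeff_plus_def
proof (rule the_equality)
  show "\<exists>n0>0. \<exists>cm. has_harmonic_elliptic_expansion k F \<rho> n0 cp cm" using n0 h by blast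
next
  fix dp assume "\<exists>n0>0. \<exists>cm. has_harmonic_elliptic_expansion k F \<rho> n0 dp cm"
  then obtain n1 dm where d: "has_harmonic_elliptic_expansion k F \<rho> n1 dp dm" by blast
  let ?G = "\<lambda>X. F (ell_inv \<rho> X) / (ell_inv \<rho> X - cnj \<rho>) powi (2 * int k - 2)"
  obtain \<epsilon>1 c1 where \<epsilon>1: "0 < \<epsilon>1" "\<epsilon>1 < 1" "\<And>X. 0 < norm X \<Longrightarrow> norm X < \<epsilon>1 \<Longrightarrow>
      ((\<lambda>n. (cp n + c1 n * of_real (beta_star k n (1 - (norm X)\<^sup>2))) * X powi n) has_sum ?G X) UNIV"
    by (rule harmonic_expansion_circle[OF \<rho> h]) blast
  obtain \<epsilon>2 c2 where \<epsilon>2: "0 < \<epsilon>2" "\<epsilon>2 < 1" "\<And>X. 0 < norm X \<Longrightarrow> norm X < \<epsilon>2 \<Longrightarrow>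
      ((\<lambda>n. (dp n + c2 n * of_real (beta_star k n (1 - (norm X)\<^sup>2))) * X powi n) has_sum ?G X) UNIV"
    by (rule harmonic_expansion_circle[OF \<rho> d]) blast
  define \<epsilon> where "\<epsilon> = min \<epsilon>1 \<epsilon>2"
  have \<epsilon>: "0 < \<epsilon>" "\<epsilon> < 1" using \<epsilon>1 \<epsilon>2 by (auto simp: \<epsilon>_def)
  have eq: "cp n + c1 n * of_real (beta_star k n (1 - r\<^sup>2)) = dp n + c2 n * of_real (beta_star k n (1 - r\<^sup>2))"
    if r: "0 < r" "r < \<epsilon>" for r n
    by (rule has_sum_circle_unique[OF r(1), where S = ?G
          and a = "\<lambda>n. cp n + c1 n * of_real (beta_star k n (1 - r\<^sup>2))"
          and b = "\<lambda>n. dp n + c2 n * of_real (beta_star k n (1 - r\<^sup>2))"])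
       (use r \<epsilon>1(3) \<epsilon>2(3) in \<open>auto simp: \<epsilon>_def\<close>)
  show "dp = cp"
  proof
    fix n
    have "c1 n = c2 n"
    proof (rule ccontr)
      assume ne: "c1 n \<noteq> c2 n"
      have "beta_star k n (1 - r\<^sup>2) = Re ((dp n - cp n) / (c1 n - c2 n))" if "0 < r" "r < \<epsilon>" for r
      proof -
        have "of_real (beta_star k n (1 - r\<^sup>2)) = (dp n - cp n) / (c1 n - c2 n)"
          using eq[OF that, of n] ne by (simp add: field_simps)
        then show ?thesis by (metis Re_complex_of_real)
      qed
      then show False by (rule beta_star_not_constant[OF \<epsilon>])
    qed
    moreover obtain r where "0 < r" "r < \<epsilon>" using dense[OF \<epsilon>(1)] by blast
    ultimately show "dp n = cp n" using eq[of r n] by simp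
  qed
qed

section \<open>Expansions of the Poincare series\<close>

definition automorphy_factor :: "int^2^2 \<Rightarrow> complex \<Rightarrow> complex" where
  "automorphy_factor M z = of_int (M $ 2 $ 1) * z + of_int (M $ 2 $ 2)"

lemma automorphy_factor_nonzero:
  fixes M :: "int^2^2"
  assumes "M \<in> SL2Z" "Im z > 0"
  shows "automorphy_factor M z \<noteq> 0"
proof
  assume "automorphy_factor M z = 0"
  then have e: "of_int (M $ 2 $ 1) * z + of_int (M $ 2 $ 2) = 0" by (simp add: automorphy_factor_def)
  then have "Im (of_int (M $ 2 $ 1) * z + of_int (M $ 2 $ 2)) = 0" by simp
  then have "M $ 2 $ 1 = 0" using assms(2) by simp
  moreover from this have "M $ 2 $ 2 = 0" using e by simp
  ultimately show False using assms(1) by (simp add: SL2Z_iff)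
qed

lemma moebius_diff:
  assumes "automorphy_factor M z \<noteq> 0"
  shows "moebius M z - w = lin M w z / automorphy_factor M z"
  using assms by (simp add: moebius_def lin_def automorphy_factor_def diff_divide_distrib)

text \<open>An affine function of \<open>z\<close> is determined by its values at
  \<open>\<rho>\<close> and \<open>cnj \<rho>\<close>; the second is the conjugate of the value at
  \<open>\<rho>\<close> for the parameter \<open>cnj w\<close>. This is why conjugates of
  \<open>p\<close> and \<open>q\<close> appear as coefficients of \<open>X\<close>.\<close>

lemma lin_ell_X:
  assumes "\<rho> - cnj \<rho> \<noteq> 0" "z - cnj \<rho> \<noteq> 0"
  shows "lin M w z = (z - cnj \<rho>) / (\<rho> - cnj \<rho>) * (lin M w \<rho> - cnj (lin M (cnj w) \<rho>) * ell_X \<rho> z)"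
proof -
  have "(\<rho> - cnj \<rho>) * lin M w z = (z - cnj \<rho>) * lin M w \<rho> - (z - \<rho>) * lin M w (cnj \<rho>)"
    by (simp add: lin_def algebra_simps)
  also have "(z - cnj \<rho>) * lin M w \<rho> - (z - \<rho>) * lin M w (cnj \<rho>) =
      (z - cnj \<rho>) * (lin M w \<rho> - cnj (lin M (cnj w) \<rho>) * ell_X \<rho> z)"
  proof -
    have X: "(z - cnj \<rho>) * ell_X \<rho> z = z - \<rho>" using assms(2) by (simp add: ell_X_def)
    have "(z - cnj \<rho>) * (L - K * x) = (z - cnj \<rho>) * L - ((z - cnj \<rho>) * x) * K" for L K x
      by (simp add: algebra_simps)
    then show ?thesis by (simp only: X cnj_lin complex_cnj_cnj)
  qed
  finally show ?thesis using assms(1) by (simp add: field_simps)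
qed

lemma laurent_has_sum:
  fixes a :: "nat \<Rightarrow> complex"
  assumes "((\<lambda>j. a j * X ^ j) has_sum S) UNIV"
  shows "((\<lambda>j. (if j \<ge> 0 then a (nat j) else if j = - int m - 1 then \<kappa> else 0) * X powi j)
     has_sum (S + \<kappa> * X powi (- int m - 1))) UNIV"
proof -
  have "((\<lambda>j::int. a (nat j) * X powi j) has_sum S) {0..}"
    using assms by (subst has_sum_reindex_bij_witness[of "{0..}" int nat UNIV "\<lambda>j. a j * X ^ j"])
      (auto simp: power_int_def)
  then have 1: "((\<lambda>j::int. (if j \<ge> 0 then a (nat j) else 0) * X powi j) has_sum S) UNIV"
    by (rule has_sum_cong_neutral[THEN iffD1, rotated -1]) auto
  have "((\<lambda>j::int. \<kappa> * X powi j) has_sum (\<kappa> * X powi (- int m - 1))) {- int m - 1}"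
    using has_sum_finite[of "{- int m - 1}" "\<lambda>j::int. \<kappa> * X powi j"] by simp
  then have 2: "((\<lambda>j::int. (if j = - int m - 1 then \<kappa> else 0) * X powi j) has_sum (\<kappa> * X powi (- int m - 1))) UNIV"
    by (rule has_sum_cong_neutral[THEN iffD1, rotated -1]) auto
  have "(if j \<ge> 0 then a (nat j) else 0) * X powi j + (if j = - int m - 1 then \<kappa> else 0) * X powi j =
      (if j \<ge> 0 then a (nat j) else if j = - int m - 1 then \<kappa> else 0) * X powi j" for j :: int
    by auto
  with has_sum_add[OF 1 2] show ?thesis by simp
qed

text \<open>\<open>\<zeta>\<close> is the parameter of the series and \<open>\<rho>\<close> the
  centre of expansion. The duality interprets the locale twice, with the two points
  exchanged.\<close>

locale upper_half_points =
  fixes \<zeta> \<rho> :: complex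
  assumes \<zeta>: "Im \<zeta> > 0" and \<rho>: "Im \<rho> > 0"
begin

abbreviation "pp M \<equiv> lin M \<zeta> \<rho>"
abbreviation "qq M \<equiv> lin M (cnj \<zeta>) \<rho>"

text \<open>These matrices carry \<open>\<rho>\<close> to \<open>\<zeta>\<close>, so their summand
  has its pole exactly at the centre of expansion.\<close>

definition "singular = {M \<in> SL2Z. pp M = 0}"
definition "regular = {M \<in> SL2Z. pp M \<noteq> 0}"

lemma SL2Z_split: "SL2Z = regular \<union> singular" "regular \<inter> singular = {}"
  "regular \<subseteq> SL2Z" "singular \<subseteq> SL2Z"
  by (auto simp: singular_def regular_def)

lemma rho_diff: "\<rho> - cnj \<rho> \<noteq> 0" using \<rho> by (intro diff_cnj_nonzero) simp

lemma pq: "M \<in> SL2Z \<Longrightarrow> norm (pp M) < norm (qq M)"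
  using norm_lin_lower(2)[OF \<zeta> \<rho>] .

lemma discriminant: "M \<in> SL2Z \<Longrightarrow> qq M * cnj (qq M) - pp M * cnj (pp M) = of_real (4 * Im \<zeta> * Im \<rho>)"
  using norm_lin_diff[of M \<zeta> \<rho>] by (simp add: complex_norm_square[symmetric] flip: of_real_power of_real_diff)

lemma term_factor:
  assumes M: "M \<in> SL2Z" and z: "Im z > 0"
  shows "lin M \<zeta> z = (z - cnj \<rho>) / (\<rho> - cnj \<rho>) * (pp M - cnj (qq M) * ell_X \<rho> z)"
    and "lin M (cnj \<zeta>) z = (z - cnj \<rho>) / (\<rho> - cnj \<rho>) * (qq M - cnj (pp M) * ell_X \<rho> z)"
    and "z - cnj \<rho> \<noteq> 0" and "lin M (cnj \<zeta>) z \<noteq> 0"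
proof -
  show zr: "z - cnj \<rho> \<noteq> 0" using z \<rho> by (auto simp: complex_eq_iff)
  show "lin M \<zeta> z = (z - cnj \<rho>) / (\<rho> - cnj \<rho>) * (pp M - cnj (qq M) * ell_X \<rho> z)"
    using lin_ell_X[OF rho_diff zr] .
  show "lin M (cnj \<zeta>) z = (z - cnj \<rho>) / (\<rho> - cnj \<rho>) * (qq M - cnj (pp M) * ell_X \<rho> z)"
    using lin_ell_X[OF rho_diff zr, of M "cnj \<zeta>"] by simp
  show "lin M (cnj \<zeta>) z \<noteq> 0" using norm_lin_lower(2)[OF \<zeta> z M] by auto
qed

section \<open>The summands in the local coordinate\<close>

lemma Psi_term:
  assumes k: "k \<ge> 1" and M: "M \<in> SL2Z" and z: "Im z > 0"
  shows "slash (2 * int k) (\<lambda>w. (w - cnj \<zeta>) powi (- 2 * int k) * ell_X \<zeta> w powi (- int n - 1)) M z =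
    (z - cnj \<rho>) powi (- 2 * int k) * ((\<rho> - cnj \<rho>) ^ (2 * k) * psi_loc (2 * k - 2) n (pp M) (qq M) (ell_X \<rho> z))"
proof -
  define e where "e = automorphy_factor M z"
  define P Q where "P = lin M \<zeta> z" and "Q = lin M (cnj \<zeta>) z"
  define t where "t = (z - cnj \<rho>) / (\<rho> - cnj \<rho>)"
  define A B where "A = pp M - cnj (qq M) * ell_X \<rho> z" and "B = qq M - cnj (pp M) * ell_X \<rho> z"
  have e: "e \<noteq> 0" unfolding e_def by (rule automorphy_factor_nonzero[OF M z])
  note tf = term_factor[OF M z]
  have PQ: "P = t * A" "Q = t * B" "Q \<noteq> 0" using tf by (simp_all add: P_def Q_def t_def A_def B_def)
  have t: "t \<noteq> 0" using tf(3) rho_diff by (simp add: t_def)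
  have B: "B \<noteq> 0" using PQ by auto
  have mq: "moebius M z - cnj \<zeta> = Q / e" and mp: "moebius M z - \<zeta> = P / e"
    using moebius_diff[of M z] e by (simp_all add: e_def P_def Q_def)
  have X: "ell_X \<zeta> (moebius M z) = A / B"
    unfolding ell_X_def mq mp using e t by (simp add: PQ)
  have pw: "x powi (- 2 * int k) = inverse x ^ (2 * k)" for x :: complex
  proof -
    have "- 2 * int k = - int (2 * k)" by simp
    then show ?thesis by (simp only: power_int_minus power_int_of_nat power_inverse)
  qed
  have pw1: "x powi (- int n - 1) = inverse x ^ (n + 1)" for x :: complex
  proof -
    have "- int n - 1 = - int (n + 1)" by simp
    then show ?thesis by (simp only: power_int_minus power_int_of_nat power_inverse)
  qed
  have "slash (2 * int k) (\<lambda>w. (w - cnj \<zeta>) powi (- 2 * int k) * ell_X \<zeta> w powi (- int n - 1)) M z =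
      inverse e ^ (2 * k) * (inverse (Q / e) ^ (2 * k) * inverse (A / B) ^ (n + 1))"
    unfolding slash_def automorphy_factor_def[symmetric] e_def[symmetric] mq X using pw[of e] pw1 pw by simp
  also have "\<dots> = inverse Q ^ (2 * k) * inverse (A / B) ^ (n + 1)"
  proof -
    have "inverse e * inverse (Q / e) = inverse Q" using e by (simp add: inverse_eq_divide)
    then show ?thesis by (simp only: mult.assoc[symmetric] power_mult_distrib[symmetric])
  qed
  also have "inverse Q ^ (2 * k) = inverse t ^ (2 * k) * inverse B ^ (2 * k)"
    unfolding PQ by (simp add: power_mult_distrib)
  also have "inverse t ^ (2 * k) = inverse (z - cnj \<rho>) ^ (2 * k) * (\<rho> - cnj \<rho>) ^ (2 * k)"
    unfolding t_def by (simp add: power_divide divide_inverse power_mult_distrib power_inverse)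
  also have "inverse (z - cnj \<rho>) ^ (2 * k) * (\<rho> - cnj \<rho>) ^ (2 * k) * inverse B ^ (2 * k) * inverse (A / B) ^ (n + 1) =
      inverse (z - cnj \<rho>) ^ (2 * k) * ((\<rho> - cnj \<rho>) ^ (2 * k) * (inverse B ^ (2 * k) * inverse (A / B) ^ (n + 1)))"
    by (simp only: mult.assoc)
  also have "inverse B ^ (2 * k) * inverse (A / B) ^ (n + 1) = psi_loc (2 * k - 2) n (pp M) (qq M) (ell_X \<rho> z)"
  proof -
    have "2 * k = (2 * k - 2 + 1) + 1" using k by simp
    then have "inverse B ^ (2 * k) = inverse B ^ (2 * k - 2 + 1) * inverse B" by (metis power_add power_one_right)
    moreover have "inverse (A / B) ^ (n + 1) = B ^ n * B * inverse A ^ (n + 1)"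
      by (simp add: divide_inverse power_mult_distrib)
    ultimately show ?thesis unfolding psi_loc_def A_def[symmetric] B_def[symmetric] using B by simp
  qed
  finally show ?thesis unfolding pw .
qed

lemma PP_term:
  assumes k: "k \<ge> 1" and M: "M \<in> SL2Z" and z: "Im z > 0"
  shows "slash (2 - 2 * int k) (\<lambda>w. (w - cnj \<zeta>) powi (2 * int k - 2) *
        of_real (inc_beta (1 - (ell_r \<zeta> w)\<^sup>2) (2 * k - 1) (- (- int m - 1))) * ell_X \<zeta> w powi (- int m - 1)) M z =
    of_real (beta_const (2 * k - 1) (int (m + 1))) * ((z - cnj \<rho>) powi (2 * int k - 2) *
     (inverse ((\<rho> - cnj \<rho>) ^ (2 * k - 2)) * phi_loc (2 * k - 2) m (pp M) (qq M) (ell_X \<rho> z) (cnj (ell_X \<rho> z))))"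
proof -
  define N where "N = 2 * k - 2"
  have N1: "2 * k - 1 = N + 1" using k by (simp add: N_def)
  define e where "e = automorphy_factor M z"
  define P Q where "P = lin M \<zeta> z" and "Q = lin M (cnj \<zeta>) z"
  define t where "t = (z - cnj \<rho>) / (\<rho> - cnj \<rho>)"
  define X where "X = ell_X \<rho> z"
  define A B where "A = pp M - cnj (qq M) * X" and "B = qq M - cnj (pp M) * X"
  define C where "C = beta_const (2 * k - 1) (int (m + 1))"
  have e: "e \<noteq> 0" unfolding e_def by (rule automorphy_factor_nonzero[OF M z])
  note tf = term_factor[OF M z]
  have PQ: "P = t * A" "Q = t * B" "Q \<noteq> 0" using tf by (simp_all add: P_def Q_def t_def A_def B_def X_def)
  have t: "t \<noteq> 0" using tf(3) rho_diff by (simp add: t_def)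
  have B: "B \<noteq> 0" using PQ by auto
  have mq: "moebius M z - cnj \<zeta> = Q / e" and mp: "moebius M z - \<zeta> = P / e"
    using moebius_diff[of M z] e by (simp_all add: e_def P_def Q_def)
  have XX: "ell_X \<zeta> (moebius M z) = A / B"
    unfolding ell_X_def mq mp using e t by (simp add: PQ)
  have pw: "x powi (2 * int k - 2) = x ^ N" for x :: complex
  proof -
    have "2 * int k - 2 = int N" using k by (simp add: N_def)
    then show ?thesis by (simp only: power_int_of_nat)
  qed
  have pw1: "x powi (- int m - 1) = inverse x ^ (m + 1)" for x :: complex
  proof -
    have "- int m - 1 = - int (m + 1)" by simp
    then show ?thesis by (simp only: power_int_minus power_int_of_nat power_inverse)
  qed
  have r: "(ell_r \<zeta> (moebius M z))\<^sup>2 \<le> 1"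
  proof -
    have "ell_X \<zeta> (moebius M z) = P / Q" unfolding XX using t by (simp add: PQ)
    then have "ell_r \<zeta> (moebius M z) = norm P / norm Q" by (simp add: ell_r_def norm_divide)
    also have "\<dots> \<le> 1" using norm_lin_lower(2)[OF \<zeta> z M] by (simp add: P_def Q_def divide_le_eq)
    finally show ?thesis by (simp add: ell_r_def power_le_one)
  qed
  have beta: "inc_beta (1 - (ell_r \<zeta> (moebius M z))\<^sup>2) (2 * k - 1) (- (- int m - 1)) =
      C * cutoff N m ((ell_r \<zeta> (moebius M z))\<^sup>2)"
    using inc_beta_normalised[OF r, of N m] unfolding C_def N1 by simp
  have cut: "complex_of_real (cutoff N m ((ell_r \<zeta> (moebius M z))\<^sup>2)) =
      cutoff N m ((A * (cnj (pp M) - qq M * cnj X)) / (B * (cnj (qq M) - pp M * cnj X)))"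
    unfolding of_real_cutoff ell_r_def XX complex_norm_square
    by (simp add: A_def B_def)
  have "slash (2 - 2 * int k) (\<lambda>w. (w - cnj \<zeta>) powi (2 * int k - 2) *
        of_real (inc_beta (1 - (ell_r \<zeta> w)\<^sup>2) (2 * k - 1) (- (- int m - 1))) * ell_X \<zeta> w powi (- int m - 1)) M z =
      e ^ N * ((Q / e) ^ N * (of_real C * cutoff N m ((A * (cnj (pp M) - qq M * cnj X)) / (B * (cnj (qq M) - pp M * cnj X)))) *
        inverse (A / B) ^ (m + 1))" (is "_ = e ^ N * ((Q / e) ^ N * (of_real C * ?E) * _)")
    unfolding slash_def automorphy_factor_def[symmetric] e_def[symmetric] mq beta of_real_mult cut pw pw1 XX minus_diff_eq[of "2::int"] ..
  also have "\<dots> = of_real C * (Q ^ N * (inverse (A / B) ^ (m + 1) * ?E))"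
    using e by (simp add: power_divide)
  also have "Q ^ N = (z - cnj \<rho>) ^ N * (inverse ((\<rho> - cnj \<rho>) ^ N) * B ^ N)"
    unfolding PQ t_def by (simp add: power_divide divide_inverse power_mult_distrib power_inverse)
  also have "(z - cnj \<rho>) ^ N * (inverse ((\<rho> - cnj \<rho>) ^ N) * B ^ N) * (inverse (A / B) ^ (m + 1) * ?E) =
      (z - cnj \<rho>) ^ N * (inverse ((\<rho> - cnj \<rho>) ^ N) * (B ^ N * inverse (A / B) ^ (m + 1) * ?E))"
    by (simp only: mult.assoc)
  also have "B ^ N * inverse (A / B) ^ (m + 1) = B ^ (N + m + 1) * inverse A ^ (m + 1)"
    by (simp add: divide_inverse power_mult_distrib power_add mult_ac)
  also have "B ^ (N + m + 1) * inverse A ^ (m + 1) * ?E = phi_loc N m (pp M) (qq M) X (cnj X)"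
    unfolding phi_loc_def A_def B_def ..
  finally show ?thesis unfolding C_def N_def[symmetric] X_def pw .
qed

lemma qq_summable: "(\<lambda>M. K * inverse (norm (qq M) ^ (N + 2))) summable_on S" if "N \<ge> 2" "S \<subseteq> SL2Z"
  using summable_on_norm_lin[OF \<zeta> \<rho>, of "N + 2"] that
  by (intro summable_on_cmult_right) (auto intro: summable_on_subset_banach)

text \<open>Here \<open>1 - v = D * (1 - |X|^2) / |B|^2\<close> is at most
  \<open>4 * D / |q|^2\<close>, and \<open>cutoff\<close> contains its power \<open>N + 1\<close>;
  against the remaining growth \<open>|q|^N\<close> this leaves \<open>|q|^(-N-2)\<close>. The
  factor \<open>|X|^(m+1)\<close> compensates the pole through \<open>|A| \<ge> |q| |X|\<close>,
  which holds for regular and singular matrices alike.\<close>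

lemma norm_phi_loc_le:
  assumes M: "M \<in> SL2Z" and X: "X \<noteq> 0" "norm X \<le> \<delta> / 2" and \<delta>: "\<delta> \<le> 1/2"
    and low: "pp M \<noteq> 0 \<Longrightarrow> \<delta> * norm (qq M) \<le> norm (pp M)"
  shows "pp M - cnj (qq M) * X \<noteq> 0"
    and "norm (phi_loc N m (pp M) (qq M) X (cnj X)) * norm X ^ (m + 1) \<le>
       2 ^ (N + m + 1) * (16 * Im \<zeta> * Im \<rho>) ^ (N + 1) * (\<Sum>l\<le>m. of_nat ((N + l) choose l)) * inverse (norm (qq M) ^ (N + 2))"
proof -
  define p q where "p = pp M" and "q = qq M"
  define A B where "A = p - cnj q * X" and "B = q - cnj p * X"
  define D where "D = 4 * Im \<zeta> * Im \<rho>"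
  have D: "D > 0" using \<zeta> \<rho> by (simp add: D_def)
  have pq': "norm p < norm q" using pq[OF M] by (simp add: p_def q_def)
  then have q0: "norm q > 0" using norm_ge_zero[of p] by linarith
  have X1: "norm X \<le> 1/2" "norm X > 0" using X \<delta> by auto
  have A: "norm q * norm X \<le> norm A"
  proof (cases "p = 0")
    case True then show ?thesis by (simp add: A_def norm_mult)
  next
    case False
    then have "\<delta> * norm q / 2 \<le> norm A"
      unfolding A_def using low X(2) by (intro norm_numerator_ge) (auto simp: p_def q_def)
    moreover have "norm q * norm X \<le> norm q * (\<delta> / 2)" using X(2) by (intro mult_left_mono) auto
    ultimately show ?thesis by (simp add: mult.commute)
  qed
  have A0: "norm A > 0" using A mult_pos_pos[OF q0 X1(2)] by linarith
  then show "pp M - cnj (qq M) * X \<noteq> 0" by (auto simp: A_def p_def q_def)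
  have B2: "norm B \<le> 2 * norm q" unfolding B_def using pq' X1 by (intro norm_affine_le) auto
  have B1: "norm q / 2 \<le> norm B" unfolding B_def using pq' X1 by (intro norm_denominator_ge) auto
  have B0: "norm B > 0" using B1 q0 by linarith
  define v where "v = (norm A)\<^sup>2 / (norm B)\<^sup>2"
  have cv: "complex_of_real v = (A * (cnj p - q * cnj X)) / (B * (cnj q - p * cnj X))"
    unfolding v_def of_real_divide complex_norm_square by (simp add: A_def B_def)
  have dAB: "(norm B)\<^sup>2 - (norm A)\<^sup>2 = D * (1 - (norm X)\<^sup>2)"
  proof -
    have "complex_of_real ((norm B)\<^sup>2 - (norm A)\<^sup>2) = (q * cnj q - p * cnj p) * (1 - X * cnj X)"
      unfolding of_real_diff complex_norm_square by (simp add: A_def B_def algebra_simps)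
    also have "\<dots> = of_real (D * (1 - (norm X)\<^sup>2))"
      unfolding p_def q_def D_def of_real_mult[of _ "1 - _"] of_real_diff complex_norm_square discriminant[OF M] by simp
    finally show ?thesis by (simp only: of_real_eq_iff)
  qed
  have v1: "1 - v = D * (1 - (norm X)\<^sup>2) / (norm B)\<^sup>2"
    unfolding v_def dAB[symmetric] using B0 by (simp add: diff_divide_distrib)
  have xx: "(norm X)\<^sup>2 \<le> 1" using X1 by (simp add: power_le_one)
  have v0: "0 \<le> v" "0 \<le> 1 - v" unfolding v1 using D xx by (auto simp: v_def)
  have v2: "1 - v \<le> 4 * D / (norm q)\<^sup>2"
  proof -
    have "(norm q / 2)\<^sup>2 \<le> (norm B)\<^sup>2" using B1 by (intro power_mono) auto
    then have "D * (1 - (norm X)\<^sup>2) / (norm B)\<^sup>2 \<le> D * 1 / (norm q / 2)\<^sup>2"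
      using D q0 xx by (intro frac_le mult_left_mono) auto
    then show ?thesis unfolding v1 by (simp add: power_divide mult.commute)
  qed
  have cutb: "norm (cutoff N m (complex_of_real v)) \<le> (4 * D / (norm q)\<^sup>2) ^ (N + 1) * (\<Sum>l\<le>m. of_nat ((N + l) choose l))"
  proof -
    have "norm (cutoff N m (complex_of_real v)) = \<bar>cutoff N m v\<bar>"
      by (simp flip: of_real_cutoff)
    also have "\<dots> = (1 - v) ^ (N + 1) * (\<Sum>l\<le>m. of_nat ((N + l) choose l) * v ^ l)"
      unfolding cutoff_def using v0 by (intro abs_of_nonneg mult_nonneg_nonneg sum_nonneg) auto
    also have "\<dots> \<le> (4 * D / (norm q)\<^sup>2) ^ (N + 1) * (\<Sum>l\<le>m. of_nat ((N + l) choose l) * 1)"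
      using v0 v2 D by (intro mult_mono power_mono sum_mono mult_left_mono power_le_one sum_nonneg) auto
    finally show ?thesis by simp
  qed
  have iA: "inverse (norm A) * norm X \<le> inverse (norm q)"
  proof -
    have "inverse (norm A) \<le> inverse (norm q * norm X)" using A q0 X1 by (intro le_imp_inverse_le) auto
    then have "inverse (norm A) * norm X \<le> inverse (norm q * norm X) * norm X" by (rule mult_right_mono) simp
    also have "\<dots> = inverse (norm q)" using X1 by (simp add: field_simps)
    finally show ?thesis .
  qed
  have "norm (phi_loc N m p q X (cnj X)) * norm X ^ (m + 1) =
      norm B ^ (N + m + 1) * (inverse (norm A) * norm X) ^ (m + 1) * norm (cutoff N m (complex_of_real v))"
    unfolding phi_loc_def cv A_def[symmetric] B_def[symmetric] norm_mult norm_power norm_inverse power_mult_distrib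
    by (simp only: mult_ac)
  also have "\<dots> \<le> (2 * norm q) ^ (N + m + 1) * inverse (norm q) ^ (m + 1) *
      ((4 * D / (norm q)\<^sup>2) ^ (N + 1) * (\<Sum>l\<le>m. of_nat ((N + l) choose l)))"
    using B2 iA cutb q0 A0 by (intro mult_mono power_mono) auto
  also have "\<dots> = 2 ^ (N + m + 1) * (4 * D) ^ (N + 1) * (\<Sum>l\<le>m. of_nat ((N + l) choose l)) * inverse (norm q ^ (N + 2))"
  proof -
    have "(2 * x) ^ (N + m + 1) * inverse x ^ (m + 1) * ((4 * D / x\<^sup>2) ^ (N + 1) * S) =
       2 ^ (N + m + 1) * (4 * D) ^ (N + 1) * S * inverse (x ^ (N + 2))" if x: "x > 0" for x S :: real
    proof -
      have one: "x ^ j * inverse x ^ j = 1" for j unfolding power_mult_distrib[symmetric] using x by simp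
      have "(2 * x) ^ (N + m + 1) * inverse x ^ (m + 1) * ((4 * D / x\<^sup>2) ^ (N + 1) * S) =
        2 ^ (N + m + 1) * (4 * D) ^ (N + 1) * S * (x ^ N * inverse x ^ N) * (x ^ (m + 1) * inverse x ^ (m + 1)) * inverse x ^ (N + 2)"
        by (simp add: divide_inverse power_mult_distrib power_add power2_eq_square power_inverse mult_ac)
      then show ?thesis unfolding one by (simp add: power_inverse)
    qed
    from this[OF q0] show ?thesis .
  qed
  finally show "norm (phi_loc N m (pp M) (qq M) X (cnj X)) * norm X ^ (m + 1) \<le>
       2 ^ (N + m + 1) * (16 * Im \<zeta> * Im \<rho>) ^ (N + 1) * (\<Sum>l\<le>m. of_nat ((N + l) choose l)) * inverse (norm (qq M) ^ (N + 2))"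
    by (simp add: D_def p_def q_def mult.assoc)
qed

lemma regular_imp: "M \<in> regular \<Longrightarrow> M \<in> SL2Z" "M \<in> regular \<Longrightarrow> pp M \<noteq> 0"
  and singular_imp: "M \<in> singular \<Longrightarrow> M \<in> SL2Z" "M \<in> singular \<Longrightarrow> pp M = 0"
  by (simp_all add: regular_def singular_def)

lemma qq_pos: "M \<in> SL2Z \<Longrightarrow> norm (qq M) > 0"
  using pq[of M] norm_ge_zero[of "pp M"] by linarith

text \<open>A choice fixed once, so that all expansions share the radius
  \<open>ratio_bound / 2\<close>. The cap 1/2 keeps \<open>|X|\<close> below 1/4, inside the disc
  used for the antiholomorphic part.\<close>

definition ratio_bound :: real where
  "ratio_bound = (SOME \<delta>. 0 < \<delta> \<and> \<delta> \<le> 1/2 \<and>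
     (\<forall>M\<in>SL2Z. pp M \<noteq> 0 \<longrightarrow> \<delta> * norm (qq M) \<le> norm (pp M)))"

lemma ratio_bound:
  "0 < ratio_bound" "ratio_bound \<le> 1/2" "ratio_bound \<le> 1"
  "M \<in> SL2Z \<Longrightarrow> pp M \<noteq> 0 \<Longrightarrow> ratio_bound * norm (qq M) \<le> norm (pp M)"
proof -
  have "\<exists>\<delta>. 0 < \<delta> \<and> \<delta> \<le> 1/2 \<and> (\<forall>M\<in>SL2Z. pp M \<noteq> 0 \<longrightarrow> \<delta> * norm (qq M) \<le> norm (pp M))"
    using lin_ratio_bounded_below[OF \<zeta> \<rho>] by metis
  then have "0 < ratio_bound \<and> ratio_bound \<le> 1/2 \<and>
      (\<forall>M\<in>SL2Z. pp M \<noteq> 0 \<longrightarrow> ratio_bound * norm (qq M) \<le> norm (pp M))"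
    unfolding ratio_bound_def by (rule someI_ex)
  then show "0 < ratio_bound" "ratio_bound \<le> 1/2" "ratio_bound \<le> 1"
    "M \<in> SL2Z \<Longrightarrow> pp M \<noteq> 0 \<Longrightarrow> ratio_bound * norm (qq M) \<le> norm (pp M)"
    by auto
qed

lemma regular_series:
  assumes N: "N \<ge> 2" and X: "norm X < ratio_bound / 2"
    and hol: "\<And>M. M \<in> regular \<Longrightarrow> f M holomorphic_on ball 0 (ratio_bound / 2)"
    and bound: "\<And>M X. M \<in> regular \<Longrightarrow> norm X \<le> ratio_bound / 2 \<Longrightarrow> norm (f M X) \<le> K * inverse (norm (qq M) ^ (N + 2))"
  shows "(\<lambda>M. f M X) summable_on regular"
    and "((\<lambda>j. (\<Sum>\<^sub>\<infinity>M\<in>regular. taylor_coeff (f M) j) * X ^ j) has_sum (\<Sum>\<^sub>\<infinity>M\<in>regular. f M X)) UNIV"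
proof -
  have K: "(\<lambda>M. K * inverse (norm (qq M) ^ (N + 2))) summable_on regular"
    using N SL2Z_split(3) by (rule qq_summable)
  have b: "norm (f M X) \<le> K * inverse (norm (qq M) ^ (N + 2))" if "M \<in> regular" "X \<in> ball 0 (ratio_bound / 2)" for M X
    using bound[of M X] that by simp
  have w: "norm (X ^ n) \<le> 1 * norm X ^ n" for n by (simp add: norm_power)
  have V: "(\<lambda>n. taylor_coeff (f M) n * X ^ n) sums f M X" if "M \<in> regular" for M
    using hol[OF that] X by (rule taylor_coeff_sums)
  show "(\<lambda>M. f M X) summable_on regular"
    and "((\<lambda>j. (\<Sum>\<^sub>\<infinity>M\<in>regular. taylor_coeff (f M) j) * X ^ j) has_sum (\<Sum>\<^sub>\<infinity>M\<in>regular. f M X)) UNIV"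
    using family_power_series[OF hol b K w norm_ge_zero X V] by blast+
qed

lemma singular_series:
  fixes f g :: "int^2^2 \<Rightarrow> complex"
  assumes N: "N \<ge> 2" and g: "\<And>M. M \<in> singular \<Longrightarrow> f M = g M * c"
    and bound: "\<And>M. M \<in> singular \<Longrightarrow> norm (g M) \<le> K * inverse (norm (qq M) ^ (N + 2))"
  shows "f summable_on singular" and "(\<Sum>\<^sub>\<infinity>M\<in>singular. f M) = (\<Sum>\<^sub>\<infinity>M\<in>singular. g M) * c"
proof -
  have K: "(\<lambda>M. K * inverse (norm (qq M) ^ (N + 2))) summable_on singular"
    using N SL2Z_split(4) by (rule qq_summable)
  have sg: "g summable_on singular"
    by (rule abs_summable_summable, rule Infinite_Sum.abs_summable_on_comparison_test'[OF K bound])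
  have "f summable_on singular \<longleftrightarrow> (\<lambda>M. g M * c) summable_on singular"
    using g by (rule summable_on_cong)
  then show "f summable_on singular" using summable_on_cmult_left[OF sg, of c] by simp
  have "(\<Sum>\<^sub>\<infinity>M\<in>singular. f M) = (\<Sum>\<^sub>\<infinity>M\<in>singular. g M * c)" using g by (rule infsum_cong)
  also have "\<dots> = (\<Sum>\<^sub>\<infinity>M\<in>singular. g M) * c" using sg by (intro infsum_cmult_left) auto
  finally show "(\<Sum>\<^sub>\<infinity>M\<in>singular. f M) = (\<Sum>\<^sub>\<infinity>M\<in>singular. g M) * c" .
qed

lemma infsum_split:
  fixes f :: "_ \<Rightarrow> complex"
  assumes "f summable_on regular" "f summable_on singular"
  shows "(\<Sum>\<^sub>\<infinity>M\<in>SL2Z. f M) = (\<Sum>\<^sub>\<infinity>M\<in>regular. f M) + (\<Sum>\<^sub>\<infinity>M\<in>singular. f M)"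
  unfolding SL2Z_split(1) using assms SL2Z_split(2) by (rule infsum_Un_disjoint)

lemma psi_loc_singular:
  "psi_loc N n 0 q X = (q ^ n * inverse q ^ (N + 1) * inverse (- cnj q) ^ (n + 1)) * X powi (- int n - 1)"
proof -
  have "- int n - 1 = - int (n + 1)" by simp
  then have "X powi (- int n - 1) = inverse X ^ (n + 1)"
    by (simp only: power_int_minus power_int_of_nat power_inverse)
  moreover have "inverse (0 - cnj q * X) ^ (n + 1) = inverse (- cnj q) ^ (n + 1) * inverse X ^ (n + 1)"
    by (simp only: power_mult_distrib[symmetric] inverse_mult_distrib[symmetric]) simp
  ultimately show ?thesis unfolding psi_loc_def by simp
qed

text \<open>The regular summands are holomorphic on a common disc and add up to a Taylor series.
  Each singular summand is an exact multiple of \<open>X^(-n-1)\<close>, so the principal part is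
  one term.\<close>

lemma Psi_expansion:
  assumes k: "k > 1"
  shows "has_elliptic_expansion k (Psi k \<zeta> (- int n - 1)) \<rho>
    (\<lambda>j. (\<rho> - cnj \<rho>) ^ (2 * k) *
       (if j \<ge> 0 then \<Sum>\<^sub>\<infinity>M\<in>regular. taylor_coeff (psi_loc (2 * k - 2) n (pp M) (qq M)) (nat j)
        else if j = - int n - 1
        then \<Sum>\<^sub>\<infinity>M\<in>singular. qq M ^ n * inverse (qq M) ^ (2 * k - 2 + 1) * inverse (- cnj (qq M)) ^ (n + 1)
        else 0))" (is "has_elliptic_expansion _ _ _ (\<lambda>j. _ * ?c j)")
  unfolding has_elliptic_expansion_def
proof
  show "\<exists>N. \<forall>j<N. (\<rho> - cnj \<rho>) ^ (2 * k) * ?c j = 0"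
    by (rule exI[of _ "- int n - 1"]) auto
  define N where "N = 2 * k - 2"
  have N: "N \<ge> 2" using k by (simp add: N_def)
  have "\<forall>\<^sub>F z in at \<rho>. Im z > 0 \<and> ell_X \<rho> z \<noteq> 0 \<and> norm (ell_X \<rho> z) < ratio_bound / 2"
    using \<rho> ratio_bound(1) by (intro eventually_at_ell_X) auto
  then show "\<forall>\<^sub>F z in at \<rho>. \<exists>S. ((\<lambda>j. (\<rho> - cnj \<rho>) ^ (2 * k) * ?c j * ell_X \<rho> z powi j) has_sum S) UNIV \<and>
      Psi k \<zeta> (- int n - 1) z = (z - cnj \<rho>) powi (- 2 * int k) * S"
  proof eventually_elim
    case (elim z)
    define X where "X = ell_X \<rho> z"
    let ?f = "\<lambda>M. psi_loc N n (pp M) (qq M) X"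
    let ?g = "\<lambda>M. qq M ^ n * inverse (qq M) ^ (N + 1) * inverse (- cnj (qq M)) ^ (n + 1)"
    have X: "norm X < ratio_bound / 2" using elim by (simp add: X_def)
    have hol: "psi_loc N n (pp M) (qq M) holomorphic_on ball 0 (ratio_bound / 2)" if "M \<in> regular" for M
      using local_terms_holomorphic(1)[OF pq ratio_bound(1,3,4)] that regular_imp by blast
    have bound: "norm (psi_loc N n (pp M) (qq M) X) \<le> 2 ^ n * 2 ^ (N + 1) * (2 / ratio_bound) ^ (n + 1) *
        inverse (norm (qq M) ^ (N + 2))" if "M \<in> regular" "norm X \<le> ratio_bound / 2" for M X
      using norm_psi_loc_le[OF pq ratio_bound(1,3,4), of M X N n] that regular_imp by simp
    have R: "?f summable_on regular"
      "((\<lambda>j. (\<Sum>\<^sub>\<infinity>M\<in>regular. taylor_coeff (psi_loc N n (pp M) (qq M)) j) * X ^ j) has_sum infsum ?f regular) UNIV"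
      by (rule regular_series[OF N X hol bound]; assumption)+
    have sing: "?f M = ?g M * X powi (- int n - 1)" if "M \<in> singular" for M
      using psi_loc_singular[of N n "qq M" X] singular_imp(2)[OF that] by simp
    have sb: "norm (?g M) \<le> 1 * inverse (norm (qq M) ^ (N + 2))" if "M \<in> singular" for M
    proof -
      have q: "norm (qq M) > 0" using qq_pos singular_imp(1)[OF that] .
      have "norm (?g M) = norm (qq M) ^ n * inverse (norm (qq M)) ^ (N + 1) * inverse (norm (qq M)) ^ (n + 1)"
        by (simp add: norm_mult norm_power norm_inverse)
      also have "\<dots> = 1 * inverse (norm (qq M) ^ (N + 2))"
        using power_collect(1)[of "norm (qq M)" 1 n 1 N 1] q by (simp add: divide_inverse)
      finally show ?thesis by simp
    qed
    have S: "?f summable_on singular" "infsum ?f singular = infsum ?g singular * X powi (- int n - 1)"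
      by (rule singular_series[OF N sing sb]; assumption)+
    have "((\<lambda>j. ?c j * X powi j) has_sum ((\<Sum>\<^sub>\<infinity>M\<in>regular. ?f M) + (\<Sum>\<^sub>\<infinity>M\<in>singular. ?g M) * X powi (- int n - 1))) UNIV"
      using laurent_has_sum[OF R(2), where m = n and \<kappa> = "\<Sum>\<^sub>\<infinity>M\<in>singular. ?g M"] unfolding N_def .
    then have "((\<lambda>j. ?c j * X powi j) has_sum (\<Sum>\<^sub>\<infinity>M\<in>SL2Z. ?f M)) UNIV"
      unfolding infsum_split[OF R(1) S(1)] S(2) .
    from has_sum_cmult_right[OF this, of "(\<rho> - cnj \<rho>) ^ (2 * k)"]
    have "((\<lambda>j. (\<rho> - cnj \<rho>) ^ (2 * k) * ?c j * X powi j) has_sum ((\<rho> - cnj \<rho>) ^ (2 * k) * (\<Sum>\<^sub>\<infinity>M\<in>SL2Z. ?f M))) UNIV"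
      by (simp only: mult.assoc)
    moreover have "Psi k \<zeta> (- int n - 1) z =
        (z - cnj \<rho>) powi (- 2 * int k) * ((\<rho> - cnj \<rho>) ^ (2 * k) * (\<Sum>\<^sub>\<infinity>M\<in>SL2Z. ?f M))"
    proof -
      have "Psi k \<zeta> (- int n - 1) z =
          (\<Sum>\<^sub>\<infinity>M\<in>SL2Z. (z - cnj \<rho>) powi (- 2 * int k) * ((\<rho> - cnj \<rho>) ^ (2 * k) * ?f M))"
        unfolding Psi_def N_def X_def using k elim by (intro infsum_cong Psi_term) auto
      then show ?thesis by (simp only: infsum_cmult_right')
    qed
    ultimately show ?case unfolding X_def by blast
  qed
qed

section \<open>Expansion of the series of weight 2 - 2k\<close>

definition phi_anti_coeff :: "nat \<Rightarrow> nat \<Rightarrow> nat \<Rightarrow> complex" where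
  "phi_anti_coeff N m j = (\<Sum>\<^sub>\<infinity>M\<in>SL2Z. taylor_coeff (phi_anti N m (pp M) (qq M)) j)"

definition phi_residue :: "nat \<Rightarrow> nat \<Rightarrow> complex" where
  "phi_residue N m = (\<Sum>\<^sub>\<infinity>M\<in>singular. qq M ^ (N + m + 1) * inverse (- cnj (qq M)) ^ (m + 1))"

definition phi_bound :: "nat \<Rightarrow> nat \<Rightarrow> real" where
  "phi_bound N m = (\<Sum>\<^sub>\<infinity>M\<in>SL2Z. 2 ^ (N + m + 1) * (16 * Im \<zeta> * Im \<rho>) ^ (N + 1) *
      (\<Sum>l\<le>m. of_nat ((N + l) choose l)) * inverse (norm (qq M) ^ (N + 2)))"

lemma phi_numerator_nonzero:
  assumes "M \<in> SL2Z" "X \<noteq> 0" "norm X \<le> ratio_bound / 2"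
  shows "pp M - cnj (qq M) * X \<noteq> 0"
  using norm_phi_loc_le(1)[OF assms ratio_bound(2,4)] assms(1) by blast

lemma norm_infsum_phi_loc_le:
  assumes N: "N \<ge> 2" and X: "X \<noteq> 0" "norm X \<le> ratio_bound / 2"
  shows "norm (\<Sum>\<^sub>\<infinity>M\<in>SL2Z. phi_loc N m (pp M) (qq M) X (cnj X)) * norm X ^ (m + 1) \<le> phi_bound N m"
proof -
  let ?f = "\<lambda>M. phi_loc N m (pp M) (qq M) X (cnj X) * of_real (norm X ^ (m + 1))"
  let ?b = "\<lambda>M. 2 ^ (N + m + 1) * (16 * Im \<zeta> * Im \<rho>) ^ (N + 1) *
      (\<Sum>l\<le>m. of_nat ((N + l) choose l)) * inverse (norm (qq M) ^ (N + 2))"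
  have b: "norm (?f M) \<le> ?b M" if "M \<in> SL2Z" for M
    using norm_phi_loc_le(2)[OF that X ratio_bound(2,4)] that by (simp add: norm_mult norm_power)
  have sb: "?b summable_on SL2Z" using N by (intro qq_summable) auto
  have sf: "(\<lambda>M. norm (?f M)) summable_on SL2Z"
    by (rule Infinite_Sum.abs_summable_on_comparison_test'[OF sb b])
  have "norm (\<Sum>\<^sub>\<infinity>M\<in>SL2Z. phi_loc N m (pp M) (qq M) X (cnj X)) * norm X ^ (m + 1) = norm (\<Sum>\<^sub>\<infinity>M\<in>SL2Z. ?f M)"
    unfolding infsum_cmult_left' by (simp add: norm_mult norm_power)
  also have "\<dots> \<le> (\<Sum>\<^sub>\<infinity>M\<in>SL2Z. norm (?f M))" using sf by (rule norm_infsum_bound)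
  also have "\<dots> \<le> phi_bound N m" unfolding phi_bound_def using sf sb b by (rule infsum_mono)
  finally show ?thesis .
qed

text \<open>Regular and singular matrices are treated alike, because \<open>phi_anti\<close> is
  holomorphic in \<open>Y\<close> on the disc of radius 1/2 for every matrix. The difference is its
  weighted primitive from 0 to \<open>cnj X\<close>.\<close>

lemma anti_series:
  assumes N: "N \<ge> 2" and X: "X \<noteq> 0" "norm X < ratio_bound / 2"
  shows "(\<lambda>M. phi_loc N m (pp M) (qq M) X (cnj X) - phi_loc N m (pp M) (qq M) X 0) summable_on SL2Z"
    and "((\<lambda>j. - phi_anti_coeff N m j * (of_real (inc_beta0 (1 - (norm X)\<^sup>2) (N + 1) (int (j + 1))) * X powi (- int (j + 1))))
      has_sum (\<Sum>\<^sub>\<infinity>M\<in>SL2Z. phi_loc N m (pp M) (qq M) X (cnj X) - phi_loc N m (pp M) (qq M) X 0)) UNIV"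
proof -
  have X1: "norm X < 1/4" using X ratio_bound(2) by simp
  define W where "W n Y = (\<Sum>i\<le>N. of_nat (N choose i) * (-1) ^ i * X ^ i * Y ^ (n + i + 1) / of_nat (n + i + 1))" for n Y
  let ?D = "norm (complex_of_real (4 * Im \<zeta> * Im \<rho>))"
  let ?K = "\<lambda>M. ?D ^ (N + 1) * cutoff_slope N m * 2 ^ m * 2 ^ (m + N + 2) * inverse (norm (qq M) ^ (N + 2))"
  let ?V = "\<lambda>M. phi_loc N m (pp M) (qq M) X (cnj X) - phi_loc N m (pp M) (qq M) X 0"
  have hol: "phi_anti N m (pp M) (qq M) holomorphic_on ball 0 (1/2)" if "M \<in> SL2Z" for M
    using pq[OF that] by (rule phi_anti_holomorphic)
  have bound: "norm (phi_anti N m (pp M) (qq M) Y) \<le> ?K M" if "M \<in> SL2Z" "Y \<in> ball 0 (1/2)" for M Y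
    using norm_phi_anti_le[OF pq[OF that(1)], of Y N m] that(2) unfolding discriminant[OF that(1)] by simp
  have K: "?K summable_on SL2Z" using N by (intro qq_summable) auto
  have prim: "norm (W n (cnj X)) \<le> 2 ^ N * (1/4) ^ n"
    "(\<lambda>n. taylor_coeff (phi_anti N m (pp M) (qq M)) n * W n (cnj X)) sums ?V M" if M: "M \<in> SL2Z" for M n
  proof -
    have "(phi_loc N m (pp M) (qq M) X has_field_derivative (1 - X * Y) ^ N * phi_anti N m (pp M) (qq M) Y) (at Y)"
      if "norm Y < 1/4" for Y
      using that X X1 by (intro has_field_derivative_phi_loc pq M phi_numerator_nonzero) auto
    from weighted_power_series_primitive[OF hol[OF M] bound[OF M] _ _ _ _ this, of "1/4" "cnj X"]
    show "norm (W n (cnj X)) \<le> 2 ^ N * (1/4) ^ n"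
      "(\<lambda>n. taylor_coeff (phi_anti N m (pp M) (qq M)) n * W n (cnj X)) sums ?V M"
      using X1 unfolding W_def by auto
  qed
  have wb: "norm (W n (cnj X)) \<le> 2 ^ N * (1/4) ^ n" for n
  proof -
    \<comment> \<open>The bound does not mention the matrix, so it is taken from the identity matrix
      as a witness that the group is inhabited.\<close>
    have "mat 1 \<in> (SL2Z :: (int^2^2) set)" by (simp add: SL2Z_def)
    then show ?thesis by (rule prim(1))
  qed
  note F = family_power_series[OF hol bound K wb _ _ prim(2)]
  show "?V summable_on SL2Z" by (rule F(1)) auto
  have "((\<lambda>j. phi_anti_coeff N m j * W j (cnj X)) has_sum infsum ?V SL2Z) UNIV"
    unfolding phi_anti_coeff_def by (rule F(2)) auto
  \<comment> \<open>Dividing \<open>(X * cnj X) ^ (j + 1 + i)\<close> by \<open>X ^ (j + 1)\<close>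
    leaves \<open>X ^ i * cnj X ^ (j + i + 1)\<close>, the terms of \<open>W j\<close>. The sign is
    that of \<open>inc_beta0_eq\<close>.\<close>
  moreover have "W j (cnj X) = - (of_real (inc_beta0 (1 - (norm X)\<^sup>2) (N + 1) (int (j + 1))) * X powi (- int (j + 1)))" for j
  proof -
    have "(norm X)\<^sup>2 \<le> 1" using X1 by (simp add: power_le_one)
    then have "- inc_beta0 (1 - (norm X)\<^sup>2) (N + 1) (int (j + 1)) = beta_primitive N (j + 1) ((norm X)\<^sup>2)"
      using inc_beta0_eq[of "j + 1"] by simp
    then have "- (of_real (inc_beta0 (1 - (norm X)\<^sup>2) (N + 1) (int (j + 1))) * X powi (- int (j + 1))) =
        beta_primitive N (j + 1) (X * cnj X) * inverse (X ^ (j + 1))"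
      unfolding complex_norm_square[symmetric] of_real_beta_primitive[symmetric]
      by (simp only: of_real_minus[symmetric] mult_minus_left[symmetric] power_int_minus power_int_of_nat)
    also have "\<dots> = W j (cnj X)"
      unfolding beta_primitive_def W_def sum_distrib_right
    proof (intro sum.cong refl)
      fix i
      have "(X * cnj X) ^ (j + i + 1) * inverse (X ^ (j + 1)) = X ^ i * cnj X ^ (j + i + 1)"
        using X(1) by (simp add: power_mult_distrib power_add field_simps)
      moreover have "j + 1 + i = j + i + 1" by simp
      moreover have "c * s * v / d * u = c * s * (v * u) / d" for c s v d u :: complex by simp
      ultimately show "of_nat (N choose i) * (-1) ^ i * (X * cnj X) ^ (j + 1 + i) / of_nat (j + 1 + i) * inverse (X ^ (j + 1)) =
          of_nat (N choose i) * (-1) ^ i * X ^ i * cnj X ^ (j + i + 1) / of_nat (j + i + 1)"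
        by (simp only: mult.assoc)
    qed
    finally show ?thesis by simp
  qed
  ultimately show "((\<lambda>j. - phi_anti_coeff N m j * (of_real (inc_beta0 (1 - (norm X)\<^sup>2) (N + 1) (int (j + 1))) * X powi (- int (j + 1))))
      has_sum infsum ?V SL2Z) UNIV"
    by (simp only: mult_minus_left mult_minus_right)
qed

lemma hol_series:
  assumes N: "N \<ge> 2" and X: "X \<noteq> 0" "norm X < ratio_bound / 2"
  shows "(\<lambda>M. phi_loc N m (pp M) (qq M) X 0) summable_on SL2Z"
    and "((\<lambda>j. (if j \<ge> 0 then \<Sum>\<^sub>\<infinity>M\<in>regular. taylor_coeff (phi_hol N m (pp M) (qq M)) (nat j)
        else if j = - int m - 1 then phi_residue N m else 0) * X powi j)
      has_sum (\<Sum>\<^sub>\<infinity>M\<in>SL2Z. phi_loc N m (pp M) (qq M) X 0)) UNIV"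
proof -
  let ?f = "\<lambda>M. phi_loc N m (pp M) (qq M) X 0"
  let ?h = "\<lambda>M. phi_hol N m (pp M) (qq M) X"
  let ?g = "\<lambda>M. qq M ^ (N + m + 1) * inverse (- cnj (qq M)) ^ (m + 1)"
  let ?D = "4 * Im \<zeta> * Im \<rho>"
  have D: "?D > 0" using \<zeta> \<rho> by simp
  have nD: "norm (qq M * cnj (qq M) - pp M * cnj (pp M)) = ?D" if "M \<in> SL2Z" for M
    unfolding discriminant[OF that] norm_of_real using D by simp
  have hb: "norm (phi_hol N m (pp M) (qq M) X) \<le> (?D ^ (N + 1) * (2 / ratio_bound) ^ (m + 1) *
    (\<Sum>l\<le>m. of_nat ((N + l) choose l) * 2 ^ m)) * inverse (norm (qq M) ^ (N + 2))"
    if "M \<in> regular" "norm X \<le> ratio_bound / 2" for M X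
    using norm_phi_hol_le[OF pq ratio_bound(1,3,4), of M X N m] that regular_imp nD[of M] by simp
  have hh: "phi_hol N m (pp M) (qq M) holomorphic_on ball 0 (ratio_bound / 2)" if "M \<in> regular" for M
    using local_terms_holomorphic(2)[OF pq ratio_bound(1,3,4)] that regular_imp by blast
  have R: "?h summable_on regular"
    "((\<lambda>j. (\<Sum>\<^sub>\<infinity>M\<in>regular. taylor_coeff (phi_hol N m (pp M) (qq M)) j) * X ^ j) has_sum infsum ?h regular) UNIV"
    by (rule regular_series[OF N X(2) hh hb]; assumption)+
  have fh: "?f M = ?h M" if "M \<in> regular" for M
    using regular_imp[OF that] X ratio_bound(2) by (intro phi_loc_zero pq phi_numerator_nonzero) auto
  have R1: "?f summable_on regular" using R(1) summable_on_cong[of regular ?f ?h] fh by simp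
  have R2: "infsum ?f regular = infsum ?h regular" using fh by (rule infsum_cong)
  have sing: "?f M = ?g M * X powi (- int m - 1)" if "M \<in> singular" for M
  proof -
    have q: "qq M \<noteq> 0" using qq_pos singular_imp(1)[OF that] by auto
    have "- int m - 1 = - int (m + 1)" by simp
    then have "X powi (- int m - 1) = inverse X ^ (m + 1)"
      by (simp only: power_int_minus power_int_of_nat power_inverse)
    moreover have "inverse (- cnj (qq M) * X) ^ (m + 1) = inverse (- cnj (qq M)) ^ (m + 1) * inverse X ^ (m + 1)"
      by (simp only: power_mult_distrib[symmetric] inverse_mult_distrib[symmetric])
    ultimately show ?thesis
      using phi_loc_zero_centre[OF q, of N m X] singular_imp(2)[OF that] by (simp only: mult.assoc)
  qed
  have sb: "norm (?g M) \<le> ?D ^ (N + 1) * inverse (norm (qq M) ^ (N + 2))" if "M \<in> singular" for M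
  proof -
    let ?q = "norm (qq M)"
    have q: "?q > 0" using qq_pos singular_imp(1)[OF that] .
    \<comment> \<open>For \<open>p = 0\<close> the invariant \<open>|q|^2 - |p|^2\<close> fixes
      \<open>|q|\<close>, so the factor \<open>|q|^N\<close> can be traded for the summable
      \<open>|q|^(-N-2)\<close> at the cost of a constant.\<close>
    have Dq: "?D = ?q ^ 2"
      using nD[OF singular_imp(1)[OF that]] singular_imp(2)[OF that] by (simp add: norm_mult power2_eq_square)
    have "norm (?g M) = ?q ^ (N + m + 1) * inverse ?q ^ (m + 1)"
      by (simp add: norm_mult norm_power norm_inverse)
    also have "\<dots> = ?q ^ N" using q by (simp add: power_add field_simps)
    also have "\<dots> = ?D ^ (N + 1) * inverse (?q ^ (N + 2))"
    proof -
      have "?D ^ (N + 1) = ?q ^ N * ?q ^ (N + 2)"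
        unfolding Dq power_mult[symmetric] power_add[symmetric] by (simp add: mult_2)
      moreover have "?q ^ (N + 2) * inverse (?q ^ (N + 2)) = 1" using q by (intro right_inverse) simp
      ultimately show ?thesis by (simp only: mult.assoc mult_1_right)
    qed
    finally show ?thesis by simp
  qed
  have S: "?f summable_on singular" "infsum ?f singular = infsum ?g singular * X powi (- int m - 1)"
    by (rule singular_series[OF N sing sb]; assumption)+
  show "?f summable_on SL2Z"
    unfolding SL2Z_split(1) using R1 S(1) SL2Z_split(2) by (rule summable_on_Un_disjoint)
  show "((\<lambda>j. (if j \<ge> 0 then \<Sum>\<^sub>\<infinity>M\<in>regular. taylor_coeff (phi_hol N m (pp M) (qq M)) (nat j)
        else if j = - int m - 1 then phi_residue N m else 0) * X powi j) has_sum infsum ?f SL2Z) UNIV"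
    unfolding infsum_split[OF R1 S(1)] S(2) R2
    using laurent_has_sum[OF R(2), where m = m and \<kappa> = "phi_residue N m"] unfolding phi_residue_def .
qed

lemma PP_eq:
  assumes k: "k > 1" and z: "Im z > 0"
  shows "inverse (of_real (beta_const (2 * k - 1) (- (- int m - 1)))) * PP k \<zeta> (- int m - 1) z =
    (z - cnj \<rho>) powi (2 * int k - 2) * (inverse ((\<rho> - cnj \<rho>) ^ (2 * k - 2)) *
      (\<Sum>\<^sub>\<infinity>M\<in>SL2Z. phi_loc (2 * k - 2) m (pp M) (qq M) (ell_X \<rho> z) (cnj (ell_X \<rho> z))))"
proof -
  define C where "C = complex_of_real (beta_const (2 * k - 1) (int (m + 1)))"
  have "2 * k - 1 = (2 * k - 2) + 1" using k by simp
  then have C: "C \<noteq> 0" using beta_const_nonzero[of "2 * k - 2" m] by (simp add: C_def)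
  have C': "complex_of_real (beta_const (2 * k - 1) (- (- int m - 1))) = C" by (simp add: C_def)
  have "PP k \<zeta> (- int m - 1) z = (\<Sum>\<^sub>\<infinity>M\<in>SL2Z. C * ((z - cnj \<rho>) powi (2 * int k - 2) *
     (inverse ((\<rho> - cnj \<rho>) ^ (2 * k - 2)) * phi_loc (2 * k - 2) m (pp M) (qq M) (ell_X \<rho> z) (cnj (ell_X \<rho> z)))))"
    unfolding PP_def C_def using k z by (intro infsum_cong PP_term) auto
  then show ?thesis unfolding C' infsum_cmult_right' using C by simp
qed

text \<open>The growth order \<open>m + 1\<close> is the order of the pole of the singular summands.
  The power \<open>Y^j\<close> in the Taylor series of \<open>phi_anti\<close> yields the
  nonmeromorphic term of index \<open>- j - 1\<close>, so only negative indices occur and the finite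
  middle sum is zero.\<close>

lemma PP_expansion:
  assumes k: "k > 1"
  shows "has_harmonic_elliptic_expansion k
    (\<lambda>z. inverse (of_real (beta_const (2 * k - 1) (- (- int m - 1)))) * PP k \<zeta> (- int m - 1) z) \<rho> (m + 1)
    (\<lambda>j. inverse ((\<rho> - cnj \<rho>) ^ (2 * k - 2)) *
       (if j \<ge> 0 then \<Sum>\<^sub>\<infinity>M\<in>regular. taylor_coeff (phi_hol (2 * k - 2) m (pp M) (qq M)) (nat j)
        else if j = - int m - 1 then phi_residue (2 * k - 2) m else 0))
    (\<lambda>j. if j < 0 then - (inverse ((\<rho> - cnj \<rho>) ^ (2 * k - 2)) * phi_anti_coeff (2 * k - 2) m (nat (- j - 1))) else 0)"
  (is "has_harmonic_elliptic_expansion _ ?F _ _ (\<lambda>j. _ * ?c j) ?d")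
proof -
  define N where "N = 2 * k - 2"
  define \<kappa> where "\<kappa> = inverse ((\<rho> - cnj \<rho>) ^ N)"
  have N: "N \<ge> 2" and N1: "2 * k - 1 = N + 1" using k by (simp_all add: N_def)
  define nk where "nk = int (min (2 * k - 2) (m + 1))"
  let ?G = "\<lambda>X. \<Sum>\<^sub>\<infinity>M\<in>SL2Z. phi_loc N m (pp M) (qq M) X (cnj X)"
  have ev: "\<forall>\<^sub>F z in at \<rho>. Im z > 0 \<and> ell_X \<rho> z \<noteq> 0 \<and> norm (ell_X \<rho> z) < ratio_bound / 2"
    using \<rho> ratio_bound(1) by (intro eventually_at_ell_X) auto
  have Feq: "?F z = (z - cnj \<rho>) powi (2 * int k - 2) * (\<kappa> * ?G (ell_X \<rho> z))" if "Im z > 0" for z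
    unfolding \<kappa>_def N_def using PP_eq[OF k that] .
  have bfun: "Bfun (\<lambda>z. of_real (ell_r \<rho> z ^ (m + 1)) * ?F z) (at \<rho>)"
  proof (rule BfunI)
    have "((\<lambda>z. norm (z - cnj \<rho>)) \<longlongrightarrow> norm (\<rho> - cnj \<rho>)) (at \<rho>)" by (intro tendsto_intros)
    then have "\<forall>\<^sub>F z in at \<rho>. norm (z - cnj \<rho>) < norm (\<rho> - cnj \<rho>) + 1" by (rule order_tendstoD) simp
    with ev show "\<forall>\<^sub>F z in at \<rho>. norm (of_real (ell_r \<rho> z ^ (m + 1)) * ?F z) \<le>
        (norm (\<rho> - cnj \<rho>) + 1) ^ N * (norm \<kappa> * phi_bound N m)"
    proof eventually_elim
      case (elim z)
      have zp: "(z - cnj \<rho>) powi (2 * int k - 2) = (z - cnj \<rho>) ^ N"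
      proof -
        have "2 * int k - 2 = int N" using k by (simp add: N_def)
        then show ?thesis by (simp only: power_int_of_nat)
      qed
      have "norm (of_real (ell_r \<rho> z ^ (m + 1)) * ?F z) =
          norm (z - cnj \<rho>) ^ N * (norm \<kappa> * (norm (?G (ell_X \<rho> z)) * norm (ell_X \<rho> z) ^ (m + 1)))"
        unfolding Feq[OF conjunct1[OF elim(1)]] zp by (simp add: norm_mult norm_power ell_r_def mult_ac)
      also have "\<dots> \<le> (norm (\<rho> - cnj \<rho>) + 1) ^ N * (norm \<kappa> * phi_bound N m)"
        using elim by (intro mult_mono power_mono mult_left_mono norm_infsum_phi_loc_le N) auto
      finally show ?case .
    qed
  qed
  have "\<forall>\<^sub>F z in at \<rho>. \<exists>S T.
          ((\<lambda>n. \<kappa> * ?c n * ell_X \<rho> z powi n) has_sum S) {- int (m + 1)..} \<and>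
          ((\<lambda>n. ?d n * of_real (inc_beta0 (1 - (ell_r \<rho> z)\<^sup>2) (2 * k - 1) (-n)) * ell_X \<rho> z powi n)
             has_sum T) {n. n \<le> int (m + 1) \<and> n \<notin> {0..nk}} \<and>
          ?F z = (z - cnj \<rho>) powi (2 * int k - 2) *
            (S + (\<Sum>n=0..nk. ?d n * of_real (inc_beta (1 - (ell_r \<rho> z)\<^sup>2) (2 * k - 1) (-n)) * ell_X \<rho> z powi n) + T)"
    using ev
  proof eventually_elim
    case (elim z)
    define X where "X = ell_X \<rho> z"
    have X: "X \<noteq> 0" "norm X < ratio_bound / 2" using elim by (auto simp: X_def)
    let ?S = "\<Sum>\<^sub>\<infinity>M\<in>SL2Z. phi_loc N m (pp M) (qq M) X 0"
    let ?T = "\<Sum>\<^sub>\<infinity>M\<in>SL2Z. phi_loc N m (pp M) (qq M) X (cnj X) - phi_loc N m (pp M) (qq M) X 0"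
    note H = hol_series[OF N X, of m] and A = anti_series[OF N X, of m]
    have S: "((\<lambda>n. \<kappa> * ?c n * X powi n) has_sum (\<kappa> * ?S)) {- int (m + 1)..}"
    proof -
      have "((\<lambda>n. \<kappa> * (?c n * X powi n)) has_sum (\<kappa> * ?S)) UNIV"
        using has_sum_cmult_right[OF H(2)] unfolding N_def .
      then have "((\<lambda>n. \<kappa> * (?c n * X powi n)) has_sum (\<kappa> * ?S)) {- int (m + 1)..}"
        by (rule has_sum_cong_neutral[THEN iffD1, rotated -1]) auto
      then show ?thesis by (simp only: mult.assoc)
    qed
    have T: "((\<lambda>n. ?d n * of_real (inc_beta0 (1 - (norm X)\<^sup>2) (2 * k - 1) (-n)) * X powi n)
             has_sum (\<kappa> * ?T)) {n. n \<le> int (m + 1) \<and> n \<notin> {0..nk}}"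
    proof -
      let ?t = "\<lambda>n. ?d n * of_real (inc_beta0 (1 - (norm X)\<^sup>2) (2 * k - 1) (-n)) * X powi n"
      have "((\<lambda>j. \<kappa> * (- phi_anti_coeff N m j * (of_real (inc_beta0 (1 - (norm X)\<^sup>2) (N + 1) (int (j + 1))) * X powi (- int (j + 1)))))
          has_sum (\<kappa> * ?T)) UNIV"
        by (rule has_sum_cmult_right[OF A(2)])
      moreover have "\<kappa> * (- phi_anti_coeff N m j * (of_real (inc_beta0 (1 - (norm X)\<^sup>2) (N + 1) (int (j + 1))) * X powi (- int (j + 1)))) =
          ?t (- int (j + 1))" for j
      proof -
        have "nat (- (- int (j + 1)) - 1) = j" "- int (j + 1) < 0" by simp_all
        then show ?thesis unfolding N1 N_def[symmetric] \<kappa>_def[symmetric] by (simp only: if_True minus_minus mult_minus_left mult_minus_right mult.assoc)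
      qed
      ultimately have "((\<lambda>j::nat. ?t (- int (j + 1))) has_sum (\<kappa> * ?T)) UNIV" by (simp only:)
      also have "?this \<longleftrightarrow> (?t has_sum (\<kappa> * ?T)) {..<0}"
        by (rule has_sum_reindex_bij_witness[of _ "\<lambda>n. nat (- n - 1)" "\<lambda>j. - int (j + 1)"]) auto
      finally show ?thesis
        by (rule has_sum_cong_neutral[THEN iffD1, rotated -1]) auto
    qed
    have mid: "(\<Sum>n=0..nk. ?d n * of_real (inc_beta (1 - (norm X)\<^sup>2) (2 * k - 1) (-n)) * X powi n) = 0"
      by (intro sum.neutral) auto
    have "?G X = ?S + ?T"
      using infsum_add[OF H(1) A(1)] by simp
    then have FS: "?F z = (z - cnj \<rho>) powi (2 * int k - 2) * (\<kappa> * ?S + 0 + \<kappa> * ?T)"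
      using Feq[OF conjunct1[OF elim]] unfolding X_def[symmetric] by (simp only: ring_distribs add_0_right)
    show ?case
      unfolding ell_r_def X_def[symmetric]
      by (intro exI conjI, rule S, rule T, subst mid, rule FS)
  qed
  note expansion = this[unfolded \<kappa>_def N_def]
  have zero: "\<forall>n < - int (m + 1). inverse ((\<rho> - cnj \<rho>) ^ (2 * k - 2)) * ?c n = 0" by auto
  show ?thesis
    unfolding has_harmonic_elliptic_expansion_def Let_def nk_def[symmetric]
    by (intro conjI bfun zero expansion)
qed

lemma Psi_coeff_eq:
  assumes "k > 1"
  shows "Psi_coeff k \<zeta> \<rho> (- int n - 1) (int m) =
    (\<rho> - cnj \<rho>) ^ (2 * k) * (\<Sum>\<^sub>\<infinity>M\<in>regular. taylor_coeff (psi_loc (2 * k - 2) n (pp M) (qq M)) m)"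
  unfolding Psi_coeff_def elliptic_coeff_eq[OF \<rho> Psi_expansion[OF assms]] by simp

lemma PP_coeff_eq:
  assumes "k > 1"
  shows "PP_coeff k \<zeta> \<rho> (- int m - 1) (int n) =
    inverse ((\<rho> - cnj \<rho>) ^ (2 * k - 2)) * (\<Sum>\<^sub>\<infinity>M\<in>regular. taylor_coeff (phi_hol (2 * k - 2) m (pp M) (qq M)) n)"
  unfolding PP_coeff_def by (subst elliptic_coeff_plus_eq[OF \<rho> _ PP_expansion[OF assms]]) simp_all

end

section \<open>The duality of the coefficients\<close>

lemma diff_cnj: "z - cnj z = 2 * \<i> * of_real (Im z)"
  by (simp add: complex_eq_iff)

text \<open>Since \<open>z - cnj z = 2 i Im z\<close>, the power \<open>2k - 2\<close> of
  \<open>D = 4 Im z1 Im z2\<close> is the product of the same powers of \<open>z1 - cnj z1\<close>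
  and \<open>z2 - cnj z2\<close>. The last factor is
  \<open>D = - (Im z1 / Im z2) * (z2 - cnj z2)^2\<close>, which accounts for both the sign and the
  quotient of heights.\<close>

lemma duality_constant:
  assumes "Im z1 > 0" "Im z2 > 0" "k \<ge> 1"
  shows "inverse ((z1 - cnj z1) ^ (2 * k - 2)) * of_real (4 * Im z1 * Im z2) ^ (2 * k - 2 + 1) =
    - of_real (Im z1 / Im z2) * (z2 - cnj z2) ^ (2 * k)"
proof -
  obtain j where k: "k = Suc j" using assms(3) by (cases k) auto
  define a b where "a = complex_of_real (Im z1)" and "b = complex_of_real (Im z2)"
  have ab: "a \<noteq> 0" "b \<noteq> 0" using assms by (auto simp: a_def b_def)
  have sq': "(2 * \<i> * c) ^ (2 * j) = (- 4) ^ j * (c ^ j * c ^ j)" for c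
  proof -
    have "(2 * \<i> * c)\<^sup>2 = - 4 * (c * c)" by (simp add: power2_eq_square)
    then show ?thesis by (simp only: power_mult power_mult_distrib)
  qed
  have sq: "(z1 - cnj z1) ^ (2 * j) = (- 4) ^ j * (a ^ j * a ^ j)" "(z2 - cnj z2) ^ (2 * j) = (- 4) ^ j * (b ^ j * b ^ j)"
    unfolding diff_cnj a_def[symmetric] b_def[symmetric] by (rule sq')+
  have "inverse ((z1 - cnj z1) ^ (2 * j)) * (4 * a * b) ^ (2 * j + 1) = - (a / b) * ((z2 - cnj z2) ^ (2 * j) * (z2 - cnj z2) ^ 2)"
  proof -
    have z22: "(z2 - cnj z2) ^ 2 = - 4 * (b * b)"
      unfolding diff_cnj b_def[symmetric] by (simp add: power2_eq_square)
    have 16: "(4 * a * b) ^ (2 * j + 1) = ((- 4) ^ j * (- 4) ^ j) * (a ^ j * a ^ j) * (b ^ j * b ^ j) * (4 * a * b)"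
    proof -
      have "(4 * a * b)\<^sup>2 = ((- 4) * (- 4)) * (a * a) * (b * b)" by (simp add: power2_eq_square)
      then have "(4 * a * b) ^ (2 * j) = ((- 4) ^ j * (- 4) ^ j) * (a ^ j * a ^ j) * (b ^ j * b ^ j)"
        by (simp only: power_mult power_mult_distrib)
      then show ?thesis by (simp only: power_add power_one_right)
    qed
    have ne: "(- 4 :: complex) ^ j * (a ^ j * a ^ j) \<noteq> 0" using ab by simp
    have "inverse ((- 4) ^ j * (a ^ j * a ^ j)) * (((- 4) ^ j * (- 4) ^ j) * (a ^ j * a ^ j) * (b ^ j * b ^ j) * (4 * a * b))
       = ((- 4) ^ j * (b ^ j * b ^ j)) * (4 * a * b)"
      using ne by (simp add: field_simps)
    also have "\<dots> = - (a / b) * (((- 4) ^ j * (b ^ j * b ^ j)) * (- 4 * (b * b)))"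
      using ab by simp
    finally show ?thesis unfolding sq z22 16 .
  qed
  moreover have "(z2 - cnj z2) ^ (2 * Suc j) = (z2 - cnj z2) ^ (2 * j) * (z2 - cnj z2) ^ 2"
    by (simp only: power_add[symmetric]) simp
  moreover have "2 * k - 2 = 2 * j" "2 * k = 2 * Suc j" by (simp_all add: k)
  moreover have "complex_of_real (4 * Im z1 * Im z2) = 4 * a * b" "complex_of_real (Im z1 / Im z2) = a / b"
    by (simp_all add: a_def b_def)
  ultimately show ?thesis by (metis (no_types, lifting))
qed

theorem theorem1p2:
  fixes k m n :: nat and z1 z2 :: complex
  assumes "k > 1" and "Im z1 > 0" and "Im z2 > 0"
  shows "PP_coeff k z2 z1 (- int m - 1) (int n) =
         - of_real (Im z1 / Im z2) * Psi_coeff k z1 z2 (- int n - 1) (int m)"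
proof -
  define N where "N = 2 * k - 2"
  interpret psi: upper_half_points z1 z2 using assms(2,3) by unfold_locales
  interpret phi: upper_half_points z2 z1 using assms(2,3) by unfold_locales
  \<comment> \<open>The inverse matrix turns the pair \<open>(p, q)\<close> at \<open>z2\<close>
    into \<open>(- p, - cnj q)\<close> at \<open>z1\<close>; in particular it maps regular matrices
    to regular ones.\<close>
  have lin_adj': "lin (adj M) z2 z1 = - lin M z1 z2" "lin (adj M) (cnj z2) z1 = - cnj (lin M (cnj z1) z2)" for M
    by (simp_all add: lin_adj cnj_lin)
  have bij: "bij_betw adj psi.regular phi.regular"
  proof (rule bij_betw_subset[OF bij_betw_adj_SL2Z psi.SL2Z_split(3)])
    show "adj ` psi.regular = phi.regular"
    proof
      show "adj ` psi.regular \<subseteq> phi.regular"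
        using bij_betwE[OF bij_betw_adj_SL2Z] by (auto simp: psi.regular_def phi.regular_def lin_adj')
      show "phi.regular \<subseteq> adj ` psi.regular"
      proof
        fix M assume M: "M \<in> phi.regular"
        then obtain M' where "M' \<in> SL2Z" "M = adj M'"
          using bij_betw_adj_SL2Z phi.SL2Z_split(3) by (auto simp: bij_betw_def)
        then show "M \<in> adj ` psi.regular" using M by (auto simp: psi.regular_def phi.regular_def lin_adj')
      qed
    qed
  qed
  have term_eq: "taylor_coeff (phi_hol N m (lin (adj M) z2 z1) (lin (adj M) (cnj z2) z1)) n =
      of_real (4 * Im z1 * Im z2) ^ (N + 1) * taylor_coeff (psi_loc N n (lin M z1 z2) (lin M (cnj z1) z2)) m"
    if "M \<in> psi.regular" for M
    unfolding lin_adj' using taylor_coeff_duality[OF psi.pq[of M], of N m n] psi.regular_imp[OF that] psi.discriminant[of M]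
    by (simp add: N_def)
  have "PP_coeff k z2 z1 (- int m - 1) (int n) = inverse ((z1 - cnj z1) ^ N) *
      (\<Sum>\<^sub>\<infinity>M\<in>phi.regular. taylor_coeff (phi_hol N m (lin M z2 z1) (lin M (cnj z2) z1)) n)"
    using phi.PP_coeff_eq[OF assms(1)] by (simp only: N_def)
  also have "(\<Sum>\<^sub>\<infinity>M\<in>phi.regular. taylor_coeff (phi_hol N m (lin M z2 z1) (lin M (cnj z2) z1)) n) =
      (\<Sum>\<^sub>\<infinity>M\<in>psi.regular. taylor_coeff (phi_hol N m (lin (adj M) z2 z1) (lin (adj M) (cnj z2) z1)) n)"
    using infsum_reindex_bij_betw[OF bij, of "\<lambda>M. taylor_coeff (phi_hol N m (lin M z2 z1) (lin M (cnj z2) z1)) n"] by simp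
  also have "\<dots> = (\<Sum>\<^sub>\<infinity>M\<in>psi.regular. of_real (4 * Im z1 * Im z2) ^ (N + 1) *
      taylor_coeff (psi_loc N n (lin M z1 z2) (lin M (cnj z1) z2)) m)"
    using term_eq by (rule infsum_cong)
  also have "\<dots> = of_real (4 * Im z1 * Im z2) ^ (N + 1) *
      (\<Sum>\<^sub>\<infinity>M\<in>psi.regular. taylor_coeff (psi_loc N n (lin M z1 z2) (lin M (cnj z1) z2)) m)"
    by (rule infsum_cmult_right')
  also have "inverse ((z1 - cnj z1) ^ N) * (of_real (4 * Im z1 * Im z2) ^ (N + 1) *
      (\<Sum>\<^sub>\<infinity>M\<in>psi.regular. taylor_coeff (psi_loc N n (lin M z1 z2) (lin M (cnj z1) z2)) m)) =
      - of_real (Im z1 / Im z2) * ((z2 - cnj z2) ^ (2 * k) *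
      (\<Sum>\<^sub>\<infinity>M\<in>psi.regular. taylor_coeff (psi_loc N n (lin M z1 z2) (lin M (cnj z1) z2)) m))"
    using duality_constant[OF assms(2,3), of k] assms(1)
    by (simp only: N_def mult.assoc[symmetric])
  also have "\<dots> = - of_real (Im z1 / Im z2) * Psi_coeff k z1 z2 (- int n - 1) (int m)"
    using psi.Psi_coeff_eq[OF assms(1)] by (simp only: N_def)
  finally show ?thesis .
qed

end
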